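(* Let $R$ be a uniformly non-amenable ergodic equivalence relation of type $\mathrm{II}_1$. Then $R$ contains a non-amenable subtreeing.
   Context: Let $(X,\mu)$ be a standard non-atomic probability space. A measured equivalence relation $R$ on $(X,\mu)$ is an equivalence relation on $X$ with countable classes, Borel as a subset of $X\times X$, such that saturations of $\mu$-null sets are $\mu$-null. It is ergodic if every saturated measurable set has measure $0$ or $1$. A partial automorphism of $R$ is a bimeasurable bijection between measurable subsets of $X$ whose graph lies in $R$; $[R]$ is the group of (full) automorphisms of $R$, i.e. those with domain and image $X$. $R$ is of type $\mathrm{II}_1$ if $\mu$ is invariant under every partial automorphism of $R$. Put $R^x=\{(x,y)\in R\}$ and $\mathfrak h(E)=\int_X|E\cap R^x|\,d\mu(x)$ for measurable $E\subset R$. A graphing of $R$ is a countable family $\Phi=\{\varphi_i\}$ of partial automorphisms of $R$ such that for almost every $(x,y)\in R$ one has $y=\psi_n\cdots\psi_1(x)$ for some $\psi_1,\dots,\psi_n\in\Phi\cup\Phi^{-1}$; equivalently, it is described by a measurable subset $K\subset R$ generating $R$ up to null sets. It is finite if it can be partitioned into finitely many partial automorphisms; $R$ is finitely generated if it has a finite graphing. A treeing is a graphing with no simple cycle (almost every associated graph is a forest). A subtreeing of $R$ is a treeing $F\subset R$ of an equivalence subrelation of $R$; it is non-amenable if the equivalence subrelation it generates is non-amenable (in the usual sense for measured equivalence relations, i.e. not hyperfinite). Isoperimetric constant: for a finite graphing $K\subset R$, the Cayley graph $\Sigma=\Sigma_K=\coprod_{x\in X}\Sigma^x$ is the measurable field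 of graphs where $\Sigma^x$ has vertex set $R^x$ and edges the pairs $((x,y),(x,z))\in R^x\times R^x$ with $(y,z)\in K$. Let $\Sigma^{(1)}$ be its set of edges and $\nu^{(1)}(E)=\int_X|E\cap\Sigma^x|\,d\mu(x)$ for measurable $E\subset\Sigma^{(1)}$. A symmetric vertex of $\Sigma$ is the graph $\{(x,\varphi(x)):x\in X\}\subset R$ of an element $\varphi\in[R]$; two are disjoint if their intersection is $\mathfrak h$-null. For a finite set $A$ of symmetric vertices, $\partial_K A\subset\Sigma^{(1)}$ is the set of edges of $\Sigma$ with one vertex in (the union of) $A$ and the other outside. Then $h_K(R)=\inf_A\nu^{(1)}(\partial_KA)/|A|$ over non-empty finite sets $A$ of pairwise disjoint symmetric vertices of $\Sigma_K$, and for finitely generated $R$, $h(R)=\inf_K h_K(R)$ over all finite graphings $K$ of $R$. For infinitely generated $R$, $h(R)=\sup_{R'}h(R')$ over finitely generated subrelations $R'$ of $R$. An ergodic equivalence relation of type $\mathrm{II}_1$ is uniformly non-amenable if $h(R)>0$. *)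

theory Defs
  imports "HOL-Probability.Probability_Measure"
begin

section \<open>Standard non-atomic probability spaces\<close>

text \<open>A standard Borel space carries the Borel \<open>\<sigma>\<close>-algebra of some Polish topology. The topology
  is a carrier-based one, so that a standard space need not exhaust its type.\<close>

definition standard_borel_space :: "'a measure \<Rightarrow> bool" where
  "standard_borel_space M \<longleftrightarrow>
     (\<exists>T. completely_metrizable_space T \<and> second_countable T \<and> topspace T = space M \<and>
          sets M = sigma_sets (topspace T) {U. openin T U})"

definition non_atomic :: "'a measure \<Rightarrow> bool" where
  "non_atomic M \<longleftrightarrow>
     (\<forall>A\<in>sets M. emeasure M A > 0 \<longrightarrow>
        (\<exists>B\<in>sets M. B \<subseteq> A \<and> 0 < emeasure M B \<and> emeasure M B < emeasure M A))"

definition standard_non_atomic_prob_space :: "'a measure \<Rightarrow> bool" where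
  "standard_non_atomic_prob_space M \<longleftrightarrow>
     prob_space M \<and> standard_borel_space M \<and> non_atomic M"

section \<open>Measured equivalence relations\<close>

definition measured_equiv_rel :: "'a measure \<Rightarrow> ('a \<times> 'a) set \<Rightarrow> bool" where
  "measured_equiv_rel M R \<longleftrightarrow>
     equiv (space M) R \<and> R \<in> sets (M \<Otimes>\<^sub>M M) \<and>
     (\<forall>x\<in>space M. countable (R `` {x})) \<and>
     (\<forall>N\<in>null_sets M. R `` N \<in> null_sets M)"

definition ergodic_rel :: "'a measure \<Rightarrow> ('a \<times> 'a) set \<Rightarrow> bool" where
  "ergodic_rel M R \<longleftrightarrow>
     (\<forall>A\<in>sets M. R `` A = A \<longrightarrow> emeasure M A = 0 \<or> emeasure M A = 1)"

definition fun_graph :: "'a set \<Rightarrow> ('a \<Rightarrow> 'a) \<Rightarrow> ('a \<times> 'a) set" where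
  "fun_graph A f = (\<lambda>x. (x, f x)) ` A"

text \<open>A partial automorphism is given by its domain \<open>A\<close> and a function \<open>f\<close>, of which only the
  values on \<open>A\<close> are relevant; its image is \<open>f ` A\<close>.\<close>

definition partial_automorphism ::
    "'a measure \<Rightarrow> ('a \<times> 'a) set \<Rightarrow> 'a set \<Rightarrow> ('a \<Rightarrow> 'a) \<Rightarrow> bool" where
  "partial_automorphism M R A f \<longleftrightarrow>
     A \<in> sets M \<and> f ` A \<in> sets M \<and> inj_on f A \<and>
     f \<in> restrict_space M A \<rightarrow>\<^sub>M restrict_space M (f ` A) \<and>
     the_inv_into A f \<in> restrict_space M (f ` A) \<rightarrow>\<^sub>M restrict_space M A \<and>
     fun_graph A f \<subseteq> R"

definition full_group :: "'a measure \<Rightarrow> ('a \<times> 'a) set \<Rightarrow> ('a \<Rightarrow> 'a) set" where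
  "full_group M R = {f. partial_automorphism M R (space M) f \<and> f ` space M = space M}"

definition type_II1 :: "'a measure \<Rightarrow> ('a \<times> 'a) set \<Rightarrow> bool" where
  "type_II1 M R \<longleftrightarrow>
     (\<forall>A f. partial_automorphism M R A f \<longrightarrow>
        (\<forall>B\<in>sets M. B \<subseteq> A \<longrightarrow> emeasure M (f ` B) = emeasure M B))"

definition rel_fibre :: "('a \<times> 'a) set \<Rightarrow> 'a \<Rightarrow> ('a \<times> 'a) set" where
  "rel_fibre R x = {p \<in> R. fst p = x}"

definition rel_measure :: "'a measure \<Rightarrow> ('a \<times> 'a) set \<Rightarrow> ('a \<times> 'a) set \<Rightarrow> ennreal" where
  "rel_measure M R E = (\<integral>\<^sup>+ x. emeasure (count_space UNIV) (E \<inter> rel_fibre R x) \<partial>M)"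

definition rel_null :: "'a measure \<Rightarrow> ('a \<times> 'a) set \<Rightarrow> ('a \<times> 'a) set \<Rightarrow> bool" where
  "rel_null M R E \<longleftrightarrow> (\<exists>N\<in>sets (M \<Otimes>\<^sub>M M). E \<subseteq> N \<and> N \<subseteq> R \<and> rel_measure M R N = 0)"

definition hyperfinite_rel :: "'a measure \<Rightarrow> ('a \<times> 'a) set \<Rightarrow> bool" where
  "hyperfinite_rel M R \<longleftrightarrow>
     (\<exists>S :: nat \<Rightarrow> ('a \<times> 'a) set.
        (\<forall>n. measured_equiv_rel M (S n) \<and> S n \<subseteq> R \<and> S n \<subseteq> S (Suc n) \<and>
             (\<forall>x\<in>space M. finite (S n `` {x}))) \<and>
        rel_null M R (R - (\<Union>n. S n)))"

text \<open>Amenability is taken in the form of hyperfiniteness (Connes--Feldman--Weiss).\<close>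

definition non_amenable_rel :: "'a measure \<Rightarrow> ('a \<times> 'a) set \<Rightarrow> bool" where
  "non_amenable_rel M R \<longleftrightarrow> \<not> hyperfinite_rel M R"

section \<open>Graphings\<close>

text \<open>Graphings are given as measurable subsets \<open>K\<close> of \<open>R\<close>, i.e.\ as the union of the graphs of the
  partial automorphisms. A pair lies in \<open>generated_rel M K\<close> iff it is of the form
  \<open>(x, \<psi>\<^sub>n \<cdots> \<psi>\<^sub>1 x)\<close>, where \<open>n = 0\<close> is allowed. The intersection removes the points outside of the
  space from the reflexive closure.\<close>

definition generated_rel :: "'a measure \<Rightarrow> ('a \<times> 'a) set \<Rightarrow> ('a \<times> 'a) set" where
  "generated_rel M K = (K \<union> K\<inverse>)\<^sup>* \<inter> space M \<times> space M"

definition graphing :: "'a measure \<Rightarrow> ('a \<times> 'a) set \<Rightarrow> ('a \<times> 'a) set \<Rightarrow> bool" where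
  "graphing M R K \<longleftrightarrow>
     K \<in> sets (M \<Otimes>\<^sub>M M) \<and> K \<subseteq> R \<and> rel_null M R (R - generated_rel M K)"

definition finite_graphing :: "'a measure \<Rightarrow> ('a \<times> 'a) set \<Rightarrow> ('a \<times> 'a) set \<Rightarrow> bool" where
  "finite_graphing M R K \<longleftrightarrow>
     graphing M R K \<and>
     (\<exists>P. finite P \<and> partition_on K P \<and>
          (\<forall>V\<in>P. \<exists>A f. partial_automorphism M R A f \<and> V = fun_graph A f))"

definition finitely_generated_rel :: "'a measure \<Rightarrow> ('a \<times> 'a) set \<Rightarrow> bool" where
  "finitely_generated_rel M R \<longleftrightarrow> (\<exists>K. finite_graphing M R K)"

section \<open>Cayley graphs and treeings\<close>

text \<open>An edge is an ordered pair of vertices, and a vertex is an element of \<open>R\<close>; both ends of an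
  edge have the same first coordinate, which is the index of the fibre.\<close>

type_synonym 'a cayley_edge = "('a \<times> 'a) \<times> ('a \<times> 'a)"

definition cayley_edges ::
    "('a \<times> 'a) set \<Rightarrow> ('a \<times> 'a) set \<Rightarrow> 'a cayley_edge set" where
  "cayley_edges R K = {((x, y), (x, z)) | x y z. (x, y) \<in> R \<and> (x, z) \<in> R \<and> (y, z) \<in> K}"

definition edge_fibre :: "'a cayley_edge set \<Rightarrow> 'a \<Rightarrow> 'a cayley_edge set" where
  "edge_fibre E x = {e \<in> E. fst (fst e) = x}"

definition edge_measure :: "'a measure \<Rightarrow> 'a cayley_edge set \<Rightarrow> ennreal" where
  "edge_measure M E = (\<integral>\<^sup>+ x. emeasure (count_space UNIV) (edge_fibre E x) \<partial>M)"

text \<open>Cycles are taken in the underlying undirected graph. Length 1 is a loop; length 2 is excluded,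
  since \<open>(v, w)\<close> and \<open>(w, v)\<close> are the same undirected edge.\<close>

definition simple_cycle :: "('v \<times> 'v) set \<Rightarrow> 'v list \<Rightarrow> bool" where
  "simple_cycle E vs \<longleftrightarrow>
     length vs \<notin> {0, 2} \<and> distinct vs \<and>
     (\<forall>i<length vs. (vs ! i, vs ! (Suc i mod length vs)) \<in> E \<union> E\<inverse>)"

definition forest :: "('v \<times> 'v) set \<Rightarrow> bool" where
  "forest E \<longleftrightarrow> (\<nexists>vs. simple_cycle E vs)"

definition treeing :: "'a measure \<Rightarrow> ('a \<times> 'a) set \<Rightarrow> ('a \<times> 'a) set \<Rightarrow> bool" where
  "treeing M R F \<longleftrightarrow>
     graphing M R F \<and> (AE x in M. forest (edge_fibre (cayley_edges R F) x))"

definition subtreeing :: "'a measure \<Rightarrow> ('a \<times> 'a) set \<Rightarrow> ('a \<times> 'a) set \<Rightarrow> bool" where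
  "subtreeing M R F \<longleftrightarrow> (\<exists>S. measured_equiv_rel M S \<and> S \<subseteq> R \<and> treeing M S F)"

definition non_amenable_subtreeing ::
    "'a measure \<Rightarrow> ('a \<times> 'a) set \<Rightarrow> ('a \<times> 'a) set \<Rightarrow> bool" where
  "non_amenable_subtreeing M R F \<longleftrightarrow>
     subtreeing M R F \<and> non_amenable_rel M (generated_rel M F)"

section \<open>The isoperimetric constant\<close>

definition symmetric_vertices :: "'a measure \<Rightarrow> ('a \<times> 'a) set \<Rightarrow> ('a \<times> 'a) set set" where
  "symmetric_vertices M R = fun_graph (space M) ` full_group M R"

definition disjoint_symmetric_families ::
    "'a measure \<Rightarrow> ('a \<times> 'a) set \<Rightarrow> ('a \<times> 'a) set set set" where
  "disjoint_symmetric_families M R =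
     {A. finite A \<and> A \<noteq> {} \<and> A \<subseteq> symmetric_vertices M R \<and>
         pairwise (\<lambda>V W. rel_null M R (V \<inter> W)) A}"

definition edge_boundary ::
    "('a \<times> 'a) set \<Rightarrow> ('a \<times> 'a) set \<Rightarrow> ('a \<times> 'a) set set \<Rightarrow> 'a cayley_edge set" where
  "edge_boundary R K A = {(v, w) \<in> cayley_edges R K. (v \<in> \<Union>A) \<noteq> (w \<in> \<Union>A)}"

definition isoperimetric_const_wrt ::
    "'a measure \<Rightarrow> ('a \<times> 'a) set \<Rightarrow> ('a \<times> 'a) set \<Rightarrow> ennreal" where
  "isoperimetric_const_wrt M R K =
     (INF A\<in>disjoint_symmetric_families M R.
        edge_measure M (edge_boundary R K A) / of_nat (card A))"

definition isoperimetric_const_fg :: "'a measure \<Rightarrow> ('a \<times> 'a) set \<Rightarrow> ennreal" where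
  "isoperimetric_const_fg M R = (INF K\<in>{K. finite_graphing M R K}. isoperimetric_const_wrt M R K)"

definition isoperimetric_const :: "'a measure \<Rightarrow> ('a \<times> 'a) set \<Rightarrow> ennreal" where
  "isoperimetric_const M R =
     (if finitely_generated_rel M R then isoperimetric_const_fg M R
      else (SUP R'\<in>{R'. measured_equiv_rel M R' \<and> R' \<subseteq> R \<and> finitely_generated_rel M R'}.
              isoperimetric_const_fg M R'))"

definition uniformly_non_amenable :: "'a measure \<Rightarrow> ('a \<times> 'a) set \<Rightarrow> bool" where
  "uniformly_non_amenable M R \<longleftrightarrow> isoperimetric_const M R > 0"

end

theory Submission
  imports Defs "HOL-Probability.Distribution_Functions" "HOL-Library.Transitive_Closure_Table"
begin

text \<open>Suppose that every subtreeing generates a hyperfinite relation. In a forest on a finite set there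
  are at most as many edges as vertices; writing a hyperfinite relation as an increasing union of
  finite ones, we see that every measurable forest inside \<open>R\<close> has cost at most \<open>1\<close>. We show that then
  \<open>R\<close> is finitely generated and \<open>h(R) = 0\<close>.

  By a Lusin--Novikov theorem modulo null sets, \<open>R\<close> is the union of the graphs of countably many partial
  automorphisms \<open>\<Phi> n\<close>. Stacking towers as in Dye's theorem one finds a partial automorphism \<open>T\<close> of \<open>R\<close>
  with conull domain, whose orbits are paths and which generates an ergodic relation. For each \<open>n\<close>,
  consider the minimal spanning forest of \<open>T \<union> \<Phi> n\<close>, for labels which give priority to the edges of \<open>T\<close>.
  It contains \<open>T\<close>, which already has cost \<open>1\<close>, so that its part in \<open>\<Phi> n\<close> is null. If the labels are cut off
  after finitely many binary digits, the forest becomes a graph that still generates the same relation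
  as \<open>T \<union> \<Phi> n\<close>, and its part in \<open>\<Phi> n\<close> has arbitrarily small measure. As \<open>T\<close> is ergodic, these parts for all
  \<open>n\<close> can be moved by \<open>T\<close> to disjoint places and form a single partial automorphism \<open>\<psi>\<close> of small measure.
  Hence \<open>T \<union> \<psi>\<close> is a finite graphing of \<open>R\<close>, and the columns of the towers of \<open>T\<close>, being segments of
  the \<open>T\<close>-orbits, have small boundary in it.\<close>

section \<open>The Lusin--Novikov theorem modulo null sets\<close>

text \<open>The delicate point is the choice of labels. For the injective real label
  \<open>u\<close> there are no ties, because an edge of a partial automorphism is determined by its
  source; this makes \<open>T\<close> with the minimal edges a forest. But a rejected edge is merely
  replaced by edges of smaller label, and descent in the reals need not stop, so the forest need not
  generate. With labels in the natural numbers the descent stops, but ties may leave cycles, and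
  then no bound on the cost is available. Truncating \<open>u\<close> combines both: every truncated
  graph generates, and these graphs decrease to the forest, to which alone the cost bound is
  applied; continuity of the measure from above does the rest.

  Ergodicity of \<open>T\<close>, and not only of \<open>R\<close>, is what allows an edge to be
  moved: inside an ergodic relation sets of equal measure can be matched, and here the matching
  itself is made of \<open>T\<close>-paths.

  Null sets are removed once: all classes that meet an exceptional null set are collapsed to points,
  after which the relation is enumerated everywhere by total measurable maps.\<close>

locale polish_prob_space = prob_space M + Metric_space "space M" d
  for M :: "'a measure" and d +
  fixes D :: "nat \<Rightarrow> 'a"
  assumes complete: mcomplete
    and dense_in: "D n \<in> space M"
    and dense: "y \<in> space M \<Longrightarrow> e > 0 \<Longrightarrow> \<exists>j. d (D j) y < e"
    and sets_eq: "sets M = sigma_sets (space M) {U. openin mtopology U}"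

lemma polish_prob_space_exists:
  assumes "prob_space M" "standard_borel_space M"
  shows "\<exists>d D. polish_prob_space M d D"
proof -
  interpret prob_space M by fact
  obtain T where T: "completely_metrizable_space T" "second_countable T" "topspace T = space M"
    "sets M = sigma_sets (topspace T) {U. openin T U}"
    using assms(2) by (auto simp: standard_borel_space_def)
  obtain X d where X: "Metric_space X d" "Metric_space.mcomplete X d" "T = Metric_space.mtopology X d"
    using T(1) by (auto simp: completely_metrizable_space_def)
  interpret X: Metric_space X d by fact
  have sp: "X = space M" using T(3) X(3) by simp
  have "separable_space T" using T(2) second_countable_imp_separable_space by blast
  then obtain C where C: "countable C" "C \<subseteq> topspace T" "T closure_of C = topspace T"
    by (auto simp: separable_space_def)
  have "C \<noteq> {}" using C(3) T(3) not_empty by auto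
  define D where "D = from_nat_into C"
  have D: "range D = C" using C(1) \<open>C \<noteq> {}\<close> by (simp add: D_def range_from_nat_into)
  have "polish_prob_space M d D"
  proof (unfold_locales)
    show "Metric_space.mcomplete (space M) d" using X sp by simp
    show "D n \<in> space M" for n using D C(2) T(3) by blast
    show "\<exists>j. d (D j) y < e" if y: "y \<in> space M" and e: "e > 0" for y e
    proof -
      have "y \<in> X.mtopology closure_of C" using C(3) T(3) X(3) y by simp
      then obtain z where "z \<in> C" "z \<in> X.mball y e"
        using e by (auto simp: X.metric_closure_of)
      then obtain j where "z = D j" using D by auto
      with \<open>z \<in> X.mball y e\<close> show ?thesis by (auto simp: X.commute)
    qed
    show "sets M = sigma_sets (space M) {U. openin (Metric_space.mtopology (space M) d) U}"
      using T X sp by simp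
  qed (use X(1) sp in \<open>auto simp: Metric_space_def\<close>)
  then show ?thesis by blast
qed

section \<open>Suslin schemes of rectangles\<close>

context polish_prob_space
begin

text \<open>A finite sequence is encoded as a length and an infinite sequence of which only the
  initial segment of that length counts. The second factors are closed because
  \<open>countable_sections_cov\<close> passes to a limit in \<open>y\<close> while \<open>x\<close>
  stays fixed.\<close>

definition scheme :: "(nat \<Rightarrow> (nat \<Rightarrow> nat) \<Rightarrow> 'a set) \<Rightarrow> (nat \<Rightarrow> (nat \<Rightarrow> nat) \<Rightarrow> 'a set) \<Rightarrow> bool" where
  "scheme A B \<longleftrightarrow> (\<forall>n \<sigma>. A n \<sigma> \<in> sets M \<and> closedin mtopology (B n \<sigma>)) \<and>
     (\<forall>n \<sigma> \<tau>. (\<forall>i<n. \<sigma> i = \<tau> i) \<longrightarrow> A n \<sigma> = A n \<tau> \<and> B n \<sigma> = B n \<tau>)"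

definition suslin :: "('a \<times> 'a) set \<Rightarrow> bool" where
  "suslin E \<longleftrightarrow> (\<exists>A B. scheme A B \<and> E = {(x, y). \<exists>\<sigma>. \<forall>n. x \<in> A n \<sigma> \<and> y \<in> B n \<sigma>})"

lemma schemeD:
  assumes "scheme A B"
  shows "A n \<sigma> \<in> sets M" "closedin mtopology (B n \<sigma>)"
    "(\<And>i. i < n \<Longrightarrow> \<sigma> i = \<tau> i) \<Longrightarrow> A n \<sigma> = A n \<tau>"
    "(\<And>i. i < n \<Longrightarrow> \<sigma> i = \<tau> i) \<Longrightarrow> B n \<sigma> = B n \<tau>"
  using assms unfolding scheme_def by blast+

lemma scheme_space:
  assumes "scheme A B"
  shows "x \<in> A n \<sigma> \<Longrightarrow> x \<in> space M" "y \<in> B n \<sigma> \<Longrightarrow> y \<in> space M"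
  using schemeD(1)[OF assms, of n \<sigma>, THEN sets.sets_into_space]
    schemeD(2)[OF assms, of n \<sigma>, THEN closedin_subset] by auto

lemma suslin_rect:
  assumes "A \<in> sets M" "closedin mtopology B"
  shows "suslin (A \<times> B)"
  unfolding suslin_def
  by (rule exI[of _ "\<lambda>_ _. A"], rule exI[of _ "\<lambda>_ _. B"]) (use assms in \<open>auto simp: scheme_def\<close>)

lemma suslin_UN:
  assumes "\<And>m::nat. suslin (E m)"
  shows "suslin (\<Union>m. E m)"
proof -
  have "\<forall>m. \<exists>A B. scheme A B \<and> E m = {(x, y). \<exists>\<sigma>. \<forall>n. x \<in> A n \<sigma> \<and> y \<in> B n \<sigma>}"
    using assms unfolding suslin_def by blast
  then obtain A B where *: "\<forall>m. scheme (A m) (B m) \<and>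
      E m = {(x, y). \<exists>\<sigma>. \<forall>n. x \<in> A m n \<sigma> \<and> y \<in> B m n \<sigma>}"
    unfolding choice_iff by blast
  have AB: "\<And>m. scheme (A m) (B m)"
    "\<And>m. E m = {(x, y). \<exists>\<sigma>. \<forall>n. x \<in> A m n \<sigma> \<and> y \<in> B m n \<sigma>}"
    using * by blast+
  \<comment> \<open>The first entry of the sequence selects the set \<open>E m\<close>; the
    remaining entries run through its scheme, one level later. Level 0 is the whole space.\<close>
  define A' where "A' n \<sigma> = (case n of 0 \<Rightarrow> space M | Suc n \<Rightarrow> A (\<sigma> 0) n (\<lambda>i. \<sigma> (Suc i)))" for n \<sigma>
  define B' where "B' n \<sigma> = (case n of 0 \<Rightarrow> space M | Suc n \<Rightarrow> B (\<sigma> 0) n (\<lambda>i. \<sigma> (Suc i)))" for n \<sigma>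
  have A'0: "A' 0 \<sigma> = space M" "B' 0 \<sigma> = space M"
    and A'Suc: "A' (Suc n) \<sigma> = A (\<sigma> 0) n (\<lambda>i. \<sigma> (Suc i))" "B' (Suc n) \<sigma> = B (\<sigma> 0) n (\<lambda>i. \<sigma> (Suc i))" for n \<sigma>
    by (auto simp: A'_def B'_def)
  have "scheme A' B'"
    unfolding scheme_def
  proof (intro conjI allI impI)
    fix n \<sigma>
    have cl: "closedin mtopology (space M)" using closedin_topspace[of mtopology] by simp
    show "A' n \<sigma> \<in> sets M"
      using schemeD(1)[OF AB(1)] by (cases n) (auto simp: A'0 A'Suc)
    show "closedin mtopology (B' n \<sigma>)"
      using schemeD(2)[OF AB(1)] cl by (cases n) (simp_all add: A'0 A'Suc)
    fix \<tau> assume *: "\<forall>i<n. \<sigma> i = \<tau> i"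
    show "A' n \<sigma> = A' n \<tau>"
    proof (cases n)
      case (Suc k)
      then show ?thesis using * by (auto simp: A'_def intro!: schemeD(3)[OF AB(1)])
    qed (simp add: A'_def)
    show "B' n \<sigma> = B' n \<tau>"
    proof (cases n)
      case (Suc k)
      then show ?thesis using * by (auto simp: B'_def intro!: schemeD(4)[OF AB(1)])
    qed (simp add: B'_def)
  qed
  moreover have "(\<Union>m. E m) = {(x, y). \<exists>\<sigma>. \<forall>n. x \<in> A' n \<sigma> \<and> y \<in> B' n \<sigma>}"
  proof (intro equalityI subsetI; clarsimp)
    fix x y m assume "(x, y) \<in> E m"
    then obtain \<sigma> where \<sigma>: "\<forall>n. x \<in> A m n \<sigma> \<and> y \<in> B m n \<sigma>" using AB(2) by auto
    have xy: "x \<in> space M" "y \<in> space M"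
      using \<sigma> scheme_space[OF AB(1)] by blast+
    show "\<exists>\<sigma>. \<forall>n. x \<in> A' n \<sigma> \<and> y \<in> B' n \<sigma>"
      by (rule exI[of _ "case_nat m \<sigma>"]) (use \<sigma> xy in \<open>auto simp: A'_def B'_def split: nat.split\<close>)
  next
    fix x y \<sigma> assume *: "\<forall>n. x \<in> A' n \<sigma> \<and> y \<in> B' n \<sigma>"
    have "\<forall>n. x \<in> A (\<sigma> 0) n (\<lambda>i. \<sigma> (Suc i)) \<and> y \<in> B (\<sigma> 0) n (\<lambda>i. \<sigma> (Suc i))"
      using * A'Suc by metis
    then show "\<exists>m. (x, y) \<in> E m" using AB(2) by auto
  qed
  ultimately show ?thesis unfolding suslin_def by blast
qed

lemma suslin_INT:
  assumes "\<And>m::nat. suslin (E m)"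
  shows "suslin (\<Inter>m. E m)"
proof -
  have "\<forall>m. \<exists>A B. scheme A B \<and> E m = {(x, y). \<exists>\<sigma>. \<forall>n. x \<in> A n \<sigma> \<and> y \<in> B n \<sigma>}"
    using assms unfolding suslin_def by blast
  then obtain A B where *: "\<forall>m. scheme (A m) (B m) \<and>
      E m = {(x, y). \<exists>\<sigma>. \<forall>n. x \<in> A m n \<sigma> \<and> y \<in> B m n \<sigma>}"
    unfolding choice_iff by blast
  have AB: "\<And>m. scheme (A m) (B m)"
    "\<And>m. E m = {(x, y). \<exists>\<sigma>. \<forall>n. x \<in> A m n \<sigma> \<and> y \<in> B m n \<sigma>}"
    using * by blast+
  \<comment> \<open>One sequence codes countably many, interleaved by \<open>prod_encode\<close>.
    \<open>I n\<close> contains the pairs \<open>(m, k)\<close> for which the first \<open>k\<close>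
    entries of the \<open>m\<close>-th sequence are readable from the first \<open>n\<close>
    entries; the bounds by \<open>n\<close> keep it finite.\<close>
  define I where "I n = {(m, k). m \<le> n \<and> k \<le> n \<and> (\<forall>j<k. prod_encode (m, j) < n)}" for n :: nat
  define A' where "A' n \<sigma> = space M \<inter> (\<Inter>(m, k)\<in>I n. A m k (\<lambda>j. \<sigma> (prod_encode (m, j))))" for n \<sigma>
  define B' where "B' n \<sigma> = space M \<inter> (\<Inter>(m, k)\<in>I n. B m k (\<lambda>j. \<sigma> (prod_encode (m, j))))" for n \<sigma>
  have I: "finite (I n)" "(0, 0) \<in> I n" for n
    by (auto simp: I_def intro: finite_subset[of _ "{..n} \<times> {..n}"])
  have "scheme A' B'"
    unfolding scheme_def
  proof (intro conjI allI impI)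
    fix n \<sigma>
    have cl: "closedin mtopology (space M)" using closedin_topspace[of mtopology] by simp
    have "(\<Inter>(m, k)\<in>I n. A m k (\<lambda>j. \<sigma> (prod_encode (m, j)))) \<in> sets M"
      using I(2)[of n] by (intro sets.countable_INT'' sets.finite_INT I) (auto intro: schemeD(1)[OF AB(1)])
    then show "A' n \<sigma> \<in> sets M"
      by (auto simp: A'_def)
    have "closedin mtopology (\<Inter>(m, k)\<in>I n. B m k (\<lambda>j. \<sigma> (prod_encode (m, j))))"
      using I(2)[of n] by (intro closedin_Inter) (auto intro: schemeD(2)[OF AB(1)])
    then show "closedin mtopology (B' n \<sigma>)"
      using cl by (auto simp: B'_def)
    fix \<tau> assume *: "\<forall>i<n. \<sigma> i = \<tau> i"
    show "A' n \<sigma> = A' n \<tau>"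
      unfolding A'_def
      by (intro arg_cong2[where f = "(\<inter>)"] refl INF_cong)
         (use * in \<open>auto simp: I_def intro!: schemeD(3)[OF AB(1)]\<close>)
    show "B' n \<sigma> = B' n \<tau>"
      unfolding B'_def
      by (intro arg_cong2[where f = "(\<inter>)"] refl INF_cong)
         (use * in \<open>auto simp: I_def intro!: schemeD(4)[OF AB(1)]\<close>)
  qed
  moreover have "(\<Inter>m. E m) = {(x, y). \<exists>\<sigma>. \<forall>n. x \<in> A' n \<sigma> \<and> y \<in> B' n \<sigma>}"
  proof (intro equalityI subsetI; clarsimp)
    fix x y assume "\<forall>m. (x, y) \<in> E m"
    then have "\<forall>m. \<exists>\<sigma>. \<forall>n. x \<in> A m n \<sigma> \<and> y \<in> B m n \<sigma>" using AB(2) by auto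
    then obtain \<sigma> where \<sigma>: "\<And>m n. x \<in> A m n (\<sigma> m) \<and> y \<in> B m n (\<sigma> m)" by metis
    have xy: "x \<in> space M" "y \<in> space M"
      using \<sigma> scheme_space[OF AB(1)] by blast+
    show "\<exists>\<sigma>. \<forall>n. x \<in> A' n \<sigma> \<and> y \<in> B' n \<sigma>"
      by (rule exI[of _ "\<lambda>i. \<sigma> (fst (prod_decode i)) (snd (prod_decode i))"])
         (use \<sigma> xy in \<open>auto simp: A'_def B'_def\<close>)
  next
    fix x y \<sigma> m assume *: "\<forall>n. x \<in> A' n \<sigma> \<and> y \<in> B' n \<sigma>"
    have "x \<in> A m k (\<lambda>j. \<sigma> (prod_encode (m, j))) \<and> y \<in> B m k (\<lambda>j. \<sigma> (prod_encode (m, j)))" for k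
    proof -
      define n where "n = Suc (m + k + Max (insert 0 ((\<lambda>j. prod_encode (m, j)) ` {..<k})))"
      have "prod_encode (m, j) \<le> Max (insert 0 ((\<lambda>j. prod_encode (m, j)) ` {..<k}))" if "j < k" for j
        by (rule Max_ge) (use that in auto)
      then have "prod_encode (m, j) < n" if "j < k" for j
        using that unfolding n_def by (meson le_add2 le_imp_less_Suc le_trans)
      moreover have "m \<le> n" "k \<le> n" by (simp_all add: n_def)
      ultimately have "(m, k) \<in> I n" by (auto simp: I_def)
      then show ?thesis using *[rule_format, of n] by (auto simp: A'_def B'_def)
    qed
    then show "(x, y) \<in> E m" using AB(2) by auto
  qed
  ultimately show ?thesis unfolding suslin_def by blast
qed

lemma closed_sets: "closedin mtopology B \<Longrightarrow> B \<in> sets M"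
proof -
  assume B: "closedin mtopology B"
  have "space M - B \<in> sets M" using B unfolding sets_eq closedin_def by auto
  moreover have "B = space M - (space M - B)" using closedin_subset[OF B] by auto
  ultimately show ?thesis by (metis sets.compl_sets)
qed

text \<open>Suslin sets need not be closed under complements, so the sigma-algebra argument is run
  on the sets that are Suslin together with their complement. Open sets qualify because in a metric
  space they are countable unions of closed sets.\<close>

lemma suslin_measurable:
  assumes "E \<in> sets (M \<Otimes>\<^sub>M M)"
  shows "suslin E"
proof -
  let ?X = "space M \<times> space M"
  define F where "F = {E. E \<subseteq> ?X \<and> suslin E \<and> suslin (?X - E)}"
  have cl: "closedin mtopology (space M)" using closedin_topspace[of mtopology] by simp
  have [simp]: "suslin {}" "suslin ?X"
    using suslin_rect[of "{}" "{}"] suslin_rect[of "space M" "space M"] cl by auto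
  have comp: "?X - E \<in> F" if "E \<in> F" for E
    using that by (auto simp: F_def double_diff)
  have un: "(\<Union>m. E m) \<in> F" if "\<And>m::nat. E m \<in> F" for E
  proof -
    have "?X - (\<Union>m. E m) = (\<Inter>m. ?X - E m)" by auto
    moreover have "\<And>m. E m \<subseteq> ?X" "\<And>m. suslin (E m)" "\<And>m. suslin (?X - E m)"
      using that by (auto simp: F_def)
    ultimately show ?thesis unfolding F_def by (auto intro!: suslin_UN suslin_INT simp del: UN_simps INT_simps)
  qed
  have "sigma_algebra ?X F"
  proof (subst sigma_algebra_iff2, intro conjI ballI allI impI)
    show "{} \<in> F" by (simp add: F_def)
    show "F \<subseteq> Pow ?X" by (auto simp: F_def)
    show "(\<Union>i. A i) \<in> F" if "range A \<subseteq> F" for A :: "nat \<Rightarrow> _"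
      using un[of A] that by auto
  qed (use comp in auto)
  then interpret F: sigma_algebra ?X F .
  have left: "A \<times> space M \<in> F" if "A \<in> sets M" for A
  proof -
    have "?X - A \<times> space M = (space M - A) \<times> space M" by auto
    then show ?thesis using that cl sets.sets_into_space[OF that] by (auto simp: F_def intro!: suslin_rect)
  qed
  have "space M \<times> B \<in> F" if "B \<in> sigma_sets (space M) {U. openin mtopology U}" for B
    using that
  proof induction
    case (Basic U)
    then have U: "openin mtopology U" by simp
    then have "U \<subseteq> space M" using openin_subset topspace_mtopology by blast
    have "fsigma_in mtopology U"
      using open_imp_fsigma_in[OF metrizable_space_mtopology U] .
    then obtain C where C: "\<And>n::nat. closedin mtopology (C n)" "(\<Union>n. C n) = U"
      unfolding fsigma_in_ascending by blast
    have "space M \<times> U = (\<Union>n. space M \<times> C n)" using C(2) by auto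
    moreover have "?X - space M \<times> U = space M \<times> (space M - U)" by auto
    moreover have "closedin mtopology (space M - U)" using U openin_closedin_eq topspace_mtopology by metis
    moreover have "suslin (\<Union>n. space M \<times> C n)" using C(1) by (intro suslin_UN suslin_rect) auto
    moreover have "suslin (space M \<times> (space M - U))" using calculation(3) by (intro suslin_rect) auto
    ultimately show ?case using \<open>U \<subseteq> space M\<close> unfolding F_def by auto
  next
    case Empty
    then show ?case by simp
  next
    case (Compl B)
    have "space M \<times> (space M - B) = ?X - space M \<times> B" by auto
    with Compl comp show ?case by simp
  next
    case (Union B)
    have "space M \<times> (\<Union>i. B i) = (\<Union>i. space M \<times> B i)" by auto
    with Union un show ?case by simp
  qed
  then have right: "space M \<times> B \<in> F" if "B \<in> sets M" for B using that sets_eq by simp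
  have rect: "A \<times> B \<in> F" if "A \<in> sets M" "B \<in> sets M" for A B
  proof -
    have "A \<times> B = (A \<times> space M) \<inter> (space M \<times> B)" using that sets.sets_into_space by blast
    then show ?thesis using left right that by auto
  qed
  have "E \<in> sigma_sets ?X {a \<times> b |a b. a \<in> sets M \<and> b \<in> sets M}"
    using assms by (simp add: sets_pair_measure)
  then have "E \<in> F"
    using F.sigma_sets_subset[of "{a \<times> b |a b. a \<in> sets M \<and> b \<in> sets M}"] rect by blast
  then show ?thesis by (simp add: F_def)
qed

section \<open>Covering by countably many measurable graphs, and exhaustion\<close>

definition cov :: "('a \<times> 'a) set \<Rightarrow> bool" where
  "cov Q \<longleftrightarrow> (\<exists>f::nat \<Rightarrow> 'a \<Rightarrow> 'a. \<exists>N\<in>null_sets M. (\<forall>n. f n \<in> M \<rightarrow>\<^sub>M M) \<and>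
     (\<forall>x y. (x, y) \<in> Q \<longrightarrow> x \<in> N \<or> (\<exists>n. y = f n x)))"

lemma cov_mono: "cov Q \<Longrightarrow> Q' \<subseteq> Q \<Longrightarrow> cov Q'"
  unfolding cov_def by blast

lemma cov_null: "N \<in> null_sets M \<Longrightarrow> cov (Q \<inter> N \<times> UNIV)"
  unfolding cov_def by (intro exI[of _ "\<lambda>_ x. x"] bexI[of _ N]) auto

lemma cov_empty: "cov {}"
  using cov_null[of "{}" "{}"] by simp

lemma cov_graph: "f \<in> M \<rightarrow>\<^sub>M M \<Longrightarrow> cov {(x, y). y = f x}"
  unfolding cov_def by (intro exI[of _ "\<lambda>_. f"] bexI[of _ "{}"]) auto

lemma cov_UN_nat:
  assumes "\<And>i::nat. cov (Q i)"
  shows "cov (\<Union>i. Q i)"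
proof -
  have "\<forall>i. \<exists>f N. N \<in> null_sets M \<and> (\<forall>n::nat. f n \<in> M \<rightarrow>\<^sub>M M) \<and>
     (\<forall>x y. (x, y) \<in> Q i \<longrightarrow> x \<in> N \<or> (\<exists>n. y = f n x))"
  proof
    fix i show "\<exists>f N. N \<in> null_sets M \<and> (\<forall>n::nat. f n \<in> M \<rightarrow>\<^sub>M M) \<and>
      (\<forall>x y. (x, y) \<in> Q i \<longrightarrow> x \<in> N \<or> (\<exists>n. y = f n x))"
      using assms[of i] unfolding cov_def Bex_def by assumption
  qed
  then obtain f N where *: "\<forall>i. N i \<in> null_sets M \<and> (\<forall>n::nat. f i n \<in> M \<rightarrow>\<^sub>M M) \<and>
     (\<forall>x y. (x, y) \<in> Q i \<longrightarrow> x \<in> N i \<or> (\<exists>n. y = f i n x))"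
    unfolding choice_iff by blast
  show ?thesis
    unfolding cov_def
  proof (intro exI[of _ "\<lambda>n. f (fst (prod_decode n)) (snd (prod_decode n))"] bexI[of _ "\<Union>i. N i"]
      conjI allI impI)
    show "f (fst (prod_decode n)) (snd (prod_decode n)) \<in> M \<rightarrow>\<^sub>M M" for n using * by blast
    show "(\<Union>i. N i) \<in> null_sets M" using * by (intro null_sets_UN) auto
    fix x y assume "(x, y) \<in> (\<Union>i. Q i)"
    then obtain i where "(x, y) \<in> Q i" by auto
    then have "x \<in> N i \<or> (\<exists>n. y = f i n x)" using * by blast
    then show "x \<in> (\<Union>i. N i) \<or> (\<exists>n. y = f (fst (prod_decode n)) (snd (prod_decode n)) x)"
      by (metis UNIV_I UN_iff fst_conv prod_encode_inverse snd_conv)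
  qed
qed

lemma cov_UN:
  assumes "countable I" "\<And>i. i \<in> I \<Longrightarrow> cov (Q i)"
  shows "cov (\<Union>i\<in>I. Q i)"
proof (cases "I = {}")
  case False
  then have "(\<Union>i\<in>I. Q i) = (\<Union>n. Q (from_nat_into I n))"
    using assms(1) by (metis image_image range_from_nat_into)
  then show ?thesis
    using cov_UN_nat[of "\<lambda>n. Q (from_nat_into I n)"] assms(2) False by (simp add: from_nat_into)
qed (simp add: cov_empty)

lemma cov_Un: "cov P \<Longrightarrow> cov Q \<Longrightarrow> cov (P \<union> Q)"
  using cov_UN[of "{P, Q}" "\<lambda>P. P"] by auto

text \<open>Exhaustion: the supremum of the measures of sets over which \<open>Q\<close> is covered
  is attained by a countable union of such sets. \<open>L\<close> is the complement of that union,
  so it meets any other such set in a null set.\<close>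

lemma large_exists:
  "\<exists>L\<in>sets M. cov (Q \<inter> (space M - L) \<times> UNIV) \<and>
     (\<forall>D\<in>sets M. cov (Q \<inter> D \<times> UNIV) \<longrightarrow> emeasure M (D \<inter> L) = 0)"
proof -
  define \<D> where "\<D> = {D\<in>sets M. cov (Q \<inter> D \<times> UNIV)}"
  have "{} \<in> \<D>" by (simp add: \<D>_def cov_empty)
  then have "\<D> \<noteq> {}" by blast
  from ennreal_SUP_countable_SUP[OF this, of "emeasure M"] obtain f :: "nat \<Rightarrow> ennreal"
    where f: "range f \<subseteq> emeasure M ` \<D>" "Sup (emeasure M ` \<D>) = Sup (range f)" by blast
  then have "\<forall>n. \<exists>D\<in>\<D>. f n = emeasure M D" by blast
  then obtain D where D: "\<And>n. D n \<in> \<D>" "\<And>n. f n = emeasure M (D n)" by metis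
  define D' where "D' = (\<Union>n. D n)"
  have D'M: "D' \<in> sets M" using D(1) by (auto simp: D'_def \<D>_def)
  have "cov (\<Union>n. Q \<inter> D n \<times> UNIV)"
    using D(1) by (intro cov_UN_nat) (auto simp: \<D>_def)
  then have D'c: "cov (Q \<inter> D' \<times> UNIV)"
    by (rule cov_mono) (auto simp: D'_def)
  have sup: "emeasure M A \<le> emeasure M D'" if "A \<in> \<D>" for A
  proof -
    have "emeasure M A \<le> Sup (range f)" using that f(2) by (metis SUP_upper)
    also have "\<dots> \<le> emeasure M D'"
      using D D'M by (auto intro!: SUP_least emeasure_mono simp: D'_def)
    finally show ?thesis .
  qed
  show ?thesis
  proof (intro bexI[of _ "space M - D'"] conjI ballI impI)
    have "Q \<inter> (space M - (space M - D')) \<times> UNIV \<subseteq> Q \<inter> D' \<times> UNIV" by auto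
    then show "cov (Q \<inter> (space M - (space M - D')) \<times> UNIV)" using D'c cov_mono by blast
    show "space M - D' \<in> sets M" using D'M by auto
    fix A assume A: "A \<in> sets M" "cov (Q \<inter> A \<times> UNIV)"
    have "Q \<inter> (D' \<union> A) \<times> UNIV = (Q \<inter> D' \<times> UNIV) \<union> (Q \<inter> A \<times> UNIV)" by auto
    then have "D' \<union> A \<in> \<D>" using A D'M D'c cov_Un by (auto simp: \<D>_def)
    then have "emeasure M (D' \<union> A) \<le> emeasure M D'" by (rule sup)
    moreover have "D' \<union> A = D' \<union> (A \<inter> (space M - D'))"
      using sets.sets_into_space[OF A(1)] by auto
    moreover have "emeasure M (D' \<union> (A \<inter> (space M - D'))) = emeasure M D' + emeasure M (A \<inter> (space M - D'))"
      using A D'M by (intro plus_emeasure[symmetric]) auto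
    ultimately have "emeasure M D' + emeasure M (A \<inter> (space M - D')) \<le> emeasure M D' + 0" by simp
    then show "emeasure M (A \<inter> (space M - D')) = 0"
      by (auto simp: ennreal_add_left_cancel_le)
  qed
qed

text \<open>Up to null sets, the complement of the largest set over which \<open>Q\<close> is covered by the graphs of
  countably many measurable functions.\<close>

definition large :: "('a \<times> 'a) set \<Rightarrow> 'a set" where
  "large Q = (SOME L. L \<in> sets M \<and> cov (Q \<inter> (space M - L) \<times> UNIV) \<and>
     (\<forall>D\<in>sets M. cov (Q \<inter> D \<times> UNIV) \<longrightarrow> emeasure M (D \<inter> L) = 0))"

lemma
  shows large_sets [measurable]: "large Q \<in> sets M"
    and large_cov: "cov (Q \<inter> (space M - large Q) \<times> UNIV)"
    and large_null: "\<And>D. D \<in> sets M \<Longrightarrow> cov (Q \<inter> D \<times> UNIV) \<Longrightarrow> emeasure M (D \<inter> large Q) = 0"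
  using someI_ex[OF large_exists[of Q, unfolded Bex_def]] unfolding large_def[symmetric] by blast+

lemma large_space: "large Q \<subseteq> space M"
  using large_sets by (rule sets.sets_into_space)

text \<open>Off all the sets \<open>large (P i)\<close> each \<open>P i\<close> is covered, hence so
  is \<open>Q\<close>. Thus a point that is large for \<open>Q\<close> is, up to a null set, large
  for some piece.\<close>

lemma large_UN:
  assumes "countable I" "Q \<subseteq> (\<Union>i\<in>I. P i)"
  shows "large Q - (\<Union>i\<in>I. large (P i)) \<in> null_sets M"
proof -
  let ?D = "space M - (\<Union>i\<in>I. large (P i))"
  have D: "?D \<in> sets M" using assms(1) by (intro sets.Diff sets.top sets.countable_UN') auto
  have "cov (\<Union>i\<in>I. P i \<inter> (space M - large (P i)) \<times> UNIV)"
    using assms(1) by (intro cov_UN large_cov)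
  then have "cov (Q \<inter> ?D \<times> UNIV)"
    by (rule cov_mono) (use assms(2) in auto)
  then have "emeasure M (?D \<inter> large Q) = 0" using D large_null by blast
  moreover have "?D \<inter> large Q = large Q - (\<Union>i\<in>I. large (P i))" using large_space by auto
  moreover have "?D \<inter> large Q \<in> sets M" using D by auto
  ultimately show ?thesis by (simp add: null_sets_def)
qed

lemma large_fst:
  assumes "A \<in> sets M" "Q \<subseteq> A \<times> UNIV"
  shows "large Q - A \<in> null_sets M"
proof -
  have "Q \<inter> (space M - A) \<times> UNIV = {}" using assms by auto
  then have "emeasure M ((space M - A) \<inter> large Q) = 0" using assms cov_empty large_null by auto
  moreover have "(space M - A) \<inter> large Q = large Q - A" using large_space by auto
  ultimately show ?thesis using assms by (auto simp: null_sets_def)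
qed

lemma large_empty: "large {} \<in> null_sets M"
  using large_fst[of "{}" "{}"] by simp

lemma cov_if_large_null:
  assumes "large Q \<in> null_sets M" "Q \<subseteq> space M \<times> UNIV"
  shows "cov Q"
  by (rule cov_mono[OF cov_Un[OF large_cov[of Q] cov_null[OF assms(1), of Q]]]) (use assms(2) in auto)

definition cb :: "nat \<times> nat \<Rightarrow> 'a set" where
  "cb p = mcball (D (fst p)) ((1/2) ^ snd p)"

lemma cb_closed: "closedin mtopology (cb p)"
  by (simp add: cb_def)

lemma cb_space: "cb p \<subseteq> space M"
  by (auto simp: cb_def)

lemma in_cb: "y \<in> cb (j, k) \<longleftrightarrow> y \<in> space M \<and> d (D j) y \<le> (1/2) ^ k"
  using dense_in by (auto simp: cb_def)

lemma cb_cover: "y \<in> space M \<Longrightarrow> \<exists>j. y \<in> cb (j, k)"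
  using dense[of y "(1/2)^k"] by (force simp: in_cb intro: less_imp_le)

lemma cb_meet:
  assumes "cb (i, k) \<inter> cb (j, l) \<noteq> {}"
  shows "d (D i) (D j) \<le> (1/2) ^ k + (1/2) ^ l"
proof -
  obtain y where "y \<in> cb (i, k)" "y \<in> cb (j, l)" using assms by auto
  then show ?thesis using triangle[of "D i" y "D j"] dense_in commute[of y "D j"] by (auto simp: in_cb)
qed

lemma open_Union_cb:
  assumes U: "openin mtopology U"
  shows "U = (\<Union>p\<in>{p. cb p \<subseteq> U}. cb p)"
proof (intro equalityI subsetI)
  fix y assume y: "y \<in> U"
  then obtain r where r: "r > 0" "mball y r \<subseteq> U" and ysp: "y \<in> space M"
    using U unfolding openin_mtopology by blast
  obtain k where k: "(1/2::real) ^ k < r / 2"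
    using real_arch_pow_inv[of "r/2" "1/2"] r by auto
  obtain j where j: "y \<in> cb (j, k)" using cb_cover ysp by blast
  have "cb (j, k) \<subseteq> U"
  proof
    fix z assume z: "z \<in> cb (j, k)"
    have "d y z \<le> d y (D j) + d (D j) z" using z ysp dense_in by (intro triangle) (auto simp: in_cb)
    then have "d y z < r" using z j k by (auto simp: in_cb commute)
    then show "z \<in> U" using r(2) z ysp by (auto simp: in_cb)
  qed
  then show "y \<in> (\<Union>p\<in>{p. cb p \<subseteq> U}. cb p)" using j by blast
qed blast

lemma measurable_via_cb:
  assumes "f \<in> space N \<rightarrow> space M" "\<And>p. f -` cb p \<inter> space N \<in> sets N"
  shows "f \<in> N \<rightarrow>\<^sub>M M"
proof (rule measurable_sigma_sets[OF sets_eq])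
  show "{U. openin mtopology U} \<subseteq> Pow (space M)" using openin_subset by fastforce
  fix U assume "U \<in> {U. openin mtopology U}"
  then have U: "openin mtopology U" by simp
  have "U = (\<Union>p\<in>{p. cb p \<subseteq> U}. cb p)" using U by (rule open_Union_cb)
  then have "f -` U \<inter> space N = f -` (\<Union>p\<in>{p. cb p \<subseteq> U}. cb p) \<inter> space N" by (rule arg_cong)
  also have "\<dots> = (\<Union>p\<in>{p. cb p \<subseteq> U}. f -` cb p \<inter> space N)" by blast
  finally have "f -` U \<inter> space N = (\<Union>p\<in>{p. cb p \<subseteq> U}. f -` cb p \<inter> space N)" .
  then show "f -` U \<inter> space N \<in> sets N"
    using assms(2) by (simp only:) (intro sets.countable_UN'; auto)
qed (fact assms(1))

text \<open>If a point is large for no two disjoint balls, then the balls for which it is large shrink to a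
  single point, which depends measurably on the base point.\<close>

lemma large_split:
  assumes Q: "Q \<subseteq> space M \<times> space M"
  shows "large Q - (\<Union>(p, q)\<in>{(p, q). cb p \<inter> cb q = {}}. large (Q \<inter> UNIV \<times> cb p) \<inter> large (Q \<inter> UNIV \<times> cb q))
    \<in> null_sets M"
proof -
  define L where "L p = large (Q \<inter> UNIV \<times> cb p)" for p
  have [measurable]: "L p \<in> sets M" for p by (simp add: L_def)
  define Z where "Z = large Q - (\<Union>(p, q)\<in>{(p, q). cb p \<inter> cb q = {}}. L p \<inter> L q)"
  define N where "N = (\<Union>k. large Q - (\<Union>j. L (j, k)))"
  define W where "W = Z - N"
  have [measurable]: "Z \<in> sets M"
    unfolding Z_def by (intro sets.Diff large_sets sets.countable_UN') auto
  have NN: "N \<in> null_sets M"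
    unfolding N_def L_def
    by (intro null_sets_UN large_UN) (use cb_cover Q in \<open>auto\<close>)
  then have [measurable]: "N \<in> sets M" by auto
  have [measurable]: "W \<in> sets M" by (simp add: W_def)
  \<comment> \<open>On \<open>W\<close> any two balls that are large for \<open>x\<close> meet. So
    the chosen centres form a Cauchy sequence with error of order \<open>(1/2) ^ k\<close>, and
    their limit will be the single point \<open>g x\<close>.\<close>
  define c where "c k x = (LEAST j. x \<in> L (j, k))" for k x
  have c: "x \<in> L (c k x, k)" if "x \<in> W" for x k
  proof -
    have "\<exists>j. x \<in> L (j, k)" using that by (auto simp: W_def Z_def N_def)
    then show ?thesis unfolding c_def by (rule LeastI_ex)
  qed
  have [measurable]: "c k \<in> M \<rightarrow>\<^sub>M count_space UNIV" for k
    unfolding c_def by measurable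
  have near: "d (D i) (D j) \<le> (1/2) ^ k + (1/2) ^ l" if "x \<in> W" "x \<in> L (i, k)" "x \<in> L (j, l)" for x i k j l
    by (rule cb_meet) (use that in \<open>auto simp: W_def Z_def\<close>)
  have "\<exists>y. y \<in> space M \<and> (\<forall>k. d (D (c k x)) y \<le> (1/2) ^ k)" if x: "x \<in> W" for x
  proof -
    have dc: "d (D (c k x)) (D (c l x)) \<le> (1/2) ^ k + (1/2) ^ l" for k l
      using near[OF x c[OF x] c[OF x]] .
    have "MCauchy (\<lambda>k. D (c k x))"
      unfolding MCauchy_def
    proof (intro conjI allI impI)
      fix \<epsilon> :: real assume "\<epsilon> > 0"
      then obtain K where K: "(1/2::real) ^ K < \<epsilon> / 2"
        using real_arch_pow_inv[of "\<epsilon>/2" "1/2"] by auto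
      have "d (D (c n x)) (D (c n' x)) < \<epsilon>" if "K \<le> n" "K \<le> n'" for n n'
      proof -
        have "(1/2::real) ^ n \<le> (1/2) ^ K" "(1/2::real) ^ n' \<le> (1/2) ^ K"
          using that by (auto intro: power_decreasing)
        then show ?thesis using dc[of n n'] K by linarith
      qed
      then show "\<exists>K. \<forall>n n'. K \<le> n \<longrightarrow> K \<le> n' \<longrightarrow> d (D (c n x)) (D (c n' x)) < \<epsilon>" by blast
    qed (use dense_in in auto)
    then obtain y where y: "limitin mtopology (\<lambda>k. D (c k x)) y sequentially"
      using complete by (auto simp: mcomplete_def)
    have ysp: "y \<in> space M" using y by (simp add: limitin_mspace)
    have "d (D (c k x)) y \<le> (1/2) ^ k" for k
    proof (rule field_le_epsilon)
      fix e :: real assume "e > 0"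
      then have "\<forall>\<^sub>F l in sequentially. D (c l x) \<in> space M \<and> d (D (c l x)) y < e / 2"
        using y half_gt_zero[OF \<open>e > 0\<close>] unfolding limitin_metric by blast
      moreover obtain K where K: "(1/2::real) ^ K < e / 2"
        using real_arch_pow_inv[of "e/2" "1/2"] \<open>e > 0\<close> by auto
      ultimately obtain l where l: "l \<ge> K" "d (D (c l x)) y < e / 2"
        unfolding eventually_sequentially by (meson le_cases nle_le)
      have "d (D (c k x)) y \<le> d (D (c k x)) (D (c l x)) + d (D (c l x)) y"
        using ysp dense_in by (intro triangle) auto
      moreover have "(1/2::real) ^ l \<le> (1/2) ^ K" using l by (auto intro: power_decreasing)
      ultimately show "d (D (c k x)) y \<le> (1/2) ^ k + e" using dc[of k l] l K by linarith
    qed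
    with ysp show ?thesis by blast
  qed
  then obtain g where g: "\<And>x. x \<in> W \<Longrightarrow> g x \<in> space M"
    "\<And>x k. x \<in> W \<Longrightarrow> d (D (c k x)) (g x) \<le> (1/2) ^ k" by metis
  define f where "f x = (if x \<in> W then g x else D 0)" for x
  have fm: "f \<in> M \<rightarrow>\<^sub>M M"
  proof (rule measurable_via_cb)
    show "f \<in> space M \<rightarrow> space M" using g dense_in by (auto simp: f_def)
    fix p
    obtain j k :: nat where p: "p = (j, k)" by fastforce
    \<comment> \<open>Membership of the limit in a ball is rewritten as countably many inequalities
      about the measurable indices \<open>c l x\<close>; this is where measurability of
      \<open>f\<close> comes from.\<close>
    have *: "g x \<in> cb (j, k) \<longleftrightarrow> (\<forall>l::nat. d (D (c l x)) (D j) \<le> (1/2) ^ k + (1/2) ^ l)" if x: "x \<in> W" for x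
    proof (intro iffI allI)
      fix l assume "g x \<in> cb (j, k)"
      then have gx: "g x \<in> space M" "d (g x) (D j) \<le> (1/2) ^ k" by (auto simp: in_cb commute)
      then have "d (D (c l x)) (D j) \<le> d (D (c l x)) (g x) + d (g x) (D j)"
        using dense_in by (intro triangle)
      then show "d (D (c l x)) (D j) \<le> (1/2) ^ k + (1/2) ^ l" using g(2)[OF x, of l] gx by linarith
    next
      assume *: "\<forall>l. d (D (c l x)) (D j) \<le> (1/2) ^ k + (1/2) ^ l"
      have "d (D j) (g x) \<le> (1/2) ^ k"
      proof (rule field_le_epsilon)
        fix e :: real assume "e > 0"
        then obtain l where l: "(1/2::real) ^ l < e / 2"
          using real_arch_pow_inv[of "e/2" "1/2"] by auto
        have "d (D j) (g x) \<le> d (D j) (D (c l x)) + d (D (c l x)) (g x)"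
          using dense_in g x by (intro triangle) auto
        then show "d (D j) (g x) \<le> (1/2) ^ k + e"
          using *[rule_format, of l] g(2)[OF x, of l] l commute[of "D j" "D (c l x)"] by linarith
      qed
      then show "g x \<in> cb (j, k)" using g x by (simp add: in_cb)
    qed
    have eq: "f -` cb p \<inter> space M = {x\<in>space M. if x \<in> W then \<forall>l. d (D (c l x)) (D j) \<le> (1/2) ^ k + (1/2) ^ l
        else D 0 \<in> cb p}"
      using * by (auto simp: f_def p split: if_splits)
    have [measurable]: "(\<lambda>x. d (D (c l x)) (D j)) \<in> borel_measurable M" for l
      by (rule measurable_compose[of "c l" M "count_space UNIV"]) auto
    show "f -` cb p \<inter> space M \<in> sets M"
      unfolding eq by measurable
  qed
  \<comment> \<open>A point of the section other than \<open>f x\<close> lies in a small ball too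
    far away to be large for \<open>x\<close>, so it belongs to a part that is already covered.
    Hence \<open>Q\<close> is covered over \<open>W\<close>, and \<open>W\<close> is null.\<close>
  have sub: "Q \<inter> W \<times> UNIV \<subseteq> {(x, y). y = f x} \<union> (\<Union>p. (Q \<inter> UNIV \<times> cb p) \<inter> (space M - L p) \<times> UNIV)"
  proof (clarify)
    fix x y assume xy: "(x, y) \<in> Q" "x \<in> W" "(x, y) \<notin> (\<Union>p. (Q \<inter> UNIV \<times> cb p) \<inter> (space M - L p) \<times> UNIV)"
    have sp: "x \<in> space M" "y \<in> space M" using Q xy by auto
    show "y = f x"
    proof (rule ccontr)
      assume ne: "y \<noteq> f x"
      have "f x = g x" using xy by (simp add: f_def)
      then have "d y (g x) > 0" using ne sp g xy by (metis less_eq_real_def nonneg zero)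
      then obtain k where k: "(1/2::real) ^ k < d y (g x) / 4"
        using real_arch_pow_inv[of "d y (g x) / 4" "1/2"] by auto
      obtain j where j: "y \<in> cb (j, k)" using cb_cover sp by blast
      then have "x \<in> L (j, k)" using xy sp by auto
      then have "d (D j) (D (c k x)) \<le> (1/2) ^ k + (1/2) ^ k" using near xy(2) c by blast
      moreover have "d y (g x) \<le> d y (D j) + d (D j) (g x)"
        using sp dense_in g xy by (intro triangle) auto
      moreover have "d (D j) (g x) \<le> d (D j) (D (c k x)) + d (D (c k x)) (g x)"
        using dense_in g xy by (intro triangle) auto
      moreover have "d y (D j) \<le> (1/2) ^ k" using j by (simp add: in_cb commute)
      ultimately show False using k g(2)[OF xy(2), of k] by linarith
    qed
  qed
  have "cov (\<Union>p. (Q \<inter> UNIV \<times> cb p) \<inter> (space M - L p) \<times> UNIV)"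
    unfolding L_def by (intro cov_UN large_cov) auto
  then have "cov (Q \<inter> W \<times> UNIV)"
    using cov_mono[OF _ sub] cov_Un cov_graph[OF fm] by blast
  then have "emeasure M (W \<inter> large Q) = 0" using large_null by simp
  moreover have "W \<inter> large Q = W" by (auto simp: W_def Z_def)
  ultimately have "W \<in> null_sets M" by (simp add: null_sets_def)
  then have "W \<union> N \<in> null_sets M" using NN by blast
  then have "Z \<in> null_sets M" by (rule null_sets_subset) (auto simp: W_def)
  then show ?thesis by (simp add: Z_def L_def)
qed

end

text \<open>Base 3 with the digits 0 and 1 only: all digits from position \<open>m\<close> on
  contribute at most \<open>(1/3) ^ m / 2\<close>, less than a digit 1 just before them. So
  expansions are unique, unlike in base 2.\<close>

definition ternary :: "(nat \<Rightarrow> bool) \<Rightarrow> real" where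
  "ternary b = (\<Sum>n. (1/3) ^ Suc n * of_bool (b n))"

lemma ternary_tail:
  "summable (\<lambda>n. (1/3::real) ^ (Suc n + m) * of_bool (b n))"
  "0 \<le> (\<Sum>n. (1/3::real) ^ (Suc n + m) * of_bool (b n))"
  "(\<Sum>n. (1/3::real) ^ (Suc n + m) * of_bool (b n)) \<le> (1/3) ^ m / 2"
proof -
  have s: "(\<lambda>n. (1/3::real) ^ (Suc n + m)) sums ((1/3) ^ m / 2)"
    using sums_mult[OF geometric_sums[of "1/3::real"], of "(1/3) ^ m / 3"] by (simp add: power_add field_simps)
  show *: "summable (\<lambda>n. (1/3::real) ^ (Suc n + m) * of_bool (b n))"
    by (rule summable_comparison_test'[OF sums_summable[OF s]]) auto
  show "0 \<le> (\<Sum>n. (1/3::real) ^ (Suc n + m) * of_bool (b n))"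
    by (rule suminf_nonneg[OF *]) auto
  have "(\<Sum>n. (1/3::real) ^ (Suc n + m) * of_bool (b n)) \<le> (\<Sum>n. (1/3::real) ^ (Suc n + m))"
    by (rule suminf_le[OF _ * sums_summable[OF s]]) auto
  then show "(\<Sum>n. (1/3::real) ^ (Suc n + m) * of_bool (b n)) \<le> (1/3) ^ m / 2"
    using sums_unique[OF s] by simp
qed

lemma ternary_bounds: "0 \<le> ternary b \<and> ternary b < 1"
  using ternary_tail(2,3)[of 0 b] by (simp add: ternary_def)

lemma inj_ternary: "inj ternary"
proof (rule injI, rule ccontr)
  have *: "ternary c < ternary b" if n: "\<And>m. m < n \<Longrightarrow> b m = c m" "b n" "\<not> c n" for b c n
  proof -
    have split: "ternary b = (\<Sum>i<n. (1/3) ^ Suc i * of_bool (b i)) + (1/3) ^ Suc n * of_bool (b n) +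
        (\<Sum>k. (1/3) ^ (Suc k + Suc n) * of_bool (b (k + Suc n)))" for b
      using suminf_split_initial_segment[of "\<lambda>n. (1/3::real) ^ Suc n * of_bool (b n)" "Suc n"]
        ternary_tail(1)[of 0 b] by (simp add: ternary_def add.commute)
    have "(\<Sum>i<n. (1/3::real) ^ Suc i * of_bool (b i)) = (\<Sum>i<n. (1/3) ^ Suc i * of_bool (c i))"
      using n(1) by (intro sum.cong) auto
    moreover have "0 < (1/3::real) ^ Suc n" by simp
    moreover have "of_bool (b n) = (1::real)" "of_bool (c n) = (0::real)" using n by auto
    ultimately show ?thesis
      unfolding split[of b] split[of c]
      using ternary_tail(2)[of "Suc n" "\<lambda>k. b (k + Suc n)"] ternary_tail(3)[of "Suc n" "\<lambda>k. c (k + Suc n)"]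
      by (simp only: mult_1_right mult_zero_right add_0_right)
  qed
  fix b c assume eq: "ternary b = ternary c" "b \<noteq> c"
  then have ex: "\<exists>n. b n \<noteq> c n" by auto
  define n where "n = (LEAST n. b n \<noteq> c n)"
  have "b n \<noteq> c n" unfolding n_def using ex by (rule LeastI_ex)
  moreover have "b m = c m" if "m < n" for m using that not_less_Least unfolding n_def by blast
  ultimately show False using *[of n b c] *[of n c b] eq(1) by (cases "b n") auto
qed

context polish_prob_space
begin

text \<open>If \<open>E\<close> were not covered, one could follow, for some
  \<open>x\<close>, a branch of a Suslin scheme of \<open>E\<close> together with shrinking balls along which the sections
  stay large, avoiding at each stage one more point of the countable section.\<close>

theorem countable_sections_cov:
  assumes E: "E \<in> sets (M \<Otimes>\<^sub>M M)" and count: "\<And>x. x \<in> space M \<Longrightarrow> countable (E `` {x})"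
  shows "cov E"
proof (rule ccontr)
  assume "\<not> cov E"
  obtain A B where AB: "scheme A B" and E_eq: "E = {(x, y). \<exists>\<sigma>. \<forall>n. x \<in> A n \<sigma> \<and> y \<in> B n \<sigma>}"
    using suslin_measurable[OF E] unfolding suslin_def by blast
  \<comment> \<open>The part of \<open>E\<close> whose branch in the scheme begins with
    \<open>s\<close> and whose second coordinate lies in all balls of \<open>bs\<close>.\<close>
  define node where "node s bs = {(x, y). (\<exists>\<sigma>. (\<forall>i<length s. \<sigma> i = s ! i) \<and> (\<forall>n. x \<in> A n \<sigma> \<and> y \<in> B n \<sigma>)) \<and>
     (\<forall>p\<in>set bs. y \<in> cb p)}" for s :: "nat list" and bs :: "(nat \<times> nat) list"
  have node_sub: "node s bs \<subseteq> space M \<times> space M" for s bs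
    using scheme_space[OF AB] unfolding node_def by blast
  have node_nil: "node [] [] = E" by (simp add: node_def E_eq)
  have node_cons: "node s bs \<inter> UNIV \<times> cb p = node s (p # bs)" for s bs p
    by (auto simp: node_def)
  define L where "L s bs = large (node s bs)" for s bs
  have app: "L s bs - (\<Union>i. L (s @ [i]) bs) \<in> null_sets M" for s bs
    unfolding L_def
  proof (rule large_UN)
    show "node s bs \<subseteq> (\<Union>i. node (s @ [i]) bs)"
    proof clarify
      fix x y assume "(x, y) \<in> node s bs"
      then obtain \<sigma> where \<sigma>: "\<forall>i<length s. \<sigma> i = s ! i" "\<forall>n. x \<in> A n \<sigma> \<and> y \<in> B n \<sigma>"
        "\<forall>p\<in>set bs. y \<in> cb p" by (auto simp: node_def)
      then have "(x, y) \<in> node (s @ [\<sigma> (length s)]) bs"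
        by (auto simp: node_def nth_append less_Suc_eq intro!: exI[of _ \<sigma>])
      then show "(x, y) \<in> (\<Union>i. node (s @ [i]) bs)" by blast
    qed
  qed simp
  have ball: "L s bs - (\<Union>j. L s ((j, k) # bs)) \<in> null_sets M" for s bs k
    unfolding L_def
  proof (rule large_UN)
    show "node s bs \<subseteq> (\<Union>j. node s ((j, k) # bs))"
    proof clarify
      fix x y assume xy: "(x, y) \<in> node s bs"
      then have "y \<in> space M" using node_sub by blast
      then obtain j where "y \<in> cb (j, k)" using cb_cover by blast
      then show "(x, y) \<in> (\<Union>j. node s ((j, k) # bs))" using xy node_cons by blast
    qed
  qed simp
  have split: "L s bs - (\<Union>(p, q)\<in>{(p, q). cb p \<inter> cb q = {}}. L s (p # bs) \<inter> L s (q # bs)) \<in> null_sets M" for s bs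
    using large_split[OF node_sub, of s bs] by (simp add: L_def node_cons)
  \<comment> \<open>Consistency at a finite stage only: the witness \<open>y\<close> may change from
    one node to the next, and only the limit of these witnesses has to satisfy everything.\<close>
  define ok where "ok s bs x \<longleftrightarrow> (\<forall>n\<le>length s. x \<in> A n (\<lambda>i. s ! i)) \<and>
     (\<exists>y\<in>space M. (\<forall>n\<le>length s. y \<in> B n (\<lambda>i. s ! i)) \<and> (\<forall>p\<in>set bs. y \<in> cb p))" for s bs x
  have ok: "\<exists>N\<in>null_sets M. L s bs - {x. ok s bs x} \<subseteq> N" for s bs
  proof -
    have *: "(\<forall>n\<le>length s. x \<in> A n (\<lambda>i. s ! i) \<and> y \<in> B n (\<lambda>i. s ! i)) \<and> (\<forall>p\<in>set bs. y \<in> cb p)"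
      if xy: "(x, y) \<in> node s bs" for x y
    proof -
      obtain \<sigma> where \<sigma>: "\<forall>i<length s. \<sigma> i = s ! i" "\<forall>n. x \<in> A n \<sigma> \<and> y \<in> B n \<sigma>"
        "\<forall>p\<in>set bs. y \<in> cb p" using xy by (auto simp: node_def)
      have "A n \<sigma> = A n (\<lambda>i. s ! i)" "B n \<sigma> = B n (\<lambda>i. s ! i)" if "n \<le> length s" for n
        using \<sigma>(1) that by (auto intro!: schemeD(3,4)[OF AB])
      with \<sigma> show ?thesis by metis
    qed
    show ?thesis
    proof (cases "node s bs = {}")
      case True
      then show ?thesis using large_empty by (intro bexI[of _ "L s bs"]) (auto simp: L_def)
    next
      case False
      let ?A = "\<Inter>n\<in>{..length s}. A n (\<lambda>i. s ! i)"
      have "?A \<in> sets M" using schemeD(1)[OF AB] by (intro sets.finite_INT) auto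
      moreover have "node s bs \<subseteq> ?A \<times> UNIV" using * by fastforce
      ultimately have "L s bs - ?A \<in> null_sets M" unfolding L_def by (rule large_fst)
      moreover have "L s bs - {x. ok s bs x} \<subseteq> L s bs - ?A"
      proof -
        obtain x y where "(x, y) \<in> node s bs" using False by auto
        with * node_sub have "\<exists>y\<in>space M. (\<forall>n\<le>length s. y \<in> B n (\<lambda>i. s ! i)) \<and> (\<forall>p\<in>set bs. y \<in> cb p)"
          by blast
        then show ?thesis by (auto simp: ok_def)
      qed
      ultimately show ?thesis by blast
    qed
  qed
  \<comment> \<open>There are countably many nodes, and at each of them these properties fail only
    on a null set, so almost every \<open>x\<close> has them at all nodes simultaneously.\<close>
  define good where "good x \<longleftrightarrow> (\<forall>s bs. x \<in> L s bs \<longrightarrow> (\<exists>i. x \<in> L (s @ [i]) bs) \<and>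
     (\<forall>k. \<exists>j. x \<in> L s ((j, k) # bs)) \<and>
     (\<exists>p q. cb p \<inter> cb q = {} \<and> x \<in> L s (p # bs) \<and> x \<in> L s (q # bs)) \<and> ok s bs x)" for x
  have "\<exists>N\<in>null_sets M. {x. \<not> good x} \<subseteq> N"
  proof -
    obtain N where N: "\<And>s bs. N s bs \<in> null_sets M" "\<And>s bs. L s bs - {x. ok s bs x} \<subseteq> N s bs"
      using ok by metis
    let ?N = "(\<Union>t. (L (fst t) (snd t) - (\<Union>i. L (fst t @ [i]) (snd t))) \<union>
       (\<Union>k. L (fst t) (snd t) - (\<Union>j. L (fst t) ((j, k) # snd t))) \<union>
       (L (fst t) (snd t) - (\<Union>(p, q)\<in>{(p, q). cb p \<inter> cb q = {}}. L (fst t) (p # snd t) \<inter> L (fst t) (q # snd t))) \<union>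
       N (fst t) (snd t))"
    have "?N \<in> null_sets M"
      by (intro null_sets_UN null_sets.Un app ball split N)
    moreover have "x \<in> ?N" if ng: "\<not> good x" for x
    proof -
      obtain s bs where s: "x \<in> L s bs" "(\<forall>i. x \<notin> L (s @ [i]) bs) \<or>
        (\<exists>k. \<forall>j. x \<notin> L s ((j, k) # bs)) \<or>
        \<not> (\<exists>p q. cb p \<inter> cb q = {} \<and> x \<in> L s (p # bs) \<and> x \<in> L s (q # bs)) \<or> \<not> ok s bs x"
        using ng unfolding good_def by blast
      show ?thesis
        by (rule UN_I[of "(s, bs)"], simp) (use s N(2)[of s bs] in auto)
    qed
    ultimately show ?thesis by blast
  qed
  then obtain N where N: "N \<in> null_sets M" "\<And>x. \<not> good x \<Longrightarrow> x \<in> N" by blast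
  have "L [] [] \<notin> null_sets M"
    using \<open>\<not> cov E\<close> cov_if_large_null[of E] node_sub[of "[]" "[]"] by (auto simp: L_def node_nil)
  then have "\<not> L [] [] \<subseteq> N" using null_sets_subset[OF N(1)] by (auto simp: L_def)
  then obtain x where x: "x \<in> L [] []" "good x" using N(2) by blast
  then have "x \<in> space M" using large_space by (auto simp: L_def)
  define e where "e = from_nat_into (E `` {x})"
  have e: "E `` {x} \<subseteq> range e"
    unfolding e_def by (intro subset_range_from_nat_into count \<open>x \<in> space M\<close>)
  \<comment> \<open>Stage \<open>m\<close> extends the branch by one index, adds a ball of radius
    \<open>(1/2) ^ m\<close> to force convergence, and adds a ball that misses the point
    \<open>e m\<close> of the section.\<close>
  have "\<exists>f. \<forall>m. (x \<in> L (fst (f m)) (snd (f m)) \<and> (m = 0 \<longrightarrow> f m = ([], []))) \<and>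
     (\<exists>i p j. f (Suc m) = (fst (f m) @ [i], (j, m) # p # snd (f m)) \<and> e m \<notin> cb p)"
  proof (rule dependent_nat_choice)
    show "\<exists>t. x \<in> L (fst t) (snd t) \<and> (0 = 0 \<longrightarrow> t = ([], []))" using x by auto
    fix t and m :: nat assume "x \<in> L (fst t) (snd t) \<and> (m = 0 \<longrightarrow> t = ([], []))"
    then have t: "x \<in> L (fst t) (snd t)" by blast
    have good: "(\<exists>i. x \<in> L (s @ [i]) bs)" "\<exists>j. x \<in> L s ((j, k) # bs)"
       "\<exists>p q. cb p \<inter> cb q = {} \<and> x \<in> L s (p # bs) \<and> x \<in> L s (q # bs)" if "x \<in> L s bs" for s bs k
      using x(2) that unfolding good_def by blast+
    \<comment> \<open>Two disjoint balls are available, and \<open>e m\<close> lies in at most one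
      of them.\<close>
    obtain p where p: "x \<in> L (fst t) (p # snd t)" "e m \<notin> cb p" using good(3)[OF t] by blast
    obtain j where "x \<in> L (fst t) ((j, m) # p # snd t)" using good(2)[OF p(1)] by blast
    then obtain i where "x \<in> L (fst t @ [i]) ((j, m) # p # snd t)" using good(1) by blast
    then show "\<exists>t'. (x \<in> L (fst t') (snd t') \<and> (Suc m = 0 \<longrightarrow> t' = ([], []))) \<and>
       (\<exists>i p j. t' = (fst t @ [i], (j, m) # p # snd t) \<and> e m \<notin> cb p)"
      using p(2) by (intro exI[of _ "(fst t @ [i], (j, m) # p # snd t)"]) auto
  qed
  then obtain f where f: "f 0 = ([], [])" "\<And>m. x \<in> L (fst (f m)) (snd (f m))"
    "\<And>m. \<exists>i p j. f (Suc m) = (fst (f m) @ [i], (j, m) # p # snd (f m)) \<and> e m \<notin> cb p"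
    by blast
  obtain i p j where fS: "\<And>m. f (Suc m) = (fst (f m) @ [i m], (j m, m) # p m # snd (f m))"
    "\<And>m. e m \<notin> cb (p m)" using f(3) by metis
  have f1: "fst (f m) = map i [0..<m]" for m
    by (induction m) (simp_all add: f(1) fS)
  have f2: "set (snd (f m)) = (\<Union>k<m. {(j k, k), p k})" for m
    by (induction m) (auto simp: f(1) fS less_Suc_eq)
  have A: "x \<in> A n i" for n
  proof -
    have "ok (fst (f n)) (snd (f n)) x" using x(2) f(2) unfolding good_def by blast
    then have "x \<in> A n (\<lambda>k. map i [0..<n] ! k)" by (simp add: ok_def f1)
    also have "A n (\<lambda>k. map i [0..<n] ! k) = A n i" by (rule schemeD(3)[OF AB]) auto
    finally show ?thesis .
  qed
  have "\<exists>y\<in>space M. (\<forall>n\<le>m. y \<in> B n i) \<and> (\<forall>k<m. y \<in> cb (j k, k) \<and> y \<in> cb (p k))" for m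
  proof -
    have "ok (fst (f m)) (snd (f m)) x" using x(2) f(2) unfolding good_def by blast
    then obtain y where y: "y \<in> space M" "\<forall>n\<le>m. y \<in> B n (\<lambda>k. map i [0..<m] ! k)"
      "\<forall>p\<in>set (snd (f m)). y \<in> cb p" by (auto simp: ok_def f1)
    moreover have "B n (\<lambda>k. map i [0..<m] ! k) = B n i" if "n \<le> m" for n
      by (rule schemeD(4)[OF AB]) (use that in auto)
    ultimately show ?thesis by (auto simp: f2)
  qed
  then obtain z where z: "\<And>m. z m \<in> space M" "\<And>m n. n \<le> m \<Longrightarrow> z m \<in> B n i"
    "\<And>m k. k < m \<Longrightarrow> z m \<in> cb (j k, k)" "\<And>m k. k < m \<Longrightarrow> z m \<in> cb (p k)" by metis
  have "MCauchy z"
    unfolding MCauchy_def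
  proof (intro conjI allI impI)
    fix \<epsilon> :: real assume "\<epsilon> > 0"
    then obtain K where K: "(1/2::real) ^ K < \<epsilon> / 2"
      using real_arch_pow_inv[of "\<epsilon>/2" "1/2"] by auto
    have "d (z n) (z n') < \<epsilon>" if "Suc K \<le> n" "Suc K \<le> n'" for n n'
    proof -
      have "d (z n) (z n') \<le> d (z n) (D (j K)) + d (D (j K)) (z n')"
        using z dense_in by (intro triangle) auto
      moreover have "z n \<in> cb (j K, K)" "z n' \<in> cb (j K, K)" using z(3) that by auto
      ultimately show ?thesis using K by (auto simp: in_cb commute)
    qed
    then show "\<exists>K. \<forall>n n'. K \<le> n \<longrightarrow> K \<le> n' \<longrightarrow> d (z n) (z n') < \<epsilon>" by blast
  qed (use z in auto)
  then obtain y where y: "limitin mtopology z y sequentially"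
    using complete by (auto simp: mcomplete_def)
  have "y \<in> B n i" for n
    by (rule limitin_closedin[OF y schemeD(2)[OF AB]])
       (use z(2) in \<open>auto simp: eventually_sequentially\<close>)
  then have "(x, y) \<in> E" using A by (auto simp: E_eq)
  \<comment> \<open>The limit inherits all closed conditions, so it lies in the section of
    \<open>E\<close> at \<open>x\<close> and yet differs from every point of its enumeration
    \<open>e\<close>.\<close>
  have "y \<in> cb (p k)" for k
    by (rule limitin_closedin[OF y cb_closed])
       (use z(4) in \<open>auto simp: eventually_sequentially intro!: exI[of _ "Suc k"]\<close>)
  with fS(2) have "y \<notin> range e" by auto
  then show False using e \<open>(x, y) \<in> E\<close> by blast
qed

lemma cb_separates:
  assumes "x \<in> space M" "y \<in> space M" "x \<noteq> y"
  shows "\<exists>p. x \<in> cb p \<and> y \<notin> cb p"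
proof -
  have "d x y > 0" using assms by (metis less_eq_real_def nonneg zero)
  then obtain k where k: "(1/2::real) ^ k < d x y / 2"
    using real_arch_pow_inv[of "d x y / 2" "1/2"] by auto
  obtain j where j: "x \<in> cb (j, k)" using cb_cover assms by blast
  have "d x y \<le> d x (D j) + d (D j) y" using assms dense_in by (intro triangle)
  then have "y \<notin> cb (j, k)" using k j by (auto simp: in_cb commute)
  with j show ?thesis by blast
qed

text \<open>The generator consists of the finite intersections of the balls \<open>cb p\<close>.
  Stability under intersections serves the independence argument in
  \<open>ergodic_path_exists\<close>.\<close>

lemma countable_generator_exists:
  "\<exists>C::nat \<Rightarrow> 'a set. Int_stable (range C) \<and> range C \<subseteq> Pow (space M) \<and> sets M = sigma_sets (space M) (range C)"
proof -
  define C :: "nat \<Rightarrow> 'a set" where "C n = space M \<inter> (\<Inter>p\<in>set (from_nat n). cb p)" for n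
  have C: "range C = range (\<lambda>ps. space M \<inter> (\<Inter>p\<in>set ps. cb p))"
    unfolding C_def using surj_from_nat by (metis (no_types, lifting) image_cong image_image)
  have "Int_stable (range C)"
    unfolding C
  proof (rule Int_stableI)
    fix a b assume "a \<in> range (\<lambda>ps. space M \<inter> (\<Inter>p\<in>set ps. cb p))" "b \<in> range (\<lambda>ps. space M \<inter> (\<Inter>p\<in>set ps. cb p))"
    then obtain ps qs where "a = space M \<inter> (\<Inter>p\<in>set ps. cb p)" "b = space M \<inter> (\<Inter>p\<in>set qs. cb p)" by blast
    then show "a \<inter> b \<in> range (\<lambda>ps. space M \<inter> (\<Inter>p\<in>set ps. cb p))"
      by (intro range_eqI[of _ _ "ps @ qs"]) auto
  qed
  moreover have sub: "range C \<subseteq> Pow (space M)" by (auto simp: C_def)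
  moreover have "sets M = sigma_sets (space M) (range C)"
  proof
    have cbM: "cb p \<in> sets M" for p by (rule closed_sets[OF cb_closed])
    have sets_Int_cb: "space M \<inter> (\<Inter>p\<in>set ps. cb p) \<in> sets M" for ps
    proof (induction ps)
      case (Cons p ps)
      have "space M \<inter> (\<Inter>q\<in>set (p # ps). cb q) = cb p \<inter> (space M \<inter> (\<Inter>p\<in>set ps. cb p))" by auto
      with Cons cbM show ?case by (metis sets.Int)
    qed simp
    show "sigma_sets (space M) (range C) \<subseteq> sets M"
      by (rule sets.sigma_sets_subset) (auto simp: C_def intro!: sets_Int_cb)
    interpret S: sigma_algebra "space M" "sigma_sets (space M) (range C)"
      using sub by (rule sigma_algebra_sigma_sets)
    have cbS: "cb p \<in> sigma_sets (space M) (range C)" for p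
    proof -
      have "cb p = space M \<inter> (\<Inter>q\<in>set [p]. cb q)" using cb_space[of p] by auto
      then have "cb p \<in> range C" unfolding C by blast
      then show ?thesis by (rule sigma_sets.Basic)
    qed
    show "sets M \<subseteq> sigma_sets (space M) (range C)"
      unfolding sets_eq
    proof (rule S.sigma_sets_subset, clarify)
      fix U assume "openin mtopology U"
      then have U: "U = (\<Union>p\<in>{p. cb p \<subseteq> U}. cb p)" by (rule open_Union_cb)
      have "(\<Union>p\<in>{p. cb p \<subseteq> U}. cb p) \<in> sigma_sets (space M) (range C)"
        by (intro S.countable_UN'' cbS) auto
      with U show "U \<in> sigma_sets (space M) (range C)" by simp
    qed
  qed
  ultimately show ?thesis by blast
qed

text \<open>The balls \<open>cb p\<close> separate points, so recording which of them contain
  \<open>x\<close> is injective, and \<open>ternary\<close> turns the record into one real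
  number.\<close>

lemma real_label_exists:
  "\<exists>u. u \<in> borel_measurable M \<and> inj_on u (space M) \<and> (\<forall>x. 0 \<le> u x \<and> u x < (1::real))"
proof -
  define u where "u x = ternary (\<lambda>n. x \<in> cb (prod_decode n))" for x
  have cbM [measurable]: "cb p \<in> sets M" for p by (rule closed_sets[OF cb_closed])
  have "u \<in> borel_measurable M" unfolding u_def ternary_def by measurable
  moreover have "inj_on u (space M)"
  proof (rule inj_onI, rule ccontr)
    fix x y assume xy: "x \<in> space M" "y \<in> space M" "u x = u y" "x \<noteq> y"
    then obtain p where p: "x \<in> cb p \<and> y \<notin> cb p" using cb_separates by blast
    have "(\<lambda>n. x \<in> cb (prod_decode n)) = (\<lambda>n. y \<in> cb (prod_decode n))"
      using injD[OF inj_ternary] xy(3) unfolding u_def by blast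
    then have "x \<in> cb (prod_decode (prod_encode p)) \<longleftrightarrow> y \<in> cb (prod_decode (prod_encode p))" by meson
    with p show False by simp
  qed
  moreover have "0 \<le> u x \<and> u x < 1" for x unfolding u_def by (rule ternary_bounds)
  ultimately show ?thesis by blast
qed

end

section \<open>Countable measure-preserving equivalence relations\<close>

abbreviation linked :: "('v \<times> 'v) set \<Rightarrow> ('v \<times> 'v) set" where
  "linked P \<equiv> (P \<union> P\<inverse>)\<^sup>*"

lemma converse_sets_pair:
  assumes "P \<in> sets (M \<Otimes>\<^sub>M M)"
  shows "P\<inverse> \<in> sets (M \<Otimes>\<^sub>M M)"
proof -
  have "(\<lambda>(x, y). (y, x)) -` P \<inter> space (M \<Otimes>\<^sub>M M) \<in> sets (M \<Otimes>\<^sub>M M)"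
    using measurable_pair_swap' assms by (rule measurable_sets)
  also have "(\<lambda>(x, y). (y, x)) -` P \<inter> space (M \<Otimes>\<^sub>M M) = P\<inverse>"
    using sets.sets_into_space[OF assms] by (auto simp: space_pair_measure)
  finally show ?thesis .
qed

abbreviation deg :: "('a \<times> 'a) set \<Rightarrow> 'a \<Rightarrow> ennreal" where
  "deg P x \<equiv> emeasure (count_space UNIV) (P `` {x})"

lemma deg_UN:
  assumes "disjoint_family P"
  shows "deg (\<Union>i::nat. P i) x = (\<Sum>i. deg (P i) x)"
proof -
  have "(\<Sum>i. deg (P i) x) = emeasure (count_space UNIV) (\<Union>i. P i `` {x})"
    using assms by (intro suminf_emeasure) (auto simp: disjoint_family_on_def)
  moreover have "(\<Union>i. P i `` {x}) = (\<Union>i. P i) `` {x}" by auto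
  ultimately show ?thesis by simp
qed

lemma deg_single_valued:
  assumes "single_valued P"
  shows "deg P x = indicator (Domain P) x"
proof (cases "x \<in> Domain P")
  case True
  then obtain y where "(x, y) \<in> P" by auto
  then have "P `` {x} = {y}" using assms by (auto simp: single_valued_def)
  then show ?thesis using True by simp
next
  case False
  then have "P `` {x} = {}" by auto
  then show ?thesis using False by simp
qed

lemma deg_mono: "P \<subseteq> Q \<Longrightarrow> deg P x \<le> deg Q x"
  by (rule emeasure_mono) auto

text \<open>The classes are enumerated by measurable maps, as provided by the Lusin--Novikov theorem. The
  injective label \<open>u\<close> makes the diagonal measurable and is used to order points.\<close>

locale crel = prob_space M for M :: "'a measure" +
  fixes E :: "('a \<times> 'a) set" and u :: "'a \<Rightarrow> real"
  assumes equiv: "equiv (space M) E"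
    and E_sets [measurable]: "E \<in> sets (M \<Otimes>\<^sub>M M)"
    and E_graphs: "\<exists>f::nat \<Rightarrow> 'a \<Rightarrow> 'a. (\<forall>n. f n \<in> M \<rightarrow>\<^sub>M M) \<and> E = {(x, f n x) |n x. x \<in> space M}"
    and invariant: "type_II1 M E"
    and u_measurable [measurable]: "u \<in> borel_measurable M"
    and u_inj: "inj_on u (space M)"
    and u_bounds: "0 \<le> u x" "u x < 1"
    and atomless: "x \<in> space M \<Longrightarrow> emeasure M {x} = 0"
begin

definition F :: "nat \<Rightarrow> 'a \<Rightarrow> 'a" where
  "F = (SOME f. (\<forall>n. f n \<in> M \<rightarrow>\<^sub>M M) \<and> E = {(x, f n x) |n x. x \<in> space M})"

lemma
  shows F_measurable [measurable]: "F n \<in> M \<rightarrow>\<^sub>M M"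
    and E_eq: "E = {(x, F n x) |n x. x \<in> space M}"
  using someI_ex[OF E_graphs] unfolding F_def[symmetric] by blast+

lemma E_F: "(x, y) \<in> E \<Longrightarrow> \<exists>n. y = F n x"
  by (subst (asm) E_eq) blast

lemma F_space: "x \<in> space M \<Longrightarrow> F n x \<in> space M"
  using F_measurable by (rule measurable_space)

lemma E_space: "E \<subseteq> space M \<times> space M"
  using equiv by (rule equiv_type)

lemma E_refl: "x \<in> space M \<Longrightarrow> (x, x) \<in> E"
  using equiv by (meson equivE refl_onD)

lemma E_sym: "(x, y) \<in> E \<Longrightarrow> (y, x) \<in> E"
  using equiv by (meson equivE symD)

lemma E_trans: "(x, y) \<in> E \<Longrightarrow> (y, z) \<in> E \<Longrightarrow> (x, z) \<in> E"
  using equiv by (meson equivE transD)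

lemma E_countable: "countable (E `` {x})"
proof (cases "x \<in> space M")
  case True
  then have "E `` {x} = range (\<lambda>n. F n x)" by (subst E_eq) auto
  then show ?thesis by simp
next
  case False
  then have "E `` {x} = {}" using E_space by auto
  then show ?thesis by simp
qed

section \<open>Calculus of measurable subrelations\<close>

definition rel :: "('a \<times> 'a) set \<Rightarrow> bool" where
  "rel P \<longleftrightarrow> P \<in> sets (M \<Otimes>\<^sub>M M) \<and> P \<subseteq> E"

lemma relI: "P \<in> sets (M \<Otimes>\<^sub>M M) \<Longrightarrow> P \<subseteq> E \<Longrightarrow> rel P" and
  relD: "rel P \<Longrightarrow> P \<in> sets (M \<Otimes>\<^sub>M M)" "rel P \<Longrightarrow> P \<subseteq> E"
  by (auto simp: rel_def)

lemma rel_space: "rel P \<Longrightarrow> (x, y) \<in> P \<Longrightarrow> x \<in> space M \<and> y \<in> space M"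
  using relD(2) E_space by blast

lemma rel_E: "rel E" by (simp add: rel_def E_sets)

lemma rel_empty: "rel {}" by (simp add: rel_def)

lemma rel_Un: "rel P \<Longrightarrow> rel Q \<Longrightarrow> rel (P \<union> Q)"
  and rel_Int: "rel P \<Longrightarrow> rel Q \<Longrightarrow> rel (P \<inter> Q)"
  and rel_Diff: "rel P \<Longrightarrow> rel Q \<Longrightarrow> rel (P - Q)"
  by (auto simp: rel_def)

lemma rel_UN: "(\<And>i::nat. rel (P i)) \<Longrightarrow> rel (\<Union>i. P i)"
  and rel_INT: "(\<And>i::nat. rel (P i)) \<Longrightarrow> rel (\<Inter>i. P i)"
  by (auto simp: rel_def)

lemma rel_converse: "rel P \<Longrightarrow> rel (P\<inverse>)"
  using E_sym by (auto simp: rel_def intro!: converse_sets_pair)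

lemma rel_Int_times: "rel P \<Longrightarrow> A \<in> sets M \<Longrightarrow> B \<in> sets M \<Longrightarrow> rel (P \<inter> A \<times> B)"
  by (auto simp: rel_def)

lemma rel_Int_fst: "rel P \<Longrightarrow> A \<in> sets M \<Longrightarrow> rel (P \<inter> A \<times> UNIV)"
proof -
  assume *: "rel P" "A \<in> sets M"
  then have "P \<inter> A \<times> UNIV = P \<inter> A \<times> space M" using rel_space by blast
  then show ?thesis using rel_Int_times * by auto
qed

lemma rel_Int_snd: "rel P \<Longrightarrow> A \<in> sets M \<Longrightarrow> rel (P \<inter> UNIV \<times> A)"
proof -
  assume *: "rel P" "A \<in> sets M"
  then have "P \<inter> UNIV \<times> A = P \<inter> space M \<times> A" using rel_space by blast
  then show ?thesis using rel_Int_times * by auto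
qed

text \<open>Projections of Borel sets need not be Borel; here the enumeration of the fibres by the
  maps \<open>F n\<close> turns the projection into a countable union.\<close>

lemma Domain_sets:
  assumes "rel P"
  shows "Domain P \<in> sets M"
proof -
  note [measurable] = relD(1)[OF assms]
  have "Domain P = (\<Union>n. {x\<in>space M. (x, F n x) \<in> P})"
    using relD(2)[OF assms] E_space by (subst (asm) E_eq) auto
  also have "\<dots> \<in> sets M" by measurable
  finally show ?thesis .
qed

lemma Range_sets: "rel P \<Longrightarrow> Range P \<in> sets M"
  using Domain_sets[OF rel_converse] by simp

lemma Image_sets:
  assumes "rel P" "A \<in> sets M"
  shows "P `` A \<in> sets M"
proof -
  have "P `` A = Range (P \<inter> A \<times> UNIV)" by auto
  then show ?thesis using assms Range_sets rel_Int_fst by metis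
qed

lemma rel_comp:
  assumes "rel P" "rel Q"
  shows "rel (P O Q)"
proof (rule relI)
  note [measurable] = relD(1)[OF assms(1)] relD(1)[OF assms(2)]
  have "P O Q = (\<Union>n. {p\<in>space (M \<Otimes>\<^sub>M M). (fst p, F n (fst p)) \<in> P \<and> (F n (fst p), snd p) \<in> Q})"
  proof (intro equalityI subsetI)
    fix p assume "p \<in> P O Q"
    then obtain x y z where p: "p = (x, z)" "(x, y) \<in> P" "(y, z) \<in> Q" by auto
    moreover obtain n where "y = F n x" using p(2) relD(2)[OF assms(1)] E_F by blast
    moreover have "x \<in> space M" "z \<in> space M" using p rel_space assms by blast+
    ultimately show "p \<in> (\<Union>n. {p\<in>space (M \<Otimes>\<^sub>M M). (fst p, F n (fst p)) \<in> P \<and> (F n (fst p), snd p) \<in> Q})"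
      by (auto simp: space_pair_measure)
  qed auto
  also have "\<dots> \<in> sets (M \<Otimes>\<^sub>M M)" by measurable
  finally show "P O Q \<in> sets (M \<Otimes>\<^sub>M M)" .
  show "P O Q \<subseteq> E" using relD(2) assms E_trans by blast
qed

lemma rel_Collect_less:
  assumes "rel P" "f \<in> borel_measurable M" "g \<in> borel_measurable M"
  shows "rel {(x, y)\<in>P. f x < (g y :: real)}"
proof (rule relI)
  note [measurable] = relD(1)[OF assms(1)] assms(2,3)
  have "{(x, y)\<in>P. f x < g y} = P \<inter> {p\<in>space (M \<Otimes>\<^sub>M M). f (fst p) < g (snd p)}"
    using rel_space[OF assms(1)] by (auto simp: space_pair_measure)
  also have "\<dots> \<in> sets (M \<Otimes>\<^sub>M M)" by measurable
  finally show "{(x, y)\<in>P. f x < g y} \<in> sets (M \<Otimes>\<^sub>M M)" .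
qed (use relD(2) assms in blast)

lemma rel_graph:
  assumes "A \<in> sets M" "f \<in> restrict_space M A \<rightarrow>\<^sub>M M" "\<And>x. x \<in> A \<Longrightarrow> (x, f x) \<in> E"
  shows "rel {(x, f x) |x. x \<in> A}"
proof (rule relI)
  \<comment> \<open>Labels lie below 1, so the default 2 is the label of no point, and the equation
    below cannot hold for a first coordinate outside \<open>A\<close>.\<close>
  have [measurable]: "(\<lambda>x. if x \<in> A then u (f x) else 2) \<in> borel_measurable M"
    using assms(1) by (subst measurable_If_restrict_space_iff)
      (auto intro!: measurable_compose[OF assms(2)])
  have "{(x, f x) |x. x \<in> A} = E \<inter> {p\<in>space (M \<Otimes>\<^sub>M M). u (snd p) = (if fst p \<in> A then u (f (fst p)) else 2)}"
  proof (intro equalityI subsetI)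
    fix p assume "p \<in> {(x, f x) |x. x \<in> A}"
    then show "p \<in> E \<inter> {p\<in>space (M \<Otimes>\<^sub>M M). u (snd p) = (if fst p \<in> A then u (f (fst p)) else 2)}"
      using assms(3) E_space by (auto simp: space_pair_measure)
  next
    fix p assume p: "p \<in> E \<inter> {p\<in>space (M \<Otimes>\<^sub>M M). u (snd p) = (if fst p \<in> A then u (f (fst p)) else 2)}"
    obtain x y where xy: "p = (x, y)" by fastforce
    have A: "x \<in> A" using p xy u_bounds(2)[of y] by (auto split: if_splits)
    then have "u y = u (f x)" using p xy by simp
    moreover have "y \<in> space M" "f x \<in> space M" using p xy A assms(3) E_space by blast+
    ultimately have "y = f x" using u_inj by (auto dest: inj_onD)
    with A xy show "p \<in> {(x, f x) |x. x \<in> A}" by blast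
  qed
  also have "\<dots> \<in> sets (M \<Otimes>\<^sub>M M)" by measurable
  finally show "{(x, f x) |x. x \<in> A} \<in> sets (M \<Otimes>\<^sub>M M)" .
qed (use assms in auto)

lemma rel_Id_on: "A \<in> sets M \<Longrightarrow> rel (Id_on A)"
proof -
  assume A: "A \<in> sets M"
  have "Id_on A = {(x, x) |x. x \<in> A}" by auto
  moreover have "rel {(x, x) |x. x \<in> A}"
    by (rule rel_graph[OF A]) (use E_refl sets.sets_into_space[OF A] in \<open>auto simp: measurable_restrict_space1\<close>)
  ultimately show ?thesis by simp
qed

lemma rel_relpow: "rel P \<Longrightarrow> rel (P ^^ Suc n)"
proof (induction n)
  case (Suc n)
  then have "rel ((P ^^ Suc n) O P)" by (intro rel_comp) auto
  then show ?case by simp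
qed simp

lemma generated_rel_alt:
  assumes "P \<subseteq> space M \<times> space M"
  shows "generated_rel M P = Id_on (space M) \<union> (\<Union>n. (P \<union> P\<inverse>) ^^ Suc n)"
proof -
  have "((P \<union> P\<inverse>) ^^ Suc n) \<subseteq> space M \<times> space M" for n
    using assms by (induction n) (auto simp: relcomp_unfold)
  moreover have "linked P = Id \<union> (\<Union>n. (P \<union> P\<inverse>) ^^ Suc n)"
  proof (intro equalityI subsetI)
    fix p :: "'a \<times> 'a" assume "p \<in> linked P"
    then obtain n where "p \<in> (P \<union> P\<inverse>) ^^ n" by (metis UN_E rtrancl_is_UN_relpow)
    then show "p \<in> Id \<union> (\<Union>n. (P \<union> P\<inverse>) ^^ Suc n)" by (cases n) auto
  next
    fix p :: "'a \<times> 'a" assume "p \<in> Id \<union> (\<Union>n. (P \<union> P\<inverse>) ^^ Suc n)"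
    then show "p \<in> linked P"
      using relpow_imp_rtrancl[of p] by (auto simp del: relpow.simps)
  qed
  ultimately show ?thesis by (auto simp: generated_rel_def simp del: relpow.simps)
qed

lemma rel_generated: "rel P \<Longrightarrow> rel (generated_rel M P)"
  by (subst generated_rel_alt)
     (use rel_space in \<open>auto intro!: rel_Un rel_UN rel_relpow rel_converse rel_Id_on simp del: relpow.simps\<close>)

end

lemma linked_sym: "(x, y) \<in> linked P \<Longrightarrow> (y, x) \<in> linked P"
proof -
  have "sym (P \<union> P\<inverse>)" by (auto simp: sym_def)
  then show "(x, y) \<in> linked P \<Longrightarrow> (y, x) \<in> linked P" by (metis sym_rtrancl symD)
qed

lemma equiv_generated: "equiv (space M) (generated_rel M P)"
proof (rule equivI)
  show "generated_rel M P \<subseteq> space M \<times> space M" by (auto simp: generated_rel_def)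
  show "refl_on (space M) (generated_rel M P)" by (auto simp: generated_rel_def refl_on_def)
  show "sym (generated_rel M P)" by (auto simp: generated_rel_def sym_def intro: linked_sym)
  show "trans (generated_rel M P)" by (auto simp: generated_rel_def trans_def)
qed

context crel
begin

text \<open>Lets the theory be applied inside a subrelation, namely the one generated by
  \<open>T\<close>. Where \<open>F n\<close> leaves \<open>S\<close> it is replaced by the identity,
  whose graph lies in \<open>S\<close>.\<close>

lemma sub_crel:
  assumes S: "rel S" and eq: "equiv (space M) S"
  shows "crel M S u"
proof unfold_locales
  note [measurable] = relD(1)[OF S]
  show "S \<in> sets (M \<Otimes>\<^sub>M M)" by measurable
  show "\<exists>f::nat \<Rightarrow> 'a \<Rightarrow> 'a. (\<forall>n. f n \<in> M \<rightarrow>\<^sub>M M) \<and> S = {(x, f n x) |n x. x \<in> space M}"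
  proof (intro exI[of _ "\<lambda>n x. if (x, F n x) \<in> S then F n x else x"] conjI allI)
    fix n
    show "(\<lambda>x. if (x, F n x) \<in> S then F n x else x) \<in> M \<rightarrow>\<^sub>M M" by measurable
  next
    have "(x, y) \<in> {(x, if (x, F n x) \<in> S then F n x else x) |n x. x \<in> space M}" if xy: "(x, y) \<in> S" for x y
    proof -
      obtain n where "y = F n x" using xy relD(2)[OF S] E_F by blast
      moreover have "x \<in> space M" using xy rel_space[OF S] by blast
      ultimately show ?thesis using xy by auto
    qed
    moreover have "(x, x) \<in> S" if "x \<in> space M" for x using eq that by (meson equivE refl_onD)
    ultimately have "S \<subseteq> {(x, if (x, F n x) \<in> S then F n x else x) |n x. x \<in> space M}"
      "{(x, if (x, F n x) \<in> S then F n x else x) |n x. x \<in> space M} \<subseteq> S"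
      by (auto simp only: subset_iff split_paired_all) (auto split: if_splits)
    then show "S = {(x, if (x, F n x) \<in> S then F n x else x) |n x. x \<in> space M}" by (rule equalityI)
  qed
  show "type_II1 M S"
    unfolding type_II1_def
  proof (intro allI impI)
    fix A f assume "partial_automorphism M S A f"
    then have "partial_automorphism M E A f" using relD(2)[OF S] by (auto simp: partial_automorphism_def)
    then show "\<forall>B\<in>events. B \<subseteq> A \<longrightarrow> emeasure M (f ` B) = emeasure M B"
      using invariant by (auto simp: type_II1_def)
  qed
qed (use eq u_inj u_bounds atomless in auto)

text \<open>Partial automorphisms are represented by their graphs.\<close>

definition pa :: "('a \<times> 'a) set \<Rightarrow> bool" where
  "pa P \<longleftrightarrow> rel P \<and> single_valued P \<and> single_valued (P\<inverse>)"

lemma paD: "pa P \<Longrightarrow> rel P" "pa P \<Longrightarrow> single_valued P" "pa P \<Longrightarrow> single_valued (P\<inverse>)"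
  by (auto simp: pa_def)

lemma pa_converse: "pa P \<Longrightarrow> pa (P\<inverse>)"
  by (auto simp: pa_def rel_converse)

lemma pa_subset: "pa P \<Longrightarrow> rel Q \<Longrightarrow> Q \<subseteq> P \<Longrightarrow> pa Q"
  unfolding pa_def by (meson converse_mono single_valued_subset)

lemma pa_comp: "pa P \<Longrightarrow> pa Q \<Longrightarrow> pa (P O Q)"
  unfolding pa_def by (auto simp: rel_comp single_valued_relcomp converse_relcomp)

lemma pa_UN:
  assumes "\<And>i::nat. pa (P i)" "disjoint_family (\<lambda>i. Domain (P i))" "disjoint_family (\<lambda>i. Range (P i))"
  shows "pa (\<Union>i. P i)"
  unfolding pa_def
proof (intro conjI)
  show "rel (\<Union>i. P i)" using assms(1) paD(1) by (intro rel_UN) auto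
  show "single_valued (\<Union>i. P i)"
  proof (rule single_valuedI, clarify)
    fix x y z i j assume *: "(x, y) \<in> P i" "(x, z) \<in> P j"
    then have "x \<in> Domain (P i) \<inter> Domain (P j)" by auto
    then have "i = j" using assms(2) by (auto simp: disjoint_family_on_def)
    then show "y = z" using * paD(2)[OF assms(1)] by (auto dest: single_valuedD)
  qed
  show "single_valued ((\<Union>i. P i)\<inverse>)"
  proof (rule single_valuedI, clarify)
    fix x y z i j assume *: "(y, x) \<in> P i" "(z, x) \<in> P j"
    then have "x \<in> Range (P i) \<inter> Range (P j)" by auto
    then have "i = j" using assms(3) by (auto simp: disjoint_family_on_def)
    then show "y = z" using * paD(3)[OF assms(1)] by (auto dest: single_valuedD)
  qed
qed

lemma pa_incseq:
  assumes "\<And>i::nat. pa (P i)" "incseq P"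
  shows "pa (\<Union>i. P i)"
  unfolding pa_def
proof (intro conjI)
  have *: "\<exists>k. P i \<subseteq> P k \<and> P j \<subseteq> P k" for i j
    using incseqD[OF assms(2), of i "max i j"] incseqD[OF assms(2), of j "max i j"]
    by (intro exI[of _ "max i j"]) auto
  show "rel (\<Union>i. P i)" using assms(1) paD(1) by (intro rel_UN) auto
  show "single_valued (\<Union>i. P i)"
  proof (rule single_valuedI, clarify)
    fix x y z i j assume **: "(x, y) \<in> P i" "(x, z) \<in> P j"
    obtain k where "P i \<subseteq> P k" "P j \<subseteq> P k" using * by blast
    then show "y = z" using ** single_valuedD[OF paD(2)[OF assms(1)[of k]], of x y z] by blast
  qed
  show "single_valued ((\<Union>i. P i)\<inverse>)"
  proof (rule single_valuedI, clarify)
    fix x y z i j assume **: "(y, x) \<in> P i" "(z, x) \<in> P j"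
    obtain k where "P i \<subseteq> P k" "P j \<subseteq> P k" using * by blast
    then show "y = z" using ** single_valuedD[OF paD(3)[OF assms(1)[of k]], of x y z] by blast
  qed
qed

lemma pa_Un:
  assumes "pa P" "pa Q" "Domain P \<inter> Domain Q = {}" "Range P \<inter> Range Q = {}"
  shows "pa (P \<union> Q)"
  unfolding pa_def
proof (intro conjI)
  show "rel (P \<union> Q)" using assms paD(1) by (intro rel_Un) auto
  show "single_valued (P \<union> Q)"
    using single_valuedD[OF paD(2)[OF assms(1)]] single_valuedD[OF paD(2)[OF assms(2)]] assms(3)
    by (intro single_valuedI) blast
  show "single_valued ((P \<union> Q)\<inverse>)"
    using single_valuedD[OF paD(3)[OF assms(1)]] single_valuedD[OF paD(3)[OF assms(2)]] assms(4)
    by (intro single_valuedI) blast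
qed

lemma pa_function:
  assumes "pa P"
  obtains f where "\<And>x y. (x, y) \<in> P \<longleftrightarrow> x \<in> Domain P \<and> y = f x"
proof -
  define f where "f x = (SOME y. (x, y) \<in> P)" for x
  have "(x, y) \<in> P \<longleftrightarrow> x \<in> Domain P \<and> y = f x" for x y
    unfolding f_def using paD(2)[OF assms] by (metis Domain.DomainI Domain.cases single_valuedD someI)
  then show ?thesis using that by blast
qed

lemma pa_function_measurable:
  assumes "pa P" and f: "\<And>x y. (x, y) \<in> P \<longleftrightarrow> x \<in> Domain P \<and> y = f x"
  shows "f \<in> restrict_space M (Domain P) \<rightarrow>\<^sub>M restrict_space M (Range P)"
proof (rule measurableI)
  have D: "Domain P \<in> sets M" and R: "Range P \<in> sets M"
    using Domain_sets Range_sets paD assms by auto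
  have sp: "space (restrict_space M (Domain P)) = Domain P"
    using sets.sets_into_space[OF D] by (auto simp: space_restrict_space)
  show "f x \<in> space (restrict_space M (Range P))" if "x \<in> space (restrict_space M (Domain P))" for x
    using that sets.sets_into_space[OF R] f[of x "f x"] unfolding sp by (auto simp: space_restrict_space)
  fix B assume B: "B \<in> sets (restrict_space M (Range P))"
  then have B': "B \<in> sets M" "B \<subseteq> Range P" using R by (auto simp: sets_restrict_space_iff)
  have "f -` B \<inter> Domain P = Domain (P \<inter> UNIV \<times> B)" using f by auto
  also have "\<dots> \<in> sets M" using B' paD(1)[OF assms(1)] by (intro Domain_sets rel_Int_snd)
  finally show "f -` B \<inter> space (restrict_space M (Domain P)) \<in> sets (restrict_space M (Domain P))"
    unfolding sp using D by (auto simp: sets_restrict_space_iff)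
qed

lemma pa_partial_automorphism:
  assumes "pa P" and f: "\<And>x y. (x, y) \<in> P \<longleftrightarrow> x \<in> Domain P \<and> y = f x" and "P \<subseteq> R"
  shows "partial_automorphism M R (Domain P) f" "P = fun_graph (Domain P) f"
proof -
  show P: "P = fun_graph (Domain P) f" using f by (auto simp: fun_graph_def)
  have im: "f ` Domain P = Range P" using f by auto
  have inj: "inj_on f (Domain P)"
    using f paD(3)[OF assms(1)] by (intro inj_onI) (metis converseI single_valuedD)
  obtain g where g: "\<And>x y. (x, y) \<in> P\<inverse> \<longleftrightarrow> x \<in> Domain (P\<inverse>) \<and> y = g x"
    using pa_function[OF pa_converse[OF assms(1)]] by blast
  have "the_inv_into (Domain P) f y = g y" if y: "y \<in> Range P" for y
  proof -
    have "(y, g y) \<in> P\<inverse>" using g y by auto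
    then have "g y \<in> Domain P" "f (g y) = y" using f by auto
    then show ?thesis using inj by (metis the_inv_into_f_f)
  qed
  moreover have "g \<in> restrict_space M (Range P) \<rightarrow>\<^sub>M restrict_space M (Domain P)"
    using pa_function_measurable[OF pa_converse[OF assms(1)] g] by simp
  ultimately have "the_inv_into (Domain P) f \<in> restrict_space M (Range P) \<rightarrow>\<^sub>M restrict_space M (Domain P)"
    by (subst measurable_cong[of _ _ g]) (auto simp: space_restrict_space)
  then show "partial_automorphism M R (Domain P) f"
    unfolding partial_automorphism_def im
    using pa_function_measurable[OF assms(1) f] inj P assms(3) Domain_sets Range_sets paD(1)[OF assms(1)] by metis
qed

lemma pa_measure:
  assumes "pa P"
  shows "emeasure M (Range P) = emeasure M (Domain P)"
proof -
  obtain f where f: "\<And>x y. (x, y) \<in> P \<longleftrightarrow> x \<in> Domain P \<and> y = f x"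
    using pa_function[OF assms] by blast
  have "partial_automorphism M E (Domain P) f"
    using pa_partial_automorphism(1)[OF assms f] relD(2) paD(1)[OF assms] by blast
  then have "emeasure M (f ` Domain P) = emeasure M (Domain P)"
    using invariant Domain_sets[OF paD(1)[OF assms]] unfolding type_II1_def by blast
  moreover have "f ` Domain P = Range P" using f by auto
  ultimately show ?thesis by simp
qed

text \<open>\<open>F m\<close> is a left inverse of \<open>F n\<close> on the domain, which makes
  each piece injective. As \<open>E\<close> is symmetric, every pair is of the form
  \<open>y = F n x\<close> and \<open>x = F m y\<close>, so the pieces exhaust
  \<open>E\<close>.\<close>

definition \<Phi> :: "nat \<Rightarrow> ('a \<times> 'a) set" where
  "\<Phi> k = (case prod_decode k of (n, m) \<Rightarrow> {(x, F n x) |x. x \<in> {x\<in>space M. F m (F n x) = x}})"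

lemma pa_\<Phi>: "pa (\<Phi> k)"
proof -
  obtain n m where k: "prod_decode k = (n, m)" by fastforce
  have "{x\<in>space M. F m (F n x) = x} = {x\<in>space M. u (F m (F n x)) = u x}"
    using u_inj F_space by (auto dest: inj_onD)
  also have "\<dots> \<in> sets M" by measurable
  finally have "rel (\<Phi> k)"
    unfolding \<Phi>_def k prod.case
    by (intro rel_graph) (auto simp: measurable_restrict_space1, subst E_eq, auto)
  then show ?thesis
    by (auto simp: pa_def \<Phi>_def k single_valued_def)
qed

lemma UN_\<Phi>: "(\<Union>k. \<Phi> k) = E"
proof
  show "(\<Union>k. \<Phi> k) \<subseteq> E" using pa_\<Phi> paD relD by blast
  show "E \<subseteq> (\<Union>k. \<Phi> k)"
  proof clarify
    fix x y assume xy: "(x, y) \<in> E"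
    obtain n where n: "y = F n x" using E_F[OF xy] by blast
    obtain m where m: "x = F m y" using E_F[OF E_sym[OF xy]] by blast
    have "x \<in> space M" using xy E_space by blast
    have "(x, y) \<in> \<Phi> (prod_encode (n, m))" using n m \<open>x \<in> space M\<close> by (auto simp: \<Phi>_def)
    then show "(x, y) \<in> (\<Union>k. \<Phi> k)" by blast
  qed
qed

definition \<Psi> :: "nat \<Rightarrow> ('a \<times> 'a) set" where
  "\<Psi> = disjointed \<Phi>"

lemma pa_\<Psi>: "pa (\<Psi> k)"
proof (rule pa_subset[OF pa_\<Phi>])
  show "\<Psi> k \<subseteq> \<Phi> k" by (simp add: \<Psi>_def disjointed_subset)
  show "rel (\<Psi> k)"
    using pa_\<Phi> paD relD unfolding \<Psi>_def disjointed_def by (intro relI) (auto, blast)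
qed

lemma UN_\<Psi>: "(\<Union>k. \<Psi> k) = E" and disjoint_\<Psi>: "disjoint_family \<Psi>"
  unfolding \<Psi>_def by (auto simp: UN_disjointed_eq UN_\<Phi> disjoint_family_disjointed)

lemma rel_pieces:
  assumes "rel P"
  shows "P = (\<Union>k. P \<inter> \<Psi> k)" "disjoint_family (\<lambda>k. P \<inter> \<Psi> k)" "pa (P \<inter> \<Psi> k)"
proof -
  show "P = (\<Union>k. P \<inter> \<Psi> k)" using relD(2)[OF assms] UN_\<Psi> by blast
  show "disjoint_family (\<lambda>k. P \<inter> \<Psi> k)"
    using disjoint_\<Psi> unfolding disjoint_family_on_def by blast
  show "pa (P \<inter> \<Psi> k)"
    by (rule pa_subset[OF pa_\<Psi> rel_Int[OF assms paD(1)[OF pa_\<Psi>]]]) blast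
qed

section \<open>The mass of a subrelation\<close>

lemma deg_measurable [measurable]:
  assumes "rel P"
  shows "deg P \<in> borel_measurable M"
proof -
  have "deg P x = (\<Sum>k. indicator (Domain (P \<inter> \<Psi> k)) x)" for x
    using deg_UN[OF rel_pieces(2)[OF assms], of x] deg_single_valued[OF paD(2)[OF rel_pieces(3)[OF assms]]]
    unfolding rel_pieces(1)[OF assms, symmetric] by simp
  moreover have "Domain (P \<inter> \<Psi> k) \<in> sets M" for k
    using Domain_sets paD(1) rel_pieces(3)[OF assms] by blast
  ultimately show ?thesis by simp
qed

text \<open>The measure on the relation, expressed by out-degrees. For a graphing that is disjoint
  from its converse it is the cost.\<close>

definition mass :: "('a \<times> 'a) set \<Rightarrow> ennreal" where
  "mass P = (\<integral>\<^sup>+x. deg P x \<partial>M)"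

lemma mass_mono: "P \<subseteq> Q \<Longrightarrow> mass P \<le> mass Q"
  unfolding mass_def by (intro nn_integral_mono deg_mono)

lemma mass_UN:
  assumes "\<And>i::nat. rel (P i)" "disjoint_family P"
  shows "mass (\<Union>i. P i) = (\<Sum>i. mass (P i))"
  unfolding mass_def deg_UN[OF assms(2)] using assms(1) by (intro nn_integral_suminf deg_measurable)

lemma mass_pa: "pa P \<Longrightarrow> mass P = emeasure M (Domain P)"
  unfolding mass_def using deg_single_valued[OF paD(2)] Domain_sets[OF paD(1)] by simp

text \<open>The mass transport principle: in-degree and out-degree have the same integral, because
  each piece \<open>P \<inter> \<Psi> k\<close> preserves the measure.\<close>

lemma mass_converse:
  assumes "rel P"
  shows "mass (P\<inverse>) = mass P"
proof -
  have "P\<inverse> = (\<Union>k. (P \<inter> \<Psi> k)\<inverse>)" using rel_pieces(1)[OF assms] by auto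
  then have "mass (P\<inverse>) = (\<Sum>k. mass ((P \<inter> \<Psi> k)\<inverse>))"
    using rel_pieces(2,3)[OF assms] mass_UN[of "\<lambda>k. (P \<inter> \<Psi> k)\<inverse>"] paD(1) rel_converse
    by (auto simp: disjoint_family_on_def)
  also have "\<dots> = (\<Sum>k. mass (P \<inter> \<Psi> k))"
    using rel_pieces(3)[OF assms] pa_measure by (auto simp: mass_pa pa_converse)
  also have "\<dots> = mass P"
    using mass_UN[of "\<lambda>k. P \<inter> \<Psi> k"] rel_pieces[OF assms] paD(1) by metis
  finally show ?thesis .
qed

lemma mass_Un:
  assumes "rel P" "rel Q" "P \<inter> Q = {}"
  shows "mass (P \<union> Q) = mass P + mass Q"
proof -
  have "deg (P \<union> Q) x = deg P x + deg Q x" for x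
  proof -
    have "P `` {x} \<inter> Q `` {x} = {}" using assms(3) by auto
    then show ?thesis
      using plus_emeasure[of "P `` {x}" "count_space UNIV" "Q `` {x}"] by (simp add: Un_Image)
  qed
  then show ?thesis unfolding mass_def using assms by (simp add: nn_integral_add)
qed

lemma mass_SUP:
  assumes "\<And>i::nat. rel (P i)" "incseq P"
  shows "mass (\<Union>i. P i) = (SUP i. mass (P i))"
proof -
  have "deg (\<Union>i. P i) x = (SUP i. deg (P i) x)" for x
  proof -
    have "(SUP i. deg (P i) x) = emeasure (count_space UNIV) (\<Union>i. P i `` {x})"
      using assms(2) by (intro SUP_emeasure_incseq) (auto simp: incseq_def)
    moreover have "(\<Union>i. P i `` {x}) = (\<Union>i. P i) `` {x}" by auto
    ultimately show ?thesis by simp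
  qed
  then show ?thesis
    unfolding mass_def using assms
    by (simp add: nn_integral_monotone_convergence_SUP deg_measurable incseq_def le_fun_def deg_mono)
qed

lemma rel_measure_eq_mass:
  assumes "P \<subseteq> R"
  shows "rel_measure M R P = mass P"
proof -
  have "P \<inter> rel_fibre R x = Pair x ` (P `` {x})" for x
    using assms by (auto simp: rel_fibre_def)
  then have "emeasure (count_space UNIV) (P \<inter> rel_fibre R x) = deg P x" for x
    by (simp add: emeasure_count_space finite_image_iff card_image inj_on_def)
  then show ?thesis by (simp add: rel_measure_def mass_def)
qed

end

section \<open>Ergodicity and towers\<close>

context crel
begin

lemma singleton_null:
  assumes "A \<in> sets M" "\<And>x y. x \<in> A \<Longrightarrow> y \<in> A \<Longrightarrow> x = y"
  shows "measure M A = 0"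
proof (cases "A = {}")
  case False
  then obtain x where "x \<in> A" by auto
  then have "A = {x}" using assms(2) by blast
  moreover have "x \<in> space M" using \<open>x \<in> A\<close> sets.sets_into_space[OF assms(1)] by blast
  ultimately show ?thesis using atomless by (simp add: measure_def)
qed simp

text \<open>The distribution function of \<open>v\<close> on \<open>A\<close> is continuous, since
  \<open>v\<close> is injective on \<open>A\<close> and points are null. The intermediate value
  theorem then yields every value \<open>s\<close>.\<close>

lemma cut_level:
  assumes A: "A \<in> sets M" and v [measurable]: "v \<in> borel_measurable M" and inj: "inj_on v A"
    and bounds: "\<And>x. x \<in> A \<Longrightarrow> a \<le> v x" "\<And>x. x \<in> A \<Longrightarrow> v x \<le> b"
    and s: "0 \<le> s" "s \<le> measure M A"
  shows "\<exists>t::real. measure M {x\<in>A. v x \<le> t} = s"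
proof -
  note [measurable] = A
  define N where "N = distr (density M (indicator A)) borel v"
  interpret R: finite_measure "density M (indicator A)"
    using A by (rule finite_measure_restricted)
  have "finite_measure N" unfolding N_def by (rule R.finite_measure_distr) simp
  then interpret N: finite_borel_measure N
    by (simp add: finite_borel_measure_def finite_borel_measure_axioms_def N_def)
  have N: "measure N B = measure M {x\<in>A. v x \<in> B}" if [measurable]: "B \<in> sets borel" for B
  proof -
    have "measure N B = measure (density M (indicator A)) (v -` B \<inter> space M)"
      unfolding N_def by (subst measure_distr) auto
    also have "\<dots> = measure M (A \<inter> (v -` B \<inter> space M))"
      by (intro measure_restricted) (auto simp: A)
    also have "A \<inter> (v -` B \<inter> space M) = {x\<in>A. v x \<in> B}" using sets.sets_into_space[OF A] by auto
    finally show ?thesis .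
  qed
  have cdf: "cdf N t = measure M {x\<in>A. v x \<le> t}" for t
    unfolding cdf_def by (subst N) auto
  have "measure N {t} = 0" for t
  proof -
    have "measure N {t} = measure M {x\<in>A. v x = t}" by (subst N) auto
    also have "\<dots> = 0"
      by (rule singleton_null) (use inj in \<open>auto dest: inj_onD\<close>)
    finally show ?thesis .
  qed
  then have cont: "isCont (cdf N) t" for t using N.isCont_cdf by simp
  have lo: "cdf N (a - 1) \<le> s"
  proof -
    have "{x\<in>A. v x \<le> a - 1} = {}" using bounds(1) by force
    then show ?thesis using s unfolding cdf by (simp only: measure_empty)
  qed
  have hi: "s \<le> cdf N (max a b)"
  proof -
    have "{x\<in>A. v x \<le> max a b} = A" using bounds(2) by (auto simp: le_max_iff_disj)
    then show ?thesis using s cdf by simp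
  qed
  have "\<exists>t. a - 1 \<le> t \<and> t \<le> max a b \<and> cdf N t = s"
    by (rule IVT[where f = "cdf N"]) (use lo hi cont in auto)
  then show ?thesis using cdf by auto
qed

lemma subset_of_measure:
  assumes A: "A \<in> sets M" and s: "0 \<le> s" "s \<le> measure M A"
  shows "\<exists>B\<in>sets M. B \<subseteq> A \<and> measure M B = s"
proof -
  have "inj_on u A" using u_inj sets.sets_into_space[OF A] by (rule inj_on_subset)
  then obtain t where "measure M {x\<in>A. u x \<le> t} = s"
    using cut_level[OF A u_measurable _ _ _ s, of 0 1] u_bounds by (auto intro: less_imp_le)
  moreover have "{x\<in>A. u x \<le> t} \<in> sets M" using A by measurable
  ultimately show ?thesis by (intro bexI[of _ "{x\<in>A. u x \<le> t}"]) auto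
qed

end

locale ergodic_crel = crel +
  assumes ergodic: "ergodic_rel M E"
begin

lemma saturation_null_or_full:
  assumes A: "A \<in> sets M" "measure M A > 0"
  shows "measure M (E `` A) = 1"
proof -
  have EA: "E `` A \<in> sets M" using rel_E A(1) by (rule Image_sets)
  have "E `` (E `` A) = E `` A"
    using E_trans E_refl E_space by blast
  then have "emeasure M (E `` A) = 0 \<or> emeasure M (E `` A) = 1"
    using ergodic EA unfolding ergodic_rel_def by blast
  moreover have "A \<subseteq> E `` A" using E_refl sets.sets_into_space[OF A(1)] by blast
  then have "measure M A \<le> measure M (E `` A)" using EA by (rule finite_measure_mono)
  ultimately show ?thesis using A(2) by (auto simp: measure_def)
qed

text \<open>Greedy matching along \<open>\<Phi> 0\<close>, \<open>\<Phi> 1\<close> and so on. No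
  pair of \<open>E\<close> can join an unmatched point of \<open>A\<close> to one of
  \<open>B\<close>. If the rest of \<open>A\<close> had positive measure, its saturation would be
  conull, so the rest of \<open>B\<close> would be null; equality of measures then makes the rest of
  \<open>A\<close> null as well.\<close>

lemma equidecomposable:
  assumes A: "A \<in> sets M" and B: "B \<in> sets M" and eq: "measure M A = measure M B"
  shows "\<exists>P. pa P \<and> Domain P \<subseteq> A \<and> Range P \<subseteq> B \<and> measure M (A - Domain P) = 0"
proof -
  define Q where "Q = rec_nat {} (\<lambda>n Q. Q \<union> (\<Phi> n \<inter> (A - Domain Q) \<times> (B - Range Q)))"
  have Q0: "Q 0 = {}" and QS: "Q (Suc n) = Q n \<union> (\<Phi> n \<inter> (A - Domain (Q n)) \<times> (B - Range (Q n)))" for n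
    by (simp_all add: Q_def)
  have pa: "pa (Q n)" for n
  proof (induction n)
    case 0
    then show ?case by (simp add: Q0 pa_def rel_empty)
  next
    case (Suc n)
    have "A - Domain (Q n) \<in> sets M" "B - Range (Q n) \<in> sets M"
      using A B Domain_sets Range_sets paD(1)[OF Suc] by auto
    then have "pa (\<Phi> n \<inter> (A - Domain (Q n)) \<times> (B - Range (Q n)))"
      using pa_subset[OF pa_\<Phi> rel_Int_times[OF paD(1)[OF pa_\<Phi>]]] by blast
    then show ?case unfolding QS by (intro pa_Un Suc) auto
  qed
  have "incseq Q" by (rule incseq_SucI) (auto simp: QS)
  define P where "P = (\<Union>n. Q n)"
  have P: "pa P" unfolding P_def using pa \<open>incseq Q\<close> by (rule pa_incseq)
  have sub: "Domain (Q n) \<subseteq> A" "Range (Q n) \<subseteq> B" for n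
    by (induction n) (auto simp: Q0 QS)
  have DP: "Domain P \<in> sets M" and RP: "Range P \<in> sets M"
    using Domain_sets Range_sets paD(1)[OF P] by auto
  have dA: "Domain P \<subseteq> A" and rB: "Range P \<subseteq> B" using sub unfolding P_def by blast+
  have "measure M (A - Domain P) = 0"
  proof (rule ccontr)
    assume "measure M (A - Domain P) \<noteq> 0"
    then have "measure M (A - Domain P) > 0" by (simp add: zero_less_measure_iff)
    then have full: "measure M (E `` (A - Domain P)) = 1"
      using A DP by (intro saturation_null_or_full) auto
    have "(B - Range P) \<inter> E `` (A - Domain P) = {}"
    proof (safe; simp only: empty_iff)
      fix x y assume xy: "(x, y) \<in> E" "x \<in> A" "x \<notin> Domain P" "y \<in> B" "y \<notin> Range P"
      then obtain n where "(x, y) \<in> \<Phi> n" using UN_\<Phi> by blast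
      moreover have "x \<notin> Domain (Q n)" "y \<notin> Range (Q n)" using xy unfolding P_def by blast+
      ultimately have "(x, y) \<in> Q (Suc n)" using xy by (auto simp: QS)
      then show False using xy by (auto simp: P_def)
    qed
    then have "measure M ((B - Range P) \<union> E `` (A - Domain P)) = measure M (B - Range P) + 1"
      using full B RP Image_sets[OF rel_E, of "A - Domain P"] A DP
      by (subst finite_measure_Union) auto
    then have "measure M (B - Range P) \<le> 0"
      using prob_le_1[of "(B - Range P) \<union> E `` (A - Domain P)"] by linarith
    then have "measure M B \<le> measure M (Range P)"
      using finite_measure_Diff[OF B RP rB] by simp
    also have "\<dots> = measure M (Domain P)" using pa_measure[OF P] by (simp add: measure_def)
    finally have "measure M (A - Domain P) \<le> 0"
      using finite_measure_Diff[OF A DP dA] eq by simp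
    then show False using \<open>measure M (A - Domain P) > 0\<close> by linarith
  qed
  with P dA rB show ?thesis by blast
qed

end

section \<open>Towers and their visits to a set\<close>

definition tower_graph :: "'a set \<Rightarrow> ('a \<Rightarrow> 'a) \<Rightarrow> ('a \<times> 'a) set" where
  "tower_graph B f = {(x, f x) |x. x \<in> B}"

definition visits :: "nat \<Rightarrow> (nat \<Rightarrow> 'a \<Rightarrow> 'a) \<Rightarrow> 'a set \<Rightarrow> 'a \<Rightarrow> nat" where
  "visits N g C x = (\<Sum>i<N. of_bool (g i x \<in> C))"

context crel
begin

text \<open>The \<open>N\<close> levels \<open>g i ` B\<close> are disjoint and have the measure of \<open>B\<close>, so that the last condition says
  that they cover the space up to a null set.\<close>

definition tower :: "nat \<Rightarrow> 'a set \<Rightarrow> (nat \<Rightarrow> 'a \<Rightarrow> 'a) \<Rightarrow> bool" where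
  "tower N B g \<longleftrightarrow> N > 0 \<and> B \<in> sets M \<and> (\<forall>i<N. rel (tower_graph B (g i))) \<and>
     (\<forall>i<N. \<forall>j<N. \<forall>x\<in>B. \<forall>y\<in>B. g i x = g j y \<longrightarrow> i = j \<and> x = y) \<and>
     (\<forall>x\<in>B. g 0 x = x) \<and> measure M B * N = 1"

lemma towerD:
  assumes "tower N B g"
  shows "N > 0" "B \<in> sets M" "i < N \<Longrightarrow> rel (tower_graph B (g i))"
    "i < N \<Longrightarrow> j < N \<Longrightarrow> x \<in> B \<Longrightarrow> y \<in> B \<Longrightarrow> g i x = g j y \<Longrightarrow> i = j \<and> x = y"
    "x \<in> B \<Longrightarrow> g 0 x = x" "measure M B * N = 1"
  using assms unfolding tower_def by blast+

lemma tower_pa: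
  assumes "tower N B g" "i < N"
  shows "pa (tower_graph B (g i))"
  using towerD(3)[OF assms] towerD(4)[OF assms(1,2,2)]
  unfolding pa_def by (auto simp: tower_graph_def single_valued_def)

lemma tower_graph_restrict:
  assumes "tower N B g" "i < N" "D \<in> sets M" "D \<subseteq> B"
  shows "pa (tower_graph D (g i))"
proof -
  have "tower_graph D (g i) = tower_graph B (g i) \<inter> D \<times> UNIV" using assms(4) by (auto simp: tower_graph_def)
  then show ?thesis
    using pa_subset[OF tower_pa[OF assms(1,2)] rel_Int_fst[OF towerD(3)[OF assms(1,2)] assms(3)]] by auto
qed

lemma tower_visit_sets:
  assumes "tower N B g" "i < N" "D \<in> sets M" "D \<subseteq> B" "C \<in> sets M"
  shows "{x\<in>D. g i x \<in> C} \<in> sets M" "g i ` D \<in> sets M"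
    "measure M (g i ` {x\<in>D. g i x \<in> C}) = measure M {x\<in>D. g i x \<in> C}"
proof -
  have "Domain (tower_graph D (g i) \<inter> UNIV \<times> C) = {x\<in>D. g i x \<in> C}" by (auto simp: tower_graph_def)
  then show *: "{x\<in>D. g i x \<in> C} \<in> sets M"
    using Domain_sets[OF rel_Int_snd[OF paD(1)[OF tower_graph_restrict[OF assms(1-4)]] assms(5)]] by simp
  have im: "Range (tower_graph D (g i)) = g i ` D" "Domain (tower_graph D (g i)) = D" for D by (auto simp: tower_graph_def)
  show "g i ` D \<in> sets M"
    using Range_sets[OF paD(1)[OF tower_graph_restrict[OF assms(1-4)]]] im by simp
  have "pa (tower_graph {x\<in>D. g i x \<in> C} (g i))"
    using assms * by (intro tower_graph_restrict) auto
  from pa_measure[OF this] show "measure M (g i ` {x\<in>D. g i x \<in> C}) = measure M {x\<in>D. g i x \<in> C}"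
    by (simp add: im measure_def)
qed

text \<open>The levels over \<open>D\<close> are disjoint and each is reached by a
  measure-preserving map, so the measure of a set within the columns is the integral over the base
  of the number of visits.\<close>

lemma tower_visits:
  assumes T: "tower N B g" and D: "D \<in> sets M" "D \<subseteq> B" and C: "C \<in> sets M"
  shows "measure M (C \<inter> (\<Union>i<N. g i ` D)) = (\<integral>x. indicator D x * real (visits N g C x) \<partial>M)"
    "(\<Union>i<N. g i ` D) \<in> sets M"
    "integrable M (\<lambda>x. indicator D x * real (visits N g C x))"
proof -
  note vs = tower_visit_sets[OF T _ D C]
  show "(\<Union>i<N. g i ` D) \<in> sets M" using vs(2) by (intro sets.finite_UN) auto
  have "C \<inter> (\<Union>i<N. g i ` D) = (\<Union>i<N. g i ` {x\<in>D. g i x \<in> C})" by auto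
  moreover have "disjoint_family_on (\<lambda>i. g i ` {x\<in>D. g i x \<in> C}) {..<N}"
    using towerD(4)[OF T] D(2) unfolding disjoint_family_on_def by (auto dest: subsetD) blast+
  moreover have "g i ` {x\<in>D. g i x \<in> C} \<in> sets M" if "i < N" for i
    using tower_visit_sets(2)[OF T that vs(1)[OF that] _ C] D(2) by blast
  ultimately have "measure M (C \<inter> (\<Union>i<N. g i ` D)) = (\<Sum>i<N. measure M (g i ` {x\<in>D. g i x \<in> C}))"
    by (simp add: finite_measure_finite_Union image_subset_iff)
  also have "\<dots> = (\<Sum>i<N. measure M {x\<in>D. g i x \<in> C})" using vs(3) by auto
  also have "\<dots> = (\<Sum>i<N. \<integral>x. indicator {x\<in>D. g i x \<in> C} x \<partial>M)"
    using vs(1) by (intro sum.cong) (auto simp: Int_absorb2 sets.sets_into_space)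
  also have "\<dots> = (\<integral>x. (\<Sum>i<N. indicator {x\<in>D. g i x \<in> C} x) \<partial>M)"
    using vs(1) by (intro Bochner_Integration.integral_sum[symmetric]) (auto simp: emeasure_eq_measure)
  also have eq: "(\<lambda>x. \<Sum>i<N. indicator {x\<in>D. g i x \<in> C} x) = (\<lambda>x. indicator D x * real (visits N g C x))"
    by (rule ext) (auto simp: visits_def indicator_def of_bool_def intro!: sum.cong)
  finally show "measure M (C \<inter> (\<Union>i<N. g i ` D)) = (\<integral>x. indicator D x * real (visits N g C x) \<partial>M)" .
  have "integrable M (\<lambda>x. \<Sum>i<N. indicator {x\<in>D. g i x \<in> C} x :: real)"
    using vs(1) by (intro Bochner_Integration.integrable_sum) (auto simp: emeasure_eq_measure)
  then show "integrable M (\<lambda>x. indicator D x * real (visits N g C x))" unfolding eq .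
qed

lemma tower_visits_le:
  assumes T: "tower N B g" and D: "D \<in> sets M" "D \<subseteq> B" and C: "C \<in> sets M"
  shows "(\<And>x. x \<in> D \<Longrightarrow> real (visits N g C x) \<le> b) \<Longrightarrow> measure M (C \<inter> (\<Union>i<N. g i ` D)) \<le> b * measure M D"
    "(\<And>x. x \<in> D \<Longrightarrow> a \<le> real (visits N g C x)) \<Longrightarrow> a * measure M D \<le> measure M (C \<inter> (\<Union>i<N. g i ` D))"
proof -
  have i: "integrable M (\<lambda>x. indicator D x * c :: real)" for c
    using D by (intro integrable_mult_left) (auto simp: emeasure_eq_measure)
  have I: "(\<integral>x. indicator D x * c \<partial>M) = c * measure M D" for c :: real
    using D sets.sets_into_space[OF D(1)] by (simp add: Int_absorb2)
  show "measure M (C \<inter> (\<Union>i<N. g i ` D)) \<le> b * measure M D" if "\<And>x. x \<in> D \<Longrightarrow> real (visits N g C x) \<le> b"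
    unfolding tower_visits(1)[OF T D C] I[symmetric]
    using that by (intro integral_mono tower_visits(3)[OF T D C] i) (auto simp: indicator_def)
  show "a * measure M D \<le> measure M (C \<inter> (\<Union>i<N. g i ` D))" if "\<And>x. x \<in> D \<Longrightarrow> a \<le> real (visits N g C x)"
    unfolding tower_visits(1)[OF T D C] I[symmetric]
    using that by (intro integral_mono tower_visits(3)[OF T D C] i) (auto simp: indicator_def)
qed

lemma tower_full:
  assumes T: "tower N B g"
  shows "measure M (\<Union>i<N. g i ` B) = 1"
proof -
  have B: "B \<in> sets M" "B \<subseteq> B" using towerD(2)[OF T] by auto
  have g: "g i x \<in> space M" if "i < N" "x \<in> B" for i x
    using rel_space[OF towerD(3)[OF T that(1)], of x "g i x"] that(2) by (auto simp: tower_graph_def)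
  have v: "visits N g (space M) x = N" if "x \<in> B" for x
    using g that by (simp add: visits_def)
  have eq: "space M \<inter> (\<Union>i<N. g i ` B) = (\<Union>i<N. g i ` B)" using g by auto
  have "real N * measure M B \<le> measure M (\<Union>i<N. g i ` B)"
    using tower_visits_le(2)[OF T B sets.top, of "real N"] v eq by simp
  then show ?thesis using towerD(6)[OF T] prob_le_1[of "\<Union>i<N. g i ` B"]
    by (metis mult.commute order_antisym)
qed

end

lemma sum_div_mod:
  fixes f :: "nat \<Rightarrow> nat \<Rightarrow> 'b::comm_monoid_add"
  assumes "N > 0"
  shows "(\<Sum>j<N * L. f (j mod N) (j div N)) = (\<Sum>l<L. \<Sum>i<N. f i l)"
proof -
  have "(\<Sum>j<N * L. f (j mod N) (j div N)) = (\<Sum>l<L. sum (\<lambda>j. f (j mod N) (j div N)) {l * N..<l * N + N})"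
    by (simp add: sum.nat_group mult.commute)
  also have "\<dots> = (\<Sum>l<L. \<Sum>i<N. f i l)"
  proof (rule sum.cong[OF refl])
    fix l :: nat
    have "sum (\<lambda>j. f (j mod N) (j div N)) {l * N..<l * N + N} = (\<Sum>i\<in>{0..<N}. f ((i + l * N) mod N) ((i + l * N) div N))"
      using sum.shift_bounds_nat_ivl[of "\<lambda>j. f (j mod N) (j div N)" 0 "l * N" N] by (simp add: add.commute)
    also have "\<dots> = (\<Sum>i<N. f i l)"
      using assms by (intro sum.cong) auto
    finally show "sum (\<lambda>j. f (j mod N) (j div N)) {l * N..<l * N + N} = (\<Sum>i<N. f i l)" .
  qed
  finally show ?thesis .
qed

context ergodic_crel
begin

text \<open>The base is cut into \<open>L\<close> pieces of equal measure along the number of visits to \<open>C\<close>, and the pieces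
  are stacked. Between consecutive pieces the number of visits is monotone, so that the total
  along two columns differs by at most the height of the original tower.\<close>

lemma tower_refine:
  assumes T: "tower N B g" and C: "C \<in> sets M" and L: "L > 0"
  shows "\<exists>B' h. B' \<subseteq> B \<and> (\<forall>l<L. \<forall>x\<in>B'. h l x \<in> B) \<and> (\<forall>x\<in>B'. h 0 x = x) \<and>
    tower (N * L) B' (\<lambda>j x. g (j mod N) (h (j div N) x)) \<and>
    (\<forall>x\<in>B'. \<bar>real (visits (N * L) (\<lambda>j x. g (j mod N) (h (j div N) x)) C x) - real (N * L) * measure M C\<bar> \<le> real N)"
proof -
  have B [measurable]: "B \<in> sets M" and N: "N > 0" and mB: "measure M B * N = 1"
    using towerD[OF T] by auto
  then have mB0: "measure M B > 0" by (simp add: zero_less_measure_iff) auto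
  define n where "n x = (\<Sum>i<N. if x \<in> {x\<in>B. g i x \<in> C} then 1 else 0 :: real)" for x
  have n_visits: "n x = real (visits N g C x)" if "x \<in> B" for x
    using that by (auto simp: n_def visits_def of_bool_def intro!: sum.cong)
  have n_measurable [measurable]: "n \<in> borel_measurable M"
  proof -
    have [measurable]: "{x\<in>B. g i x \<in> C} \<in> sets M" if "i < N" for i
      using tower_visit_sets(1)[OF T that B _ C] by simp
    show ?thesis unfolding n_def by (intro borel_measurable_sum measurable_If_set sets.Int sets.top) auto
  qed
  \<comment> \<open>On the base \<open>n\<close> is integer-valued and \<open>u\<close> lies in
    \<open>[0, 1)\<close>. So \<open>v\<close> is injective there, as \<open>cut_level\<close>
    requires, and sorting by \<open>v\<close> sorts by the number of visits.\<close>
  define v where "v x = n x + u x" for x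
  have v_measurable [measurable]: "v \<in> borel_measurable M" unfolding v_def by measurable
  have n_mono: "n x \<le> n y" if "x \<in> B" "y \<in> B" "v x < v y" for x y
  proof -
    have "real (visits N g C x) < real (visits N g C y) + 1"
      using that u_bounds(1)[of x] u_bounds(2)[of y] by (simp add: v_def n_visits)
    then show ?thesis using that by (simp add: n_visits)
  qed
  have "inj_on v B"
  proof (rule inj_onI)
    fix x y assume xy: "x \<in> B" "y \<in> B" "v x = v y"
    have "n x = n y"
    proof -
      have "\<bar>n x - n y\<bar> < 1" using xy u_bounds[of x] u_bounds[of y] by (auto simp: v_def)
      then show ?thesis using xy by (simp add: n_visits)
    qed
    then have "u x = u y" using xy by (simp add: v_def)
    then show "x = y" using u_inj xy sets.sets_into_space[OF B] by (auto dest: inj_onD)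
  qed
  moreover have "0 \<le> n x" "n x \<le> real N" for x
    using sum_mono[of "{..<N}" "\<lambda>i. if x \<in> {x\<in>B. g i x \<in> C} then 1 else 0 :: real" "\<lambda>_. 1"]
    by (simp_all add: n_def sum_nonneg)
  then have "0 \<le> v x" "v x \<le> real N + 1" for x
    using u_bounds[of x] by (auto simp: v_def intro: add_mono less_imp_le)
  moreover have "0 \<le> real l * (measure M B / L)" "real l * (measure M B / L) \<le> measure M B" if "l \<le> L" for l
    using that L by (auto simp: field_simps intro: mult_right_mono)
  ultimately have "\<exists>t. measure M {x\<in>B. v x \<le> t} = real l * (measure M B / L)" if "l \<le> L" for l
    using that by (intro cut_level[OF B v_measurable, of 0 "real N + 1"]) auto
  then obtain t where t: "\<And>l. l \<le> L \<Longrightarrow> measure M {x\<in>B. v x \<le> t l} = real l * (measure M B / L)" by metis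
  have t_mono: "t l < t m" if "l < m" "m \<le> L" for l m
  proof (rule ccontr)
    assume "\<not> t l < t m"
    then have "measure M {x\<in>B. v x \<le> t m} \<le> measure M {x\<in>B. v x \<le> t l}"
      by (intro finite_measure_mono) auto
    then show False using t[of l] t[of m] that mB0 L by (simp add: field_simps)
  qed
  define b where "b l = {x\<in>B. t l < v x \<and> v x \<le> t (Suc l)}" for l
  have b_sets [measurable]: "b l \<in> sets M" for l unfolding b_def by measurable
  have b_measure: "measure M (b l) = measure M B / L" if "l < L" for l
  proof -
    have "b l = {x\<in>B. v x \<le> t (Suc l)} - {x\<in>B. v x \<le> t l}" by (auto simp: b_def)
    moreover have "{x\<in>B. v x \<le> t l} \<subseteq> {x\<in>B. v x \<le> t (Suc l)}" using t_mono[of l "Suc l"] that by force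
    ultimately have "measure M (b l) = measure M {x\<in>B. v x \<le> t (Suc l)} - measure M {x\<in>B. v x \<le> t l}"
      by (simp add: finite_measure_Diff)
    then show ?thesis using t that by (simp add: field_simps)
  qed
  have b_less: "v x < v y" if "x \<in> b l" "y \<in> b m" "l < m" "m < L" for x y l m
  proof -
    have "t (Suc l) \<le> t m" using t_mono[of "Suc l" m] that by (cases "Suc l = m") auto
    then show ?thesis using that by (auto simp: b_def)
  qed
  \<comment> \<open>The pieces are matched with the lowest one. For \<open>l = 0\<close> the
    matching is the identity, so that level 0 of the new tower is its base.\<close>
  have "\<exists>P. pa P \<and> Domain P \<subseteq> b 0 \<and> Range P \<subseteq> b l \<and> measure M (b 0 - Domain P) = 0 \<and> (l = 0 \<longrightarrow> P \<subseteq> Id)"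
    if "l < L" for l
  proof (cases "l = 0")
    case True
    then show ?thesis
      using rel_Id_on[OF b_sets[of 0]]
      by (intro exI[of _ "Id_on (b 0)"]) (auto simp: pa_def single_valued_def)
  next
    case False
    then show ?thesis
      using equidecomposable[OF b_sets[of 0] b_sets[of l]] b_measure[of 0] b_measure[of l] that L by auto
  qed
  then obtain P where P: "\<And>l. l < L \<Longrightarrow> pa (P l)" "\<And>l. l < L \<Longrightarrow> Domain (P l) \<subseteq> b 0"
    "\<And>l. l < L \<Longrightarrow> Range (P l) \<subseteq> b l" "\<And>l. l < L \<Longrightarrow> measure M (b 0 - Domain (P l)) = 0" "P 0 \<subseteq> Id"
    using L by metis
  have "\<exists>h. \<forall>x y. (x, y) \<in> P l \<longleftrightarrow> x \<in> Domain (P l) \<and> y = h x" if "l < L" for l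
    using pa_function[OF P(1)[OF that]] by metis
  then obtain h where h: "\<And>l x y. l < L \<Longrightarrow> (x, y) \<in> P l \<longleftrightarrow> x \<in> Domain (P l) \<and> y = h l x" by metis
  define B' where "B' = (\<Inter>l\<in>{..<L}. Domain (P l))"
  have DP: "Domain (P l) \<in> sets M" if "l < L" for l using Domain_sets[OF paD(1)[OF P(1)[OF that]]] .
  have B'_sets: "B' \<in> sets M" unfolding B'_def using DP L by (intro sets.finite_INT) auto
  have B'b: "B' \<subseteq> b 0" using P(2)[OF L] L by (auto simp: B'_def)
  have B'_measure: "measure M B' = measure M B / L"
  proof -
    have "measure M (b 0 - B') \<le> (\<Sum>l<L. measure M (b 0 - Domain (P l)))"
    proof -
      have eq: "b 0 - B' = (\<Union>l<L. b 0 - Domain (P l))" by (auto simp: B'_def)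
      show ?thesis unfolding eq using DP by (intro finite_measure_subadditive_finite) auto
    qed
    also have "\<dots> = 0" using P(4) by simp
    finally have "measure M (b 0 - B') = 0" using measure_nonneg[of M "b 0 - B'"] by linarith
    then show ?thesis using finite_measure_Diff[OF b_sets B'_sets B'b] b_measure[OF L] by simp
  qed
  have hP: "(x, h l x) \<in> P l" if "l < L" "x \<in> B'" for l x using h[OF that(1)] that by (auto simp: B'_def)
  have hb: "h l x \<in> b l" if "l < L" "x \<in> B'" for l x using hP[OF that] P(3)[OF that(1)] by blast
  have hB: "h l x \<in> B" if "l < L" "x \<in> B'" for l x using hb[OF that] by (auto simp: b_def)
  have h0: "h 0 x = x" if "x \<in> B'" for x using hP[OF L that] P(5) by auto
  \<comment> \<open>For \<open>j = l * N + i\<close> this is level \<open>i\<close> of the old tower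
    over the \<open>l\<close>-th piece.\<close>
  define g' where "g' j x = g (j mod N) (h (j div N) x)" for j x
  have jL: "j div N < L" "j mod N < N" if "j < N * L" for j
    using that N by (auto simp: less_mult_imp_div_less mult.commute)
  have "tower (N * L) B' g'"
    unfolding tower_def
  proof (intro conjI allI impI ballI)
    show "N * L > 0" using N L by simp
    show "B' \<in> sets M" by (rule B'_sets)
    show "g' 0 x = x" if "x \<in> B'" for x using that towerD(5)[OF T] hB[OF L] h0 by (simp add: g'_def)
    show "measure M B' * real (N * L) = 1" using mB L by (simp add: B'_measure)
  next
    fix j assume j: "j < N * L"
    note j' = jL[OF j]
    have "tower_graph B' (g' j) = (P (j div N) \<inter> B' \<times> UNIV) O tower_graph B (g (j mod N))"
      using hB[OF j'(1)] h[OF j'(1)] hP[OF j'(1)] by (auto simp: tower_graph_def g'_def)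
    then show "rel (tower_graph B' (g' j))"
      using rel_comp[OF rel_Int_fst[OF paD(1)[OF P(1)[OF j'(1)]] B'_sets] towerD(3)[OF T j'(2)]] by simp
  next
    fix j k x y assume *: "j < N * L" "k < N * L" "x \<in> B'" "y \<in> B'" "g' j x = g' k y"
    then have eq: "j mod N = k mod N" "h (j div N) x = h (k div N) y"
      using towerD(4)[OF T jL(2)[OF *(1)] jL(2)[OF *(2)] hB[OF jL(1)[OF *(1)] *(3)] hB[OF jL(1)[OF *(2)] *(4)]]
      by (auto simp: g'_def)
    have div: "j div N = k div N"
    proof (rule ccontr)
      assume "j div N \<noteq> k div N"
      then show False
        using b_less[OF hb hb, OF jL(1)[OF *(1)] *(3) jL(1)[OF *(2)] *(4)]
          b_less[OF hb hb, OF jL(1)[OF *(2)] *(4) jL(1)[OF *(1)] *(3)] jL(1)[OF *(1)] jL(1)[OF *(2)] eq(2)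
        by (cases "j div N < k div N") auto
    qed
    show "j = k" using eq(1) div by (metis div_mult_mod_eq)
    show "x = y"
      using paD(3)[OF P(1)[OF jL(1)[OF *(1)]]] hP[OF jL(1)[OF *(1)] *(3)] hP[OF jL(1)[OF *(1)] *(4)] eq(2) div
      by (auto dest!: single_valuedD[of _ "h (j div N) x" x y])
  qed
  moreover have "\<bar>real (visits (N * L) g' C x) - real (N * L) * measure M C\<bar> \<le> real N" if x: "x \<in> B'" for x
  proof -
    have vis: "visits (N * L) g' C x = (\<Sum>l<L. visits N g C (h l x))" for x
      unfolding visits_def g'_def using sum_div_mod[OF N, of "\<lambda>i l. of_bool (g i (h l x) \<in> C)" L] .
    \<comment> \<open>Compare piece \<open>l\<close> of the column of \<open>y\<close> with piece
      \<open>l + 1\<close> of the column of \<open>z\<close>, which has at least as many visits.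
      Only the last piece of \<open>y\<close> lacks a partner, at a cost of at most
      \<open>N\<close>.\<close>
    have close: "visits (N * L) g' C y \<le> visits (N * L) g' C z + N" if y: "y \<in> B'" and z: "z \<in> B'" for y z
    proof -
      obtain K where K: "L = Suc K" using L by (cases L) auto
      have "visits N g C (h l y) \<le> visits N g C (h (Suc l) z)" if "l < K" for l
      proof -
        have "n (h l y) \<le> n (h (Suc l) z)"
          using that K y z by (intro n_mono hB b_less[OF hb hb]) auto
        then show ?thesis using that K y z hB by (simp add: n_visits)
      qed
      then have "(\<Sum>l<K. visits N g C (h l y)) \<le> (\<Sum>l<K. visits N g C (h (Suc l) z))"
        by (intro sum_mono) auto
      moreover have "visits N g C (h K y) \<le> N"
        unfolding visits_def by (rule order_trans[OF sum_mono[of _ _ "\<lambda>_. 1"]]) auto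
      ultimately show ?thesis
        unfolding vis unfolding K sum.lessThan_Suc[of "\<lambda>l. visits N g C (h l y)"] sum.lessThan_Suc_shift[of "\<lambda>l. visits N g C (h l z)"]
        by simp
    qed
    note T' = \<open>tower (N * L) B' g'\<close>
    have CX: "measure M (C \<inter> (\<Union>i<N * L. g' i ` B')) = measure M C"
    proof -
      have "AE y in M. y \<in> (\<Union>i<N * L. g' i ` B')"
        using tower_full[OF T'] by (subst (asm) prob_eq_1) (use tower_visits(2)[OF T' B'_sets _ C] in auto)
      then show ?thesis by (intro finite_measure_eq_AE) (use C tower_visits(2)[OF T' B'_sets _ C] in auto)
    qed
    have m': "measure M B' * real (N * L) = 1" using towerD(6)[OF T'] .
    \<comment> \<open>The average number of visits over all columns is determined by the measure of
      \<open>C\<close>, and no column differs by more than \<open>N\<close> from that of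
      \<open>x\<close>; so \<open>x\<close> is within \<open>N\<close> of the average.\<close>
    have "measure M C \<le> (real (visits (N * L) g' C x) + real N) * measure M B'"
      using tower_visits_le(1)[OF T' B'_sets _ C, of "real (visits (N * L) g' C x) + real N"] close[OF _ x] CX by force
    moreover have "(real (visits (N * L) g' C x) - real N) * measure M B' \<le> measure M C"
      using tower_visits_le(2)[OF T' B'_sets _ C, of "real (visits (N * L) g' C x) - real N"] close[OF x] CX by force
    ultimately have "measure M C * real (N * L) \<le> (real (visits (N * L) g' C x) + real N) * (measure M B' * real (N * L))"
      "(real (visits (N * L) g' C x) - real N) * (measure M B' * real (N * L)) \<le> measure M C * real (N * L)"
      using mult_right_mono[of _ _ "real (N * L)"] by (simp_all only: mult.assoc[symmetric] of_nat_0_le_iff)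
    then show ?thesis unfolding m' by (simp add: mult.commute abs_le_iff)
  qed
  ultimately show ?thesis
    using hB h0 B'b unfolding g'_def by (intro exI[of _ B'] exI[of _ h]) (auto simp: b_def)
qed

end

section \<open>An ergodic subrelation generated by one partial automorphism\<close>

text \<open>At a vertex of greatest height in a cycle both neighbours are predecessors, hence equal.
  This forces length 1 or 2; length 2 is excluded in \<open>simple_cycle\<close>, and a loop
  contradicts the height.\<close>

lemma forest_if_height:
  fixes lam :: "'v \<Rightarrow> nat"
  assumes inj: "single_valued (P\<inverse>)" and lam: "\<And>y z. (y, z) \<in> P \<Longrightarrow> lam z = Suc (lam y)"
  shows "forest P"
  unfolding forest_def
proof
  assume "\<exists>vs. simple_cycle P vs"
  then obtain vs where vs: "simple_cycle P vs" by blast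
  define n where "n = length vs"
  have n: "n > 0" "n \<noteq> 2" and dist: "distinct vs"
    and edge: "\<And>i. i < n \<Longrightarrow> (vs ! i, vs ! (Suc i mod n)) \<in> P \<union> P\<inverse>"
    using vs by (auto simp: simple_cycle_def n_def)
  have "finite ((\<lambda>i. lam (vs ! i)) ` {..<n})" "(\<lambda>i. lam (vs ! i)) ` {..<n} \<noteq> {}" using n by auto
  then obtain i where i: "i < n" "\<And>j. j < n \<Longrightarrow> lam (vs ! j) \<le> lam (vs ! i)"
    using Max_in[of "(\<lambda>i. lam (vs ! i)) ` {..<n}"] Max_ge[of "(\<lambda>i. lam (vs ! i)) ` {..<n}"] by fastforce
  define p where "p = (i + n - 1) mod n"
  have p: "p < n" "Suc p mod n = i"
    using n i by (auto simp: p_def mod_Suc_eq)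
  have q: "Suc i mod n < n" using n by simp
  have "(vs ! (Suc i mod n), vs ! i) \<in> P"
    using edge[OF i(1)] lam[of "vs ! i" "vs ! (Suc i mod n)"] i(2)[OF q] by auto
  moreover have "(vs ! p, vs ! i) \<in> P"
    using edge[OF p(1)] lam[of "vs ! i" "vs ! p"] i(2)[OF p(1)] p(2) by auto
  ultimately have "vs ! (Suc i mod n) = vs ! p" using inj by (auto dest: single_valuedD)
  then have "Suc i mod n = p" using dist p q by (simp add: nth_eq_iff_index_eq n_def)
  then have "(i + 2) mod n = i mod n" using p(2) i(1) by (metis add_2_eq_Suc' mod_Suc_eq mod_less)
  then have "n dvd 2" by (metis add_diff_cancel_left' le_add1 mod_eq_dvd_iff_nat)
  then have "n = 1" using n by (metis dvd_imp_le le_antisym less_eq_Suc_le not_less_eq_eq numeral_2_eq_2 One_nat_def zero_less_numeral)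
  then have "(vs ! 0, vs ! 0) \<in> P" using edge[of 0] by auto
  then show False using lam by fastforce
qed

lemma nonpos_if_le_inverse:
  fixes a :: real
  assumes "\<And>m. a \<le> 1 / real (Suc m)"
  shows "a \<le> 0"
proof (rule ccontr)
  assume "\<not> a \<le> 0"
  then obtain m where "inverse (real (Suc m)) < a" using reals_Archimedean[of a] by auto
  with assms[of m] show False by (simp add: inverse_eq_divide)
qed

lemma single_height_exists:
  assumes "\<And>i j x y. i < N \<Longrightarrow> j < N \<Longrightarrow> x \<in> B \<Longrightarrow> y \<in> B \<Longrightarrow> g i x = g j y \<Longrightarrow> i = j"
  shows "\<exists>lam :: _ \<Rightarrow> nat. \<forall>i<N. \<forall>x\<in>B. lam (g i x) = i"
  by (intro exI[of _ "\<lambda>y. THE i. i < N \<and> (\<exists>x\<in>B. y = g i x)"] allI impI ballI the_equality)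
     (use assms in blast)+

context ergodic_crel
begin

text \<open>The relation is ergodic because, for each set \<open>C\<close> of the generator, the towers visit \<open>C\<close> with almost
  constant frequency; an invariant set is thus independent of all measurable sets, in particular
  of itself.\<close>

lemma ergodic_path_exists:
  fixes C :: "nat \<Rightarrow> 'a set"
  assumes gen: "Int_stable (range C)" "range C \<subseteq> Pow (space M)" "sets M = sigma_sets (space M) (range C)"
  shows "\<exists>T. pa T \<and> measure M (Domain T) = 1 \<and> forest T \<and> T \<inter> T\<inverse> = {} \<and> ergodic_rel M (generated_rel M T) \<and>
    (\<forall>n. \<exists>N\<ge>n. \<exists>B g. tower N B g \<and> (\<exists>Z\<in>sets M. measure M Z = 1 \<and>
       (\<forall>x\<in>B. \<forall>i<N. g i x \<in> Z \<longrightarrow> (\<forall>j. Suc j < N \<longrightarrow> (g j x, g (Suc j) x) \<in> T))))"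
proof -
  have C_sets: "C j \<in> sets M" for j unfolding gen(3) by auto
  \<comment> \<open>Stage \<open>k\<close> treats the set \<open>C j\<close> with
    \<open>j = fst (prod_decode k)\<close>, so every set is treated at arbitrarily late stages.
    Stacking \<open>k + 2\<close> pieces makes the relative error
    \<open>N k / N (Suc k) = 1 / (k + 2)\<close>.\<close>
  define step where "step k s s' \<longleftrightarrow> (case s of (N, B, g) \<Rightarrow> case s' of (N', B', g') \<Rightarrow>
      N' = N * (k + 2) \<and> B' \<subseteq> B \<and>
      (\<exists>h. (\<forall>l<k + 2. \<forall>x\<in>B'. h l x \<in> B) \<and> g' = (\<lambda>j x. g (j mod N) (h (j div N) x))) \<and>
      (\<forall>x\<in>B'. \<bar>real (visits N' g' (C (fst (prod_decode k))) x) - real N' * measure M (C (fst (prod_decode k)))\<bar> \<le> real N))"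
    for k and s s' :: "nat \<times> 'a set \<times> (nat \<Rightarrow> 'a \<Rightarrow> 'a)"
  have "\<exists>s. \<forall>k. (case s k of (N, B, g) \<Rightarrow> tower N B g) \<and> step k (s k) (s (Suc k))"
  proof (rule dependent_nat_choice)
    have "tower_graph (space M) (\<lambda>x. x) = Id_on (space M)" by (auto simp: tower_graph_def)
    then have "tower 1 (space M) (\<lambda>_ x. x)"
      using rel_Id_on[of "space M"] by (auto simp: tower_def prob_space)
    then show "\<exists>s. case s of (N, B, g) \<Rightarrow> tower N B g" by auto
    fix s :: "nat \<times> 'a set \<times> (nat \<Rightarrow> 'a \<Rightarrow> 'a)" and k :: nat
    assume s: "case s of (N, B, g) \<Rightarrow> tower N B g"
    obtain N B g where [simp]: "s = (N, B, g)" using prod_cases3 by blast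
    obtain B' h where "B' \<subseteq> B" "\<forall>l<k + 2. \<forall>x\<in>B'. h l x \<in> B"
      "tower (N * (k + 2)) B' (\<lambda>j x. g (j mod N) (h (j div N) x))"
      "\<forall>x\<in>B'. \<bar>real (visits (N * (k + 2)) (\<lambda>j x. g (j mod N) (h (j div N) x)) (C (fst (prod_decode k))) x) -
         real (N * (k + 2)) * measure M (C (fst (prod_decode k)))\<bar> \<le> real N"
      using tower_refine[OF _ C_sets[of "fst (prod_decode k)"], of N B g "k + 2"] s by auto
    then show "\<exists>s'. (case s' of (N, B, g) \<Rightarrow> tower N B g) \<and> step k s s'"
      by (intro exI[of _ "(N * (k + 2), B', \<lambda>j x. g (j mod N) (h (j div N) x))"]) (auto simp: step_def)
  qed
  then obtain s where s': "\<forall>k. (case s k of (N, B, g) \<Rightarrow> tower N B g) \<and> step k (s k) (s (Suc k))"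
    by (elim exE)
  have s: "case s k of (N, B, g) \<Rightarrow> tower N B g" "step k (s k) (s (Suc k))" for k
    using s' by simp_all
  define N where "N k = fst (s k)" for k
  define B where "B k = fst (snd (s k))" for k
  define g where "g k = snd (snd (s k))" for k
  have T: "tower (N k) (B k) (g k)" for k using s(1)[of k] by (auto simp: N_def B_def g_def split: prod.splits)
  have step: "step k (N k, B k, g k) (N (Suc k), B (Suc k), g (Suc k))" for k
    using s(2)[of k] by (simp add: N_def B_def g_def)
  have NS: "N (Suc k) = N k * (k + 2)" for k using step[of k] by (simp add: step_def)
  have "\<exists>h. (\<forall>l<k + 2. \<forall>x\<in>B (Suc k). h l x \<in> B k) \<and> g (Suc k) = (\<lambda>j x. g k (j mod N k) (h (j div N k) x))" for k
    using step[of k] by (simp add: step_def)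
  then obtain h where hB: "\<And>k l x. l < k + 2 \<Longrightarrow> x \<in> B (Suc k) \<Longrightarrow> h k l x \<in> B k"
    and gS: "\<And>k j x. g (Suc k) j x = g k (j mod N k) (h k (j div N k) x)" by metis
  have vis: "\<bar>real (visits (N (Suc k)) (g (Suc k)) (C (fst (prod_decode k))) x) -
      real (N (Suc k)) * measure M (C (fst (prod_decode k)))\<bar> \<le> real (N k)" if "x \<in> B (Suc k)" for k x
    using step[of k] that unfolding step_def prod.case by blast
  have N0: "N k > 0" for k using towerD(1)[OF T] .
  have N_ge: "N k \<ge> k" for k
  proof (induction k)
    case (Suc k)
    then show ?case using N0[of k] unfolding NS by (cases "N k") auto
  qed simp
  have jl: "j mod N k < N k" "j div N k < k + 2" if "j < N (Suc k)" for j k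
    using that N0[of k] unfolding NS by (auto simp: less_mult_imp_div_less mult.commute)
  have inj: "i = j \<and> x = y" if "i < N k" "j < N k" "x \<in> B k" "y \<in> B k" "g k i x = g k j y" for i j x y k
    using towerD(4)[OF T that] .

  \<comment> \<open>The limit of the towers\<close>
  define X where "X k = (\<Union>i<N k. g k i ` B k)" for k
  define S where "S k = {(g k i x, g k j x) |i j x. i < N k \<and> j < N k \<and> x \<in> B k}" for k
  define G where "G k = {(g k i x, g k (Suc i) x) |i x. Suc i < N k \<and> x \<in> B k}" for k
  define Z where "Z = (\<Inter>k. X k)"
  have SX: "y \<in> X k" "z \<in> X k" if "(y, z) \<in> S k" for y z k
    using that by (auto simp: S_def X_def)
  have GS: "G k \<subseteq> S k" for k by (auto simp: G_def S_def) (metis Suc_lessD)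
  \<comment> \<open>A point of a tower that survives in the next one takes its whole old column
    along, as one of the \<open>k + 2\<close> consecutive blocks of a new column. The null sets lost
    in the matching are the reason for the condition \<open>y \<in> X (Suc k)\<close>.\<close>
  have key: "\<exists>l<k + 2. \<exists>x'\<in>B (Suc k). x = h k l x' \<and> y = g (Suc k) (l * N k + i) x'"
    if y: "y = g k i x" "i < N k" "x \<in> B k" "y \<in> X (Suc k)" for y i x k
  proof -
    obtain j x' where j: "j < N (Suc k)" "x' \<in> B (Suc k)" "y = g (Suc k) j x'" using y(4) by (auto simp: X_def)
    then have "g k i x = g k (j mod N k) (h k (j div N k) x')" using gS y by simp
    then have "i = j mod N k \<and> x = h k (j div N k) x'"
      using inj y(2,3) jl[OF j(1)] hB[OF jl(2)[OF j(1)] j(2)] by blast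
    then show ?thesis using j jl[OF j(1)] by (intro exI[of _ "j div N k"]) auto
  qed
  have lift: "g k i (h k l x') = g (Suc k) (l * N k + i) x'" "l * N k + i < N (Suc k)"
    if "i < N k" "l < k + 2" for i l x' k
  proof -
    show "g k i (h k l x') = g (Suc k) (l * N k + i) x'" using that N0[of k] by (simp add: gS)
    have "l * N k + i < Suc l * N k" using that by simp
    also have "\<dots> \<le> (k + 2) * N k" using that by (intro mult_le_mono1) simp
    finally show "l * N k + i < N (Suc k)" by (simp add: NS mult.commute)
  qed
  have S_Suc: "(y, z) \<in> S (Suc k)" if yz: "(y, z) \<in> S k" "y \<in> X (Suc k)" for y z k
  proof -
    obtain i j x where *: "y = g k i x" "z = g k j x" "i < N k" "j < N k" "x \<in> B k"
      using yz by (auto simp: S_def)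
    obtain l x' where "l < k + 2" "x' \<in> B (Suc k)" "x = h k l x'" "y = g (Suc k) (l * N k + i) x'"
      using key[OF *(1,3,5) yz(2)] by blast
    then show ?thesis using * lift unfolding S_def by blast
  qed
  have G_Suc: "(y, z) \<in> G (Suc k)" if yz: "(y, z) \<in> G k" "y \<in> X (Suc k)" for y z k
  proof -
    obtain i x where *: "y = g k i x" "z = g k (Suc i) x" "Suc i < N k" "x \<in> B k"
      using yz by (auto simp: G_def)
    obtain l x' where "l < k + 2" "x' \<in> B (Suc k)" "x = h k l x'" "y = g (Suc k) (l * N k + i) x'"
      using key[OF *(1) _ *(4) yz(2)] *(3) by (meson Suc_lessD)
    moreover have "z = g (Suc k) (Suc (l * N k + i)) x'" "Suc (l * N k + i) < N (Suc k)"
      using lift(1)[OF *(3) \<open>l < k + 2\<close>, of x'] lift(2)[OF *(3) \<open>l < k + 2\<close>] *(2) \<open>x = h k l x'\<close> by simp_all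
    ultimately show ?thesis unfolding G_def by blast
  qed
  have X_Suc: "X (Suc k) \<subseteq> X k" for k
  proof
    fix y assume "y \<in> X (Suc k)"
    then obtain j x where "j < N (Suc k)" "x \<in> B (Suc k)" "y = g k (j mod N k) (h k (j div N k) x)"
      by (auto simp: X_def gS)
    then show "y \<in> X k" using jl(1)[of j k] hB[OF jl(2)[of j k], of x] unfolding X_def by auto
  qed
  have S_le: "(y, z) \<in> S m" if "(y, z) \<in> S k" "y \<in> Z" "k \<le> m" for y z k m
    using that(3) by (induction m rule: dec_induct) (use that S_Suc in \<open>auto simp: Z_def\<close>)
  have X_le: "X m \<subseteq> X k" if "k \<le> m" for k m
    using that by (induction m rule: dec_induct) (use X_Suc in auto)
  \<comment> \<open>\<open>Z\<close> is a union of entire columns of every tower, so restricting to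
    \<open>Z\<close> breaks no column.\<close>
  have Z_inv: "z \<in> Z" if "(y, z) \<in> S k" "y \<in> Z" for y z k
    unfolding Z_def
  proof
    fix m
    have "(y, z) \<in> S (max k m)" using S_le[OF that] by simp
    then show "z \<in> X m" using SX X_le[of m "max k m"] by auto
  qed
  have X_sets: "X k \<in> sets M" for k
    unfolding X_def using tower_visits(2)[OF T towerD(2)[OF T], of k] by blast
  have Z_sets [measurable]: "Z \<in> sets M" unfolding Z_def using X_sets by auto
  have X1: "measure M (X k) = 1" for k unfolding X_def by (rule tower_full[OF T])
  have Z1: "measure M Z = 1"
  proof -
    have "AE x in M. x \<in> X k" for k using X1[of k] X_sets[of k] by (simp add: prob_eq_1)
    then have "AE x in M. x \<in> Z" unfolding Z_def by (simp add: AE_all_countable)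
    then show ?thesis using Z_sets by (simp add: prob_eq_1)
  qed

  define Tr where "Tr = (\<Union>k. G k \<inter> Z \<times> Z)"
  have G_eq: "G k = (\<Union>i\<in>{i. Suc i < N k}. (tower_graph (B k) (g k i))\<inverse> O tower_graph (B k) (g k (Suc i)))" for k
  proof (intro equalityI subsetI)
    fix p assume "p \<in> G k"
    then show "p \<in> (\<Union>i\<in>{i. Suc i < N k}. (tower_graph (B k) (g k i))\<inverse> O tower_graph (B k) (g k (Suc i)))"
      by (auto simp: G_def tower_graph_def)
  next
    fix p assume "p \<in> (\<Union>i\<in>{i. Suc i < N k}. (tower_graph (B k) (g k i))\<inverse> O tower_graph (B k) (g k (Suc i)))"
    then show "p \<in> G k" unfolding G_def tower_graph_def by blast
  qed
  have G_pa: "pa (G k)" for k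
    unfolding pa_def
  proof (intro conjI)
    have "rel ((tower_graph (B k) (g k i))\<inverse> O tower_graph (B k) (g k (Suc i)))" if "Suc i < N k" for i
      using that by (intro rel_comp rel_converse towerD(3)[OF T]) auto
    then show "rel (G k)"
      unfolding G_eq rel_def by (auto intro!: sets.countable_UN'')
    show "single_valued (G k)"
      by (auto simp: G_def single_valued_def dest!: inj[rotated 4])
    show "single_valued ((G k)\<inverse>)"
      by (auto simp: G_def single_valued_def dest!: inj[rotated 4])
  qed
  have G_inc: "incseq (\<lambda>k. G k \<inter> Z \<times> Z)"
    by (rule incseq_SucI) (use G_Suc in \<open>auto simp: Z_def\<close>)
  have Tr_pa: "pa Tr"
    unfolding Tr_def
    by (rule pa_incseq[OF _ G_inc]) (use G_pa paD(1) in \<open>auto intro!: pa_subset[OF G_pa] rel_Int_times\<close>)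
  have Tr_edge: "(g k j x, g k (Suc j) x) \<in> Tr" if "x \<in> B k" "i < N k" "g k i x \<in> Z" "Suc j < N k" for k i j x
  proof -
    have "(g k i x, g k j x) \<in> S k" "(g k i x, g k (Suc j) x) \<in> S k"
      using that unfolding S_def by (blast dest: Suc_lessD)+
    then have "g k j x \<in> Z" "g k (Suc j) x \<in> Z" using Z_inv that(3) by blast+
    moreover have "(g k j x, g k (Suc j) x) \<in> G k" using that unfolding G_def by blast
    ultimately show ?thesis unfolding Tr_def by blast
  qed
  have Dom1: "measure M (Domain Tr) = 1"
  proof -
    have DT: "Domain Tr \<in> sets M" using Domain_sets paD(1)[OF Tr_pa] .
    \<comment> \<open>Within \<open>Z\<close>, only the top level of a tower can fail to have a
      successor, and its measure is the reciprocal of the height.\<close>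
    have "1 - 1 / real (Suc k) \<le> measure M (Domain Tr)" for k
    proof -
      let ?k = "Suc k" let ?L = "g (Suc k) (N (Suc k) - 1) ` B (Suc k)"
      have lt: "N ?k - 1 < N ?k" using N0[of ?k] by simp
      have "{x\<in>B ?k. g ?k (N ?k - 1) x \<in> space M} = B ?k"
        using rel_space[OF towerD(3)[OF T lt]] by (auto simp: tower_graph_def)
      then have mL: "measure M ?L = measure M (B ?k)" "?L \<in> sets M"
        using tower_visit_sets(2,3)[OF T lt towerD(2)[OF T] order_refl sets.top] by simp_all
      have "Z - ?L \<subseteq> Domain Tr"
      proof
        fix y assume y: "y \<in> Z - ?L"
        then obtain i x where i: "i < N ?k" "x \<in> B ?k" "y = g ?k i x" unfolding Z_def X_def by blast
        then have "i \<noteq> N ?k - 1" using y by auto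
        then have "Suc i < N ?k" using i by simp
        then show "y \<in> Domain Tr" using Tr_edge[OF i(2,1)] i y by blast
      qed
      then have "measure M (Z - ?L) \<le> measure M (Domain Tr)" using DT by (rule finite_measure_mono)
      moreover have "measure M Z \<le> measure M (Z - ?L) + measure M ?L"
        using mL(2) measure_Un_le[of "Z - ?L" M ?L] finite_measure_mono[of Z "(Z - ?L) \<union> ?L"] by fastforce
      moreover have "measure M (B ?k) \<le> 1 / real ?k"
      proof -
        have "measure M (B ?k) = 1 / real (N ?k)" using towerD(6)[OF T, of ?k] N0[of ?k] by (simp add: field_simps)
        also have "\<dots> \<le> 1 / real ?k" using N_ge[of ?k] by (intro divide_left_mono) auto
        finally show ?thesis .
      qed
      ultimately show ?thesis using Z1 mL(1) by linarith
    qed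
    then have "1 - measure M (Domain Tr) \<le> 1 / real (Suc k)" for k by (smt (verit))
    then have "1 - measure M (Domain Tr) \<le> 0" by (rule nonpos_if_le_inverse)
    then show ?thesis using prob_le_1[of "Domain Tr"] by linarith
  qed
  have forest: "forest Tr"
    unfolding forest_def
  proof
    assume "\<exists>vs. simple_cycle Tr vs"
    then obtain vs where vs: "simple_cycle Tr vs" by blast
    \<comment> \<open>A cycle has finitely many edges, so it lies in a single \<open>G k\<close>,
      where the level serves as a height.\<close>
    have "\<exists>k. \<forall>i<n. (vs ! i, vs ! (Suc i mod length vs)) \<in> G k \<union> (G k)\<inverse> \<and> vs ! i \<in> Z \<and> vs ! (Suc i mod length vs) \<in> Z"
      if "n \<le> length vs" for n
      using that
    proof (induction n)
      case (Suc n)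
      then obtain k where k: "\<forall>i<n. (vs ! i, vs ! (Suc i mod length vs)) \<in> G k \<union> (G k)\<inverse> \<and> vs ! i \<in> Z \<and> vs ! (Suc i mod length vs) \<in> Z"
        by auto
      have "(vs ! n, vs ! (Suc n mod length vs)) \<in> Tr \<union> Tr\<inverse>"
        using vs Suc.prems unfolding simple_cycle_def by auto
      then obtain l where l: "(vs ! n, vs ! (Suc n mod length vs)) \<in> G l \<union> (G l)\<inverse>" "vs ! n \<in> Z" "vs ! (Suc n mod length vs) \<in> Z"
        unfolding Tr_def by blast
      have mono: "G a \<inter> Z \<times> Z \<subseteq> G (max k l)" if "a \<le> max k l" for a
        using incseqD[OF G_inc that] by blast
      have "(vs ! i, vs ! (Suc i mod length vs)) \<in> G (max k l) \<union> (G (max k l))\<inverse>" "vs ! i \<in> Z" "vs ! (Suc i mod length vs) \<in> Z"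
        if "i < Suc n" for i
        using k l mono[of k] mono[of l] that unfolding less_Suc_eq by auto
      then show ?case by blast
    qed auto
    from this[OF order_refl] obtain k where "simple_cycle (G k) vs"
      using vs unfolding simple_cycle_def by blast
    moreover obtain lam where lam: "\<forall>i<N k. \<forall>x\<in>B k. lam (g k i x) = i"
      using single_height_exists[of "N k" "B k" "g k"] inj[of _ k] by blast
    have "forest (G k)"
      by (rule forest_if_height[OF paD(3)[OF G_pa], of _ lam]) (use lam in \<open>auto simp: G_def\<close>)
    ultimately show False by (auto simp: forest_def)
  qed
  have asym: "Tr \<inter> Tr\<inverse> = {}"
  proof (intro equals0I; clarsimp)
    fix y z assume yz: "(y, z) \<in> Tr" "(z, y) \<in> Tr"
    then obtain a b where "(y, z) \<in> G a \<inter> Z \<times> Z" "(z, y) \<in> G b \<inter> Z \<times> Z" unfolding Tr_def by blast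
    then have "(y, z) \<in> G (max a b)" "(z, y) \<in> G (max a b)"
      using incseqD[OF G_inc, of a "max a b"] incseqD[OF G_inc, of b "max a b"] by auto
    moreover define k where "k = max a b"
    ultimately obtain i x i' x' where "Suc i < N k" "x \<in> B k" "y = g k i x" "z = g k (Suc i) x"
      "Suc i' < N k" "x' \<in> B k" "z = g k i' x'" "y = g k (Suc i') x'"
      unfolding G_def by blast
    then show False
      using inj[of i k "Suc i'" x x'] inj[of "Suc i" k i' x x'] by simp
  qed

  \<comment> \<open>Ergodicity of the path relation\<close>
  have erg: "ergodic_rel M (generated_rel M Tr)"
    unfolding ergodic_rel_def
  proof (intro ballI impI)
    fix A assume A: "A \<in> sets M" "generated_rel M Tr `` A = A"
    define A0 where "A0 = A \<inter> Z"
    have A0_sets [measurable]: "A0 \<in> sets M" using A by (simp add: A0_def)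
    have conn: "(g k 0 x, g k j x) \<in> linked Tr" if "x \<in> B k" "i < N k" "g k i x \<in> Z" "j < N k" for k i j x
      using that(4)
    proof (induction j)
      case (Suc j)
      then have "(g k 0 x, g k j x) \<in> linked Tr" by simp
      also have "(g k j x, g k (Suc j) x) \<in> Tr \<union> Tr\<inverse>" using Tr_edge[OF that(1-3) Suc.prems] by blast
      finally show ?case .
    qed simp
    have A0_inv: "g k j x \<in> A0" if "x \<in> B k" "i < N k" "g k i x \<in> A0" "j < N k" for k i j x
    proof -
      have Zi: "g k i x \<in> Z" using that by (simp add: A0_def)
      have "(g k i x, g k j x) \<in> linked Tr"
        using linked_sym[OF conn[OF that(1,2) Zi that(2)]] conn[OF that(1,2) Zi that(4)] by (rule rtrancl_trans)
      moreover have "g k i x \<in> space M" "g k j x \<in> space M"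
        using that rel_space[OF towerD(3)[OF T]] by (auto simp: tower_graph_def)
      ultimately have "g k j x \<in> A" using A(2) that(3) by (auto simp: generated_rel_def A0_def)
      moreover have "g k j x \<in> Z"
        using that Zi Z_inv[of "g k i x" "g k j x" k] unfolding S_def by blast
      ultimately show ?thesis by (simp add: A0_def)
    qed
    have levels: "(\<Union>i<N k. g k i ` (A0 \<inter> B k)) = A0" for k
    proof (intro equalityI subsetI)
      fix y assume "y \<in> (\<Union>i<N k. g k i ` (A0 \<inter> B k))"
      then obtain i x where "i < N k" "x \<in> A0" "x \<in> B k" "y = g k i x" by blast
      then show "y \<in> A0" using A0_inv[of x k 0 i] N0[of k] towerD(5)[OF T, of x k] by simp
    next
      fix y assume y: "y \<in> A0"
      then have "y \<in> X k" by (auto simp: A0_def Z_def)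
      then obtain i x where i: "i < N k" "x \<in> B k" "y = g k i x" by (auto simp: X_def)
      then have "x \<in> A0" using A0_inv[of x k i 0] N0[of k] towerD(5)[OF T, of x k] y by simp
      then show "y \<in> (\<Union>i<N k. g k i ` (A0 \<inter> B k))" using i by blast
    qed
    have D: "A0 \<inter> B k \<in> sets M" "A0 \<inter> B k \<subseteq> B k" for k using towerD(2)[OF T] by auto
    have mA0: "measure M A0 = real (N k) * measure M (A0 \<inter> B k)" for k
    proof -
      have v: "visits (N k) (g k) (space M) x = N k" if "x \<in> B k" for x
        using that rel_space[OF towerD(3)[OF T]] by (auto simp: tower_graph_def visits_def)
      have "space M \<inter> A0 = A0" using sets.sets_into_space[OF A0_sets] by auto
      then show ?thesis
        using tower_visits_le[OF T D sets.top, of k "real (N k)"] tower_visits_le(2)[OF T D sets.top, of k "real (N k)"] v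
        unfolding levels by force
    qed
    \<comment> \<open>\<open>A0\<close> consists of full columns over
      \<open>A0 \<inter> B k\<close>. At the stages that treat \<open>C j\<close> all columns visit
      it with nearly the frequency \<open>measure M (C j)\<close>, which gives independence in the
      limit.\<close>
    have indep_gen: "measure M (C j \<inter> A0) = measure M (C j) * measure M A0" for j
    proof -
      have "\<bar>measure M (C j \<inter> A0) - measure M (C j) * measure M A0\<bar> \<le> 1 / real (Suc m)" for m
      proof -
        define k where "k = prod_encode (j, m)"
        have k: "fst (prod_decode k) = j" "m \<le> k" by (simp_all add: k_def le_prod_encode_2)
        let ?N = "real (N (Suc k))" and ?D = "measure M (A0 \<inter> B (Suc k))"
        have v: "real (visits (N (Suc k)) (g (Suc k)) (C j) x) \<le> ?N * measure M (C j) + real (N k)"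
          "?N * measure M (C j) - real (N k) \<le> real (visits (N (Suc k)) (g (Suc k)) (C j) x)"
          if "x \<in> A0 \<inter> B (Suc k)" for x
          using vis[of x k] that k(1) by (auto simp: abs_le_iff)
        have "measure M (C j \<inter> A0) \<le> (?N * measure M (C j) + real (N k)) * ?D"
          "(?N * measure M (C j) - real (N k)) * ?D \<le> measure M (C j \<inter> A0)"
          using tower_visits_le[OF T D C_sets[of j], of "Suc k"] v unfolding levels by blast+
        then have "\<bar>measure M (C j \<inter> A0) - measure M (C j) * measure M A0\<bar> \<le> real (N k) * ?D"
          unfolding mA0[of "Suc k"] by (auto simp: algebra_simps abs_le_iff)
        also have "\<dots> = measure M A0 / real (k + 2)"
          unfolding mA0[of "Suc k"] NS of_nat_mult by simp
        also have "\<dots> \<le> 1 / real (Suc m)"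
          using k(2) by (intro frac_le) auto
        finally show ?thesis .
      qed
      then have "\<bar>measure M (C j \<inter> A0) - measure M (C j) * measure M A0\<bar> \<le> 0"
        by (rule nonpos_if_le_inverse)
      then show ?thesis by simp
    qed
    have "measure M (Q \<inter> A0) = measure M Q * measure M A0" if "Q \<in> sigma_sets (space M) (range C)" for Q
      using gen(1,2) that
    proof (induction rule: sigma_sets_induct_disjoint)
      case (compl Q)
      then have Q: "Q \<in> sets M" by (simp add: gen(3))
      have "(space M - Q) \<inter> A0 = A0 - Q \<inter> A0" using sets.sets_into_space[OF A0_sets] by auto
      then have "measure M ((space M - Q) \<inter> A0) = measure M A0 - measure M (Q \<inter> A0)"
        using Q by (simp add: finite_measure_Diff)
      then show ?case using compl Q by (simp add: prob_compl algebra_simps)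
    next
      case (union Q)
      then have Q: "range Q \<subseteq> sets M" by (simp add: gen(3))
      have "(\<lambda>i. measure M (Q i)) sums measure M (\<Union>i. Q i)"
        using Q union(1) by (rule finite_measure_UNION)
      then have "(\<lambda>i. measure M (Q i) * measure M A0) sums (measure M (\<Union>i. Q i) * measure M A0)"
        by (rule sums_mult2)
      moreover have "(\<lambda>i. measure M (Q i \<inter> A0)) sums measure M (\<Union>i. Q i \<inter> A0)"
        using Q union(1) by (intro finite_measure_UNION) (auto simp: disjoint_family_on_def)
      moreover have "(\<Union>i. Q i \<inter> A0) = (\<Union>i. Q i) \<inter> A0" by auto
      ultimately show ?case using union(3) sums_unique2 by fastforce
    qed (auto simp: indep_gen)
    then have indep: "measure M (Q \<inter> A0) = measure M Q * measure M A0" if "Q \<in> sets M" for Q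
      using that gen(3) by simp
    have "measure M A0 = measure M A0 * measure M A0" using indep[OF A0_sets] by simp
    then have "measure M A0 = 0 \<or> measure M A0 = 1" by simp
    moreover have "measure M A0 = measure M A"
    proof (rule finite_measure_eq_AE)
      have "AE x in M. x \<in> Z" using Z1 by (simp add: prob_eq_1)
      then show "AE x in M. (x \<in> A0) = (x \<in> A)" by eventually_elim (simp add: A0_def)
    qed (use A in auto)
    ultimately show "emeasure M A = 0 \<or> emeasure M A = 1" by (auto simp: emeasure_eq_measure)
  qed
  have "\<exists>N'\<ge>n. \<exists>B g. tower N' B g \<and> (\<exists>Z\<in>sets M. measure M Z = 1 \<and>
       (\<forall>x\<in>B. \<forall>i<N'. g i x \<in> Z \<longrightarrow> (\<forall>j. Suc j < N' \<longrightarrow> (g j x, g (Suc j) x) \<in> Tr)))" for n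
    using N_ge[of n] T[of n] Z_sets Z1 Tr_edge[of _ n] by blast
  then show ?thesis using Tr_pa Dom1 forest asym erg by blast
qed

end

section \<open>Forests in hyperfinite relations\<close>

text \<open>Going round the cycle the long way joins the ends of the edge with index
  \<open>i0\<close>; this is how \<open>minimal_edges_forest\<close> bypasses the edge of largest
  label.\<close>

lemma cyclic_path:
  fixes v :: "nat \<Rightarrow> 'v"
  assumes n: "i0 < n" and edge: "\<And>j. j < n \<Longrightarrow> j \<noteq> i0 \<Longrightarrow> (v j, v (Suc j mod n)) \<in> Q\<^sup>*"
  shows "(v (Suc i0 mod n), v i0) \<in> Q\<^sup>*"
proof -
  have "(v (Suc i0 mod n), v ((Suc i0 + m) mod n)) \<in> Q\<^sup>*" if "m < n" for m
    using that
  proof (induction m)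
    case (Suc m)
    let ?j = "(Suc i0 + m) mod n"
    have "?j \<noteq> i0"
    proof
      assume "?j = i0"
      then have "(i0 + Suc m) mod n = i0 mod n" using n by simp
      then have "n dvd Suc m" by (metis add_diff_cancel_left' le_add1 mod_eq_dvd_iff_nat)
      then show False using Suc.prems by (auto dest: dvd_imp_le)
    qed
    then have "(v ?j, v (Suc ?j mod n)) \<in> Q\<^sup>*" using edge n by simp
    moreover have "Suc ?j mod n = (Suc i0 + Suc m) mod n" by (simp add: mod_Suc_eq)
    ultimately show ?case using Suc by (metis Suc_lessD rtrancl_trans)
  qed simp
  from this[of "n - 1"] show ?thesis using n by simp
qed

text \<open>A path without repetitions that avoids the edge would close up with it to a simple
  cycle. Asymmetry excludes the path of length 1, whose closure would be a cycle of length 2, which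
  \<open>simple_cycle\<close> does not count.\<close>

lemma forest_edge_separates:
  assumes P: "forest P" "P \<inter> P\<inverse> = {}" and e: "(a, b) \<in> P"
  shows "(a, b) \<notin> linked (P - {(a, b)})"
proof
  let ?Q = "(P - {(a, b)}) \<union> (P - {(a, b)})\<inverse>"
  assume "(a, b) \<in> ?Q\<^sup>*"
  then have "(\<lambda>x y. (x, y) \<in> ?Q)\<^sup>*\<^sup>* a b" by (simp add: rtrancl_def)
  then obtain xs0 where "rtrancl_path (\<lambda>x y. (x, y) \<in> ?Q) a xs0 b" unfolding rtranclp_eq_rtrancl_path by blast
  then obtain xs where xs: "rtrancl_path (\<lambda>x y. (x, y) \<in> ?Q) a xs b" "distinct (a # xs)"
    by (rule rtrancl_path_distinct)
  have step: "((a # xs) ! i, xs ! i) \<in> ?Q" if "i < length xs" for i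
    using rtrancl_path_nth[OF xs(1) that] .
  have ne: "xs \<noteq> []" using xs(1) e P(2) by (auto elim: rtrancl_path.cases)
  then have last: "last xs = b" using rtrancl_path_last[OF xs(1)] by simp
  have "length xs \<noteq> 1"
  proof
    assume "length xs = 1"
    then obtain c where "xs = [c]" by (auto simp: length_Suc_conv)
    then have "(a, b) \<in> ?Q" using step[of 0] last by simp
    then show False using e P(2) by auto
  qed
  moreover have "((a # xs) ! i, (a # xs) ! (Suc i mod length (a # xs))) \<in> P \<union> P\<inverse>" if "i < length (a # xs)" for i
  proof (cases "i = length xs")
    case True
    then have "(a # xs) ! i = b" using last ne by (simp add: last_conv_nth nth_Cons')
    then show ?thesis using True e by simp
  next
    case False
    then have "i < length xs" using that by simp
    then show ?thesis using step[of i] by auto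
  qed
  ultimately have "simple_cycle P (a # xs)"
    using xs(2) ne unfolding simple_cycle_def by (auto simp: length_Suc_conv)
  then show False using P(1) by (auto simp: forest_def)
qed

lemma forest_card_le:
  assumes V: "finite V" and P: "P \<subseteq> V \<times> V" "forest P" "P \<inter> P\<inverse> = {}"
  shows "card P \<le> card V"
proof -
  have fin: "finite P" using P(1) V by (meson finite_SigmaI finite_subset)
  have "\<exists>C\<subseteq>V. card P' + card C = card V \<and> (\<forall>v\<in>V. \<exists>c\<in>C. (v, c) \<in> linked P')" if "P' \<subseteq> P" for P'
    using finite_subset[OF that fin] that
  proof (induction P' rule: finite_induct)
    case empty
    then show ?case by (intro exI[of _ V]) auto
  next
    case (insert e P')
    then obtain C where C: "C \<subseteq> V" "card P' + card C = card V"
      "\<And>v. v \<in> V \<Longrightarrow> \<exists>c\<in>C. (v, c) \<in> linked P'" by auto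
    obtain a b where e: "e = (a, b)" by fastforce
    have ab: "a \<in> V" "b \<in> V" "(a, b) \<in> P" using insert.prems P(1) e by auto
    obtain c d where c: "c \<in> C" "(a, c) \<in> linked P'" and d: "d \<in> C" "(b, d) \<in> linked P'"
      using C(3) ab by metis
    have sub: "linked P' \<subseteq> linked (P - {(a, b)})"
      using insert.prems insert.hyps(2) e by (intro rtrancl_mono) auto
    have sub': "linked P' \<subseteq> linked (insert e P')"
      by (intro rtrancl_mono) auto
    have "c \<noteq> d"
    proof
      assume "c = d"
      then have "(a, b) \<in> linked P'" using c(2) linked_sym[OF d(2)] by (meson rtrancl_trans)
      then show False using forest_edge_separates[OF P(2,3) ab(3)] sub by blast
    qed
    have "\<exists>c'\<in>C - {c}. (v, c') \<in> linked (insert e P')" if v: "v \<in> V" for v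
    proof -
      obtain c' where c': "c' \<in> C" "(v, c') \<in> linked P'" using C(3) v by blast
      show ?thesis
      proof (cases "c' = c")
        case True
        have "(v, a) \<in> linked (insert e P')"
          using c'(2) linked_sym[OF c(2)] True sub' by (meson rtrancl_trans subsetD)
        moreover have "(a, b) \<in> linked (insert e P')" using e by blast
        ultimately have "(v, d) \<in> linked (insert e P')"
          using d(2) sub' by (meson rtrancl_trans subsetD)
        then show ?thesis using d(1) \<open>c \<noteq> d\<close> by blast
      next
        case False
        then show ?thesis using c' sub' by blast
      qed
    qed
    moreover have "card (insert e P') + card (C - {c}) = card V"
      using C(2) card.remove[OF finite_subset[OF C(1) V] c(1)] insert.hyps by simp
    ultimately show ?case using C(1) by (intro exI[of _ "C - {c}"]) auto
  qed
  from this[OF order_refl] show ?thesis by auto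
qed

context crel
begin

text \<open>By mass transport each edge can be charged to a root of its finite class instead of to
  its source. The root then pays for at most as many edges as its class has points, and the class
  sizes integrate over the roots to 1.\<close>

lemma finite_forest_mass_le:
  assumes S: "rel S" "equiv (space M) S" "\<And>x. x \<in> space M \<Longrightarrow> finite (S `` {x})"
    and P: "rel P" "forest P" "P \<inter> P\<inverse> = {}"
  shows "mass (P \<inter> S) \<le> 1"
proof -
  have S_refl: "(x, x) \<in> S" if "x \<in> space M" for x using S(2) that by (meson equivE refl_onD)
  have S_sym: "(y, x) \<in> S" if "(x, y) \<in> S" for x y using S(2) that by (meson equivE symD)
  have S_trans: "(x, z) \<in> S" if "(x, y) \<in> S" "(y, z) \<in> S" for x y z using S(2) that by (meson equivE transD)
  define Q where "Q = P \<inter> S"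
  have Q: "rel Q" unfolding Q_def using P S by (intro rel_Int)
  define V where "V k = Domain (Q \<inter> \<Psi> k)" for k
  have V_sets: "V k \<in> sets M" for k
    unfolding V_def using Domain_sets paD(1) rel_pieces(3)[OF Q] by blast
  \<comment> \<open>The points of least label in their class: exactly one root per class, since the
    classes are finite and \<open>u\<close> is injective. The negated labels put the condition in
    the form of \<open>rel_Collect_less\<close>.\<close>
  define D where "D = space M - Domain {(x, y)\<in>S. - u x < - u y}"
  have D_sets: "D \<in> sets M"
    unfolding D_def using Domain_sets[OF rel_Collect_less[OF S(1), of "\<lambda>x. - u x" "\<lambda>x. - u x"]] by simp
  have D_unique: "x = y" if "x \<in> D" "y \<in> D" "(x, y) \<in> S" for x y
  proof -
    have "u x = u y" using that S_sym[OF that(3)] by (force simp: D_def)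
    then show ?thesis using that u_inj by (auto simp: D_def dest: inj_onD)
  qed
  have D_ex: "\<exists>x\<in>D. (y, x) \<in> S" if y: "y \<in> space M" for y
  proof -
    have fin: "finite (u ` (S `` {y}))" "u ` (S `` {y}) \<noteq> {}" using S(3)[OF y] S_refl[OF y] by auto
    obtain x where x: "x \<in> S `` {y}" "u x = Min (u ` (S `` {y}))"
      using Min_in[OF fin] by (elim imageE) simp
    have "u x \<le> u z" if "(x, z) \<in> S" for z
    proof -
      have "z \<in> S `` {y}" using x(1) that S_trans[of y x z] by auto
      then show ?thesis unfolding x(2) by (intro Min_le fin imageI)
    qed
    then have "x \<in> D" using x rel_space[OF S(1)] by (fastforce simp: D_def)
    then show ?thesis using x by auto
  qed
  \<comment> \<open>Each point of \<open>A\<close> has exactly one root. Reversing the pairs moves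
    the measure of \<open>A\<close> to the roots.\<close>
  have count: "mass (S \<inter> D \<times> A) = emeasure M A" if A: "A \<in> sets M" for A
  proof -
    have AD: "rel (S \<inter> A \<times> D)" using S(1) A D_sets by (rule rel_Int_times)
    have "single_valued (S \<inter> A \<times> D)"
    proof (rule single_valuedI)
      fix x y z assume "(x, y) \<in> S \<inter> A \<times> D" "(x, z) \<in> S \<inter> A \<times> D"
      then show "y = z" using D_unique[of y z] S_sym S_trans by blast
    qed
    moreover have "Domain (S \<inter> A \<times> D) = A"
      using D_ex sets.sets_into_space[OF A] by blast
    ultimately have "mass (S \<inter> A \<times> D) = emeasure M A"
      using A by (simp add: mass_def deg_single_valued)
    moreover have "(S \<inter> A \<times> D)\<inverse> = S \<inter> D \<times> A" using S_sym by blast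
    ultimately show ?thesis using mass_converse[OF AD] by simp
  qed
  have "mass Q = (\<Sum>k. mass (Q \<inter> \<Psi> k))"
    using mass_UN[of "\<lambda>k. Q \<inter> \<Psi> k"] rel_pieces[OF Q] paD(1) by metis
  also have "\<dots> = (\<Sum>k. mass (S \<inter> D \<times> V k))"
    using count[OF V_sets] mass_pa[OF rel_pieces(3)[OF Q]] by (simp add: V_def)
  also have "\<dots> = (\<integral>\<^sup>+x. (\<Sum>k. deg (S \<inter> D \<times> V k) x) \<partial>M)"
    unfolding mass_def
    by (intro nn_integral_suminf[symmetric] deg_measurable rel_Int_times S(1) D_sets V_sets)
  also have "\<dots> \<le> (\<integral>\<^sup>+x. deg (S \<inter> D \<times> space M) x \<partial>M)"
  proof (rule nn_integral_mono)
    fix x assume x: "x \<in> space M"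
    show "(\<Sum>k. deg (S \<inter> D \<times> V k) x) \<le> deg (S \<inter> D \<times> space M) x"
    proof (cases "x \<in> D")
      case False
      then have "(S \<inter> D \<times> A) `` {x} = {}" for A by auto
      then show ?thesis by simp
    next
      case True
      let ?W = "S `` {x}"
      have W: "(S \<inter> D \<times> space M) `` {x} = ?W" using True rel_space[OF S(1)] by auto
      have fin: "finite ?W" using S(3)[OF x] .
      have "deg (S \<inter> D \<times> V k) x = emeasure (count_space UNIV) ((Q \<inter> \<Psi> k) \<inter> ?W \<times> ?W)" for k
      proof -
        have "(S \<inter> D \<times> V k) `` {x} = fst ` ((Q \<inter> \<Psi> k) \<inter> ?W \<times> ?W)"
        proof (intro equalityI subsetI)
          fix y assume "y \<in> (S \<inter> D \<times> V k) `` {x}"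
          then obtain z where "(x, y) \<in> S" "(y, z) \<in> Q \<inter> \<Psi> k" by (auto simp: V_def)
          moreover have "(x, z) \<in> S" using calculation S_trans[of x y z] by (auto simp: Q_def)
          ultimately show "y \<in> fst ` ((Q \<inter> \<Psi> k) \<inter> ?W \<times> ?W)"
            by (intro image_eqI[of _ _ "(y, z)"]) auto
        next
          fix y assume "y \<in> fst ` ((Q \<inter> \<Psi> k) \<inter> ?W \<times> ?W)"
          then show "y \<in> (S \<inter> D \<times> V k) `` {x}" using True by (auto simp: V_def)
        qed
        moreover have "inj_on fst ((Q \<inter> \<Psi> k) \<inter> ?W \<times> ?W)"
          using paD(2)[OF rel_pieces(3)[OF Q, of k]] by (auto simp: inj_on_def single_valued_def)
        moreover have "finite ((Q \<inter> \<Psi> k) \<inter> ?W \<times> ?W)" using fin by auto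
        ultimately show ?thesis by (simp add: emeasure_count_space card_image)
      qed
      then have "(\<Sum>k. deg (S \<inter> D \<times> V k) x) = (\<Sum>k. emeasure (count_space UNIV) ((Q \<inter> \<Psi> k) \<inter> ?W \<times> ?W))" by simp
      also have "\<dots> = emeasure (count_space UNIV) (\<Union>k. (Q \<inter> \<Psi> k) \<inter> ?W \<times> ?W)"
        using rel_pieces(2)[OF Q] by (intro suminf_emeasure) (auto simp: disjoint_family_on_def)
      also have "(\<Union>k. (Q \<inter> \<Psi> k) \<inter> ?W \<times> ?W) = Q \<inter> ?W \<times> ?W" using rel_pieces(1)[OF Q] by blast
      also have "emeasure (count_space UNIV) (Q \<inter> ?W \<times> ?W) = card (Q \<inter> ?W \<times> ?W)"
        using fin by (simp add: emeasure_count_space)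
      also have "card (Q \<inter> ?W \<times> ?W) \<le> card ?W"
      proof (rule forest_card_le[OF fin])
        have "\<not> simple_cycle P vs \<Longrightarrow> \<not> simple_cycle (Q \<inter> ?W \<times> ?W) vs" for vs
          unfolding simple_cycle_def Q_def by blast
        then show "forest (Q \<inter> ?W \<times> ?W)" using P(2) unfolding forest_def by blast
      qed (use P(3) in \<open>auto simp: Q_def\<close>)
      also have "of_nat (card ?W) = deg (S \<inter> D \<times> space M) x"
        unfolding W using fin by (simp add: emeasure_count_space)
      finally show ?thesis by simp
    qed
  qed
  also have "\<dots> = 1" using count[OF sets.top] by (simp add: mass_def emeasure_space_1)
  finally show ?thesis unfolding Q_def .
qed

lemma hyperfinite_forest_mass_le:
  assumes P: "rel P" "forest P" "P \<inter> P\<inverse> = {}" and hyp: "hyperfinite_rel M (generated_rel M P)"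
  shows "mass P \<le> 1"
proof -
  let ?G = "generated_rel M P"
  obtain S where S: "\<And>n::nat. measured_equiv_rel M (S n)" "\<And>n. S n \<subseteq> ?G" "\<And>n. S n \<subseteq> S (Suc n)"
    "\<And>n x. x \<in> space M \<Longrightarrow> finite (S n `` {x})" "rel_null M ?G (?G - (\<Union>n. S n))"
    using hyp unfolding hyperfinite_rel_def by blast
  have G: "rel ?G" using P(1) by (rule rel_generated)
  have relS: "rel (S n)" for n
  proof (rule relI)
    show "S n \<in> sets (M \<Otimes>\<^sub>M M)" using S(1)[of n] by (simp add: measured_equiv_rel_def)
    show "S n \<subseteq> E" using S(2)[of n] relD(2)[OF G] by blast
  qed
  have "mass (P \<inter> S n) \<le> 1" for n
    by (rule finite_forest_mass_le[OF relS _ S(4) P]) (use S(1) in \<open>auto simp: measured_equiv_rel_def\<close>)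
  moreover have "incseq (\<lambda>n. P \<inter> S n)" using S(3) by (intro incseq_SucI) blast
  ultimately have le: "mass (\<Union>n. P \<inter> S n) \<le> 1"
    by (subst mass_SUP) (auto intro!: SUP_least rel_Int P(1) relS)
  obtain N where N: "?G - (\<Union>n. S n) \<subseteq> N" "N \<subseteq> ?G" "rel_measure M ?G N = 0"
    using S(5) by (auto simp: rel_null_def)
  have PG: "P \<subseteq> ?G" using rel_space[OF P(1)] by (auto simp: generated_rel_def)
  have "P = (\<Union>n. P \<inter> S n) \<union> (P - (\<Union>n. S n))" by auto
  then have "mass P = mass (\<Union>n. P \<inter> S n) + mass (P - (\<Union>n. S n))"
    using mass_Un[of "\<Union>n. P \<inter> S n" "P - (\<Union>n. S n)"] P(1) relS rel_UN[of "\<lambda>n. P \<inter> S n"] rel_UN[of S]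
    by (auto simp: rel_Int rel_Diff)
  also have "mass (P - (\<Union>n. S n)) \<le> mass N" using N(1) PG by (intro mass_mono) auto
  also have "mass N = 0" using N(2,3) by (simp add: rel_measure_eq_mass)
  finally show ?thesis using le by simp
qed

end

section \<open>Minimal spanning forests\<close>

lemma rtrancl_UN_incseq:
  fixes H :: "nat \<Rightarrow> ('b \<times> 'b) set"
  assumes "incseq H"
  shows "(\<Union>n. H n)\<^sup>* = (\<Union>n. (H n)\<^sup>*)"
proof
  show "(\<Union>n. (H n)\<^sup>*) \<subseteq> (\<Union>n. H n)\<^sup>*" by (intro UN_least rtrancl_mono) auto
  show "(\<Union>n. H n)\<^sup>* \<subseteq> (\<Union>n. (H n)\<^sup>*)"
  proof clarify
    fix x y assume "(x, y) \<in> (\<Union>n. H n)\<^sup>*"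
    then show "(x, y) \<in> (\<Union>n. (H n)\<^sup>*)"
    proof induction
      case (step y z)
      then obtain m n where mn: "(x, y) \<in> (H m)\<^sup>*" "(y, z) \<in> H n" by blast
      have "(x, y) \<in> (H (max m n))\<^sup>*"
        using rtrancl_mono[OF incseqD[OF assms, of m "max m n"]] mn(1) by auto
      moreover have "(y, z) \<in> H (max m n)"
        using incseqD[OF assms, of n "max m n"] mn(2) by auto
      ultimately show ?case by (meson UNIV_I UN_I rtrancl.rtrancl_into_rtrancl)
    qed auto
  qed
qed

context crel
begin

definition lower :: "('a \<times> 'a) set \<Rightarrow> ('a \<times> 'a) set \<Rightarrow> ('a \<Rightarrow> 'b::linorder) \<Rightarrow> 'a \<Rightarrow> ('a \<times> 'a) set" where
  "lower T P c x = T \<union> {(y, z)\<in>P. c y < c x}"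

text \<open>The edges of \<open>P\<close> in the minimal spanning forest of \<open>T \<union> P\<close>, where an edge of \<open>P\<close> has the label of its
  source and the edges of \<open>T\<close> come before those of \<open>P\<close>.\<close>

definition minimal_edges :: "('a \<times> 'a) set \<Rightarrow> ('a \<times> 'a) set \<Rightarrow> ('a \<Rightarrow> 'b::linorder) \<Rightarrow> ('a \<times> 'a) set" where
  "minimal_edges T P c = {(x, y)\<in>P. (x, y) \<notin> linked (lower T P c x)}"

lemma minimal_edges_subset: "minimal_edges T P c \<subseteq> P"
  by (auto simp: minimal_edges_def)

text \<open>The graph \<open>lower T P c x\<close> varies with \<open>x\<close>, but only through
  \<open>c x\<close>. For natural labels it takes countably many values, each with a measurable
  generated relation; the label \<open>u\<close> is reached by intersection in
  \<open>minimal_edges_level\<close>.\<close>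

lemma rel_minimal_edges:
  fixes c :: "'a \<Rightarrow> nat"
  assumes T: "rel T" and P: "rel P" and c [measurable]: "c \<in> M \<rightarrow>\<^sub>M count_space UNIV"
  shows "rel (minimal_edges T P c)"
proof -
  have *: "{(y, z)\<in>P. c y < i} = P \<inter> {y\<in>space M. c y < i} \<times> UNIV" for i
    using rel_space[OF P] by auto
  have "rel {(y, z)\<in>P. c y < i}" for i
    unfolding * by (rule rel_Int_fst[OF P]) measurable
  then have "rel (generated_rel M (T \<union> {(y, z)\<in>P. c y < i}))" for i
    using T by (intro rel_generated rel_Un)
  moreover have "rel (P \<inter> {x\<in>space M. c x = i} \<times> UNIV)" for i
    by (rule rel_Int_fst[OF P]) measurable
  moreover have "minimal_edges T P c =
      (\<Union>i. P \<inter> {x\<in>space M. c x = i} \<times> UNIV - generated_rel M (T \<union> {(y, z)\<in>P. c y < i}))"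
    unfolding minimal_edges_def lower_def generated_rel_def using rel_space[OF P] by auto
  ultimately show ?thesis by (auto intro: rel_UN rel_Diff)
qed

text \<open>The labels being natural numbers, the edges outside of the forest can be replaced by well-founded
  induction.\<close>

lemma minimal_edges_generate:
  fixes c :: "'a \<Rightarrow> nat"
  shows "(x, y) \<in> P \<Longrightarrow> (x, y) \<in> linked (T \<union> minimal_edges T P c)"
proof (induction "c x" arbitrary: x y rule: less_induct)
  case less
  let ?G = "(T \<union> minimal_edges T P c) \<union> (T \<union> minimal_edges T P c)\<inverse>"
  show ?case
  proof (cases "(x, y) \<in> minimal_edges T P c")
    case False
    then have "(x, y) \<in> linked (lower T P c x)"
      using less.prems by (auto simp: minimal_edges_def)
    moreover have "lower T P c x \<union> (lower T P c x)\<inverse> \<subseteq> ?G\<^sup>*"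
    proof -
      have "(a, b) \<in> ?G\<^sup>*" if "(a, b) \<in> lower T P c x" for a b
        using that less.hyps[of a b] by (auto simp: lower_def)
      then show ?thesis by (auto intro: linked_sym)
    qed
    ultimately show ?thesis by (metis (no_types, lifting) rtrancl_subset_rtrancl subsetD)
  qed blast
qed

text \<open>A cycle contains an edge outside \<open>T\<close>, as \<open>T\<close> is a forest. Take
  one whose source has the largest label: all other edges of the cycle lie strictly below it or in
  \<open>T\<close> and link its ends, so it is not minimal.\<close>

lemma minimal_edges_forest:
  assumes T: "forest T" "T \<inter> T\<inverse> = {}" and P: "pa P"
  shows "forest (T \<union> minimal_edges T P u)"
    "(T \<union> minimal_edges T P u) \<inter> (T \<union> minimal_edges T P u)\<inverse> = {}"
    "T \<inter> minimal_edges T P u = {}"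
proof -
  let ?F = "minimal_edges T P u"
  have PP: "x \<in> space M" if "(x, y) \<in> P" for x y using rel_space[OF paD(1)[OF P]] that by blast
  have F: "(x, y) \<in> P" "(x, y) \<notin> linked (lower T P u x)" if "(x, y) \<in> ?F" for x y
    using that by (auto simp: minimal_edges_def)
  have FT: "(x, y) \<notin> T" "(y, x) \<notin> T" if "(x, y) \<in> ?F" for x y
    using F(2)[OF that] by (auto simp: lower_def)
  have FF: "(y, x) \<notin> ?F" if xy: "(x, y) \<in> ?F" for x y
  proof
    assume yx: "(y, x) \<in> ?F"
    have "x \<noteq> y" using F(2)[OF xy] by auto
    then have "u x \<noteq> u y" using u_inj PP[OF F(1)[OF xy]] PP[OF F(1)[OF yx]] by (auto dest: inj_onD)
    then consider "u x < u y" | "u y < u x" by linarith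
    then show False
    proof cases
      case 1
      then have "(x, y) \<in> lower T P u y" using F(1)[OF xy] by (simp add: lower_def)
      then show False using F(2)[OF yx] by auto
    next
      case 2
      then have "(y, x) \<in> lower T P u x" using F(1)[OF yx] by (simp add: lower_def)
      then show False using F(2)[OF xy] by auto
    qed
  qed
  show "T \<inter> ?F = {}" using FT by auto
  show "(T \<union> ?F) \<inter> (T \<union> ?F)\<inverse> = {}" using FT FF T(2) by auto
  show "forest (T \<union> ?F)"
    unfolding forest_def
  proof
    assume "\<exists>vs. simple_cycle (T \<union> ?F) vs"
    then obtain vs where vs: "simple_cycle (T \<union> ?F) vs" by blast
    define n where "n = length vs"
    define v where "v i = vs ! i" for i
    have n: "n \<noteq> 0" "n \<noteq> 2" and dist: "\<And>i j. i < n \<Longrightarrow> j < n \<Longrightarrow> v i = v j \<Longrightarrow> i = j"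
      and edge: "\<And>i. i < n \<Longrightarrow> (v i, v (Suc i mod n)) \<in> (T \<union> ?F) \<union> (T \<union> ?F)\<inverse>"
      using vs by (auto simp: simple_cycle_def n_def v_def nth_eq_iff_index_eq)
    define I where "I = {i. i < n \<and> (v i, v (Suc i mod n)) \<notin> T \<union> T\<inverse>}"
    have "I \<noteq> {}"
    proof
      assume "I = {}"
      then have "simple_cycle T vs" using vs by (auto simp: simple_cycle_def I_def n_def v_def)
      then show False using T(1) by (auto simp: forest_def)
    qed
    define src where "src i = (if (v i, v (Suc i mod n)) \<in> ?F then v i else v (Suc i mod n))" for i
    define tgt where "tgt i = (if (v i, v (Suc i mod n)) \<in> ?F then v (Suc i mod n) else v i)" for i
    have I_edge: "(src i, tgt i) \<in> ?F" if "i \<in> I" for i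
      using edge[of i] that by (auto simp: I_def src_def tgt_def)
    have st: "(v i = src i \<and> v (Suc i mod n) = tgt i) \<or> (v i = tgt i \<and> v (Suc i mod n) = src i)" for i
      by (auto simp: src_def tgt_def)
    have fin: "finite ((\<lambda>i. u (src i)) ` I)" "(\<lambda>i. u (src i)) ` I \<noteq> {}" using \<open>I \<noteq> {}\<close> by (auto simp: I_def)
    obtain i0 where i0: "i0 \<in> I" "u (src i0) = Max ((\<lambda>i. u (src i)) ` I)"
      using Max_in[OF fin] by (elim imageE) simp
    then have i0: "i0 \<in> I" "\<And>i. i \<in> I \<Longrightarrow> u (src i) \<le> u (src i0)"
      using Max_ge[OF fin(1)] by simp_all
    let ?H = "lower T P u (src i0)"
    have "(v j, v (Suc j mod n)) \<in> linked ?H" if j: "j < n" "j \<noteq> i0" for j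
    proof (cases "j \<in> I")
      case False
      then show ?thesis using j(1) by (auto simp: I_def lower_def)
    next
      case True
      \<comment> \<open>Equal labels mean equal sources, hence equal edges since \<open>P\<close> is
        single-valued, and a simple cycle cannot use an edge twice.\<close>
      have "u (src j) \<noteq> u (src i0)"
      proof
        assume "u (src j) = u (src i0)"
        then have s: "src j = src i0"
          using u_inj PP[OF F(1)[OF I_edge[OF True]]] PP[OF F(1)[OF I_edge[OF i0(1)]]] by (auto dest: inj_onD)
        have t: "tgt j = tgt i0"
          using single_valuedD[OF paD(2)[OF P] F(1)[OF I_edge[OF True]], of "tgt i0"] F(1)[OF I_edge[OF i0(1)]] s by simp
        have lt: "i0 < n" "Suc j mod n < n" "Suc i0 mod n < n" using i0 n by (auto simp: I_def)
        have "v j \<noteq> v i0" using dist j lt by blast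
        then have "v j = v (Suc i0 mod n)" "v (Suc j mod n) = v i0" using st[of j] st[of i0] s t by auto
        then have "j = Suc i0 mod n" "Suc j mod n = i0" using dist j lt by blast+
        then have "(i0 + 2) mod n = i0 mod n" using lt(1) by (metis add_2_eq_Suc' mod_Suc_eq mod_less)
        then have "n dvd 2" by (metis add_diff_cancel_left' le_add1 mod_eq_dvd_iff_nat)
        then have "n \<le> 2" by (rule dvd_imp_le) simp
        then have "n = 1" using n by linarith
        then show False using j i0 by (simp add: I_def)
      qed
      then have "(src j, tgt j) \<in> ?H" using i0(2)[OF True] F(1)[OF I_edge[OF True]] by (simp add: lower_def)
      then show ?thesis using st[of j] by auto
    qed
    then have "(v (Suc i0 mod n), v i0) \<in> linked ?H"
      using cyclic_path[of i0 n v "?H \<union> ?H\<inverse>"] i0(1) by (auto simp: I_def)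
    then have "(src i0, tgt i0) \<in> linked ?H"
      using st[of i0] linked_sym by metis
    then show False using F(2)[OF I_edge[OF i0(1)]] by blast
  qed
qed

section \<open>Labels truncated to finitely many binary digits\<close>

definition level :: "nat \<Rightarrow> 'a \<Rightarrow> nat" where
  "level n x = nat \<lfloor>2 ^ n * u x\<rfloor>"

lemma level_measurable [measurable]: "level n \<in> M \<rightarrow>\<^sub>M count_space UNIV"
  unfolding level_def by measurable

lemma level_less_iff: "level n y < level n x \<longleftrightarrow> \<lfloor>2 ^ n * u y\<rfloor> < \<lfloor>2 ^ n * u x\<rfloor>"
  unfolding level_def by (rule nat_less_eq_zless) (simp add: u_bounds(1))

lemma level_Suc: "level n y < level n x \<Longrightarrow> level (Suc n) y < level (Suc n) x"
proof -
  assume "level n y < level n x"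
  then have "\<lfloor>2 ^ n * u y\<rfloor> < \<lfloor>2 ^ n * u x\<rfloor>" by (simp only: level_less_iff)
  then have *: "2 ^ n * u y < of_int \<lfloor>2 ^ n * u x\<rfloor>" by (simp add: floor_less_iff)
  have "\<lfloor>2 ^ Suc n * u y\<rfloor> < 2 * \<lfloor>2 ^ n * u x\<rfloor>" using * by (simp add: floor_less_iff)
  also have "2 * \<lfloor>2 ^ n * u x\<rfloor> \<le> \<lfloor>2 ^ Suc n * u x\<rfloor>"
    using of_int_floor_le[of "2 ^ n * u x"] by (simp add: le_floor_iff)
  finally show ?thesis by (simp only: level_less_iff)
qed

lemma less_iff_level: "u y < u x \<longleftrightarrow> (\<exists>n. level n y < level n x)"
proof
  assume "u y < u x"
  then obtain n where n: "1 / (u x - u y) < 2 ^ n"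
    using real_arch_pow[of 2 "1 / (u x - u y)"] by auto
  then have "1 + 2 ^ n * u y < 2 ^ n * u x" using \<open>u y < u x\<close> by (simp add: field_simps)
  then have "\<lfloor>2 ^ n * u y\<rfloor> < \<lfloor>2 ^ n * u x\<rfloor>" by linarith
  then show "\<exists>n. level n y < level n x"
    by (intro exI[of _ n]) (simp only: level_less_iff)
next
  assume "\<exists>n. level n y < level n x"
  then obtain n where "level n y < level n x" by blast
  then have "\<lfloor>2 ^ n * u y\<rfloor> < \<lfloor>2 ^ n * u x\<rfloor>" by (simp only: level_less_iff)
  then have "2 ^ n * u y < 2 ^ n * u x" by linarith
  then show "u y < u x" by simp
qed

lemma lower_level:
  "incseq (\<lambda>n. lower T P (level n) x)" "lower T P u x = (\<Union>n. lower T P (level n) x)"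
proof -
  show "incseq (\<lambda>n. lower T P (level n) x)"
    by (rule incseq_SucI) (use level_Suc in \<open>auto simp: lower_def\<close>)
  show "lower T P u x = (\<Union>n. lower T P (level n) x)"
    by (auto simp: lower_def less_iff_level)
qed

text \<open>A strict inequality of labels shows up after finitely many digits and then persists, so
  the graphs \<open>lower T P (level n) x\<close> increase to the one for \<open>u\<close>. A path
  uses finitely many edges, so linkage passes to the limit too.\<close>

lemma minimal_edges_level:
  "decseq (\<lambda>n. minimal_edges T P (level n))" "minimal_edges T P u = (\<Inter>n. minimal_edges T P (level n))"
proof -
  have inc: "incseq (\<lambda>n. lower T P (level n) x \<union> (lower T P (level n) x)\<inverse>)" for x
    using lower_level(1)[of T P x] unfolding incseq_def by blast
  have "linked (lower T P (level n) x) \<subseteq> linked (lower T P (level (Suc n)) x)" for n x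
    by (intro rtrancl_mono incseqD[OF inc]) simp
  then show "decseq (\<lambda>n. minimal_edges T P (level n))"
    by (intro decseq_SucI) (auto simp: minimal_edges_def)
  have "lower T P u x \<union> (lower T P u x)\<inverse> = (\<Union>n. lower T P (level n) x \<union> (lower T P (level n) x)\<inverse>)" for x
    unfolding lower_level(2)[of T P x] by blast
  then show "minimal_edges T P u = (\<Inter>n. minimal_edges T P (level n))"
    using rtrancl_UN_incseq[OF inc] by (auto simp: minimal_edges_def)
qed

lemma thin_edges:
  assumes T: "pa T" "forest T" "T \<inter> T\<inverse> = {}" "measure M (Domain T) = 1"
    and light: "\<And>Q. rel Q \<Longrightarrow> forest Q \<Longrightarrow> Q \<inter> Q\<inverse> = {} \<Longrightarrow> mass Q \<le> 1"
    and P: "pa P" and \<epsilon>: "\<epsilon> > 0"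
  shows "\<exists>G. pa G \<and> G \<subseteq> P \<and> measure M (Domain G) < \<epsilon> \<and>
    P \<subseteq> linked (T \<union> G)"
proof -
  let ?G = "\<lambda>n. minimal_edges T P (level n)" and ?F = "minimal_edges T P u"
  have relG: "rel (?G n)" for n using paD(1) T(1) P level_measurable by (intro rel_minimal_edges)
  then have paG: "pa (?G n)" for n using minimal_edges_subset by (rule pa_subset[OF P])
  have relF: "rel ?F" unfolding minimal_edges_level(2) using relG by (rule rel_INT)
  then have paF: "pa ?F" using minimal_edges_subset by (rule pa_subset[OF P])
  have "mass (T \<union> ?F) \<le> 1"
    using minimal_edges_forest[OF T(2,3) P] relF paD(1)[OF T(1)] by (intro light rel_Un)
  moreover have "mass (T \<union> ?F) = mass T + mass ?F"
    using minimal_edges_forest(3)[OF T(2,3) P] relF paD(1)[OF T(1)] by (intro mass_Un)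
  moreover have "mass T = 1" using mass_pa[OF T(1)] T(4) by (simp add: emeasure_eq_measure)
  ultimately have "1 + ennreal (measure M (Domain ?F)) \<le> 1"
    using mass_pa[OF paF] by (simp add: emeasure_eq_measure)
  then have "ennreal (1 + measure M (Domain ?F)) \<le> ennreal 1" by (simp add: ennreal_plus[symmetric] del: ennreal_plus)
  then have F0: "measure M (Domain ?F) = 0"
    by (subst (asm) ennreal_le_iff) (auto intro: antisym)
  \<comment> \<open>Domains do not commute with intersections in general; here they do because all
    graphs lie in the single-valued \<open>P\<close>. This gives access to continuity of the measure
    from above.\<close>
  have "Domain ?F = (\<Inter>n. Domain (?G n))"
  proof (intro equalityI subsetI)
    fix x assume x: "x \<in> (\<Inter>n. Domain (?G n))"
    then obtain y where y: "(x, y) \<in> P" using minimal_edges_subset[of T P "level 0"] by blast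
    have "(x, y) \<in> ?G n" for n
    proof -
      obtain z where z: "(x, z) \<in> ?G n" using x by blast
      then have "z = y" using y single_valuedD[OF paD(2)[OF P]] minimal_edges_subset[of T P "level n"] by blast
      then show ?thesis using z by simp
    qed
    then show "x \<in> Domain ?F" unfolding minimal_edges_level(2) by blast
  qed (auto simp: minimal_edges_level(2))
  moreover have "decseq (\<lambda>n. Domain (?G n))"
    using minimal_edges_level(1)[of T P] unfolding decseq_def by blast
  ultimately have "(\<lambda>n. measure M (Domain (?G n))) \<longlonglongrightarrow> measure M (Domain ?F)"
    using finite_Lim_measure_decseq[of "\<lambda>n. Domain (?G n)"] Domain_sets[OF relG] by auto
  then have "\<forall>\<^sub>F n in sequentially. measure M (Domain (?G n)) < \<epsilon>"
    unfolding F0 using \<epsilon> by (rule order_tendstoD)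
  then obtain n where "measure M (Domain (?G n)) < \<epsilon>" by (auto simp: eventually_sequentially)
  moreover have "P \<subseteq> linked (T \<union> ?G n)" using minimal_edges_generate by auto
  ultimately show ?thesis using paG minimal_edges_subset by blast
qed

end

section \<open>Packing edges and the isoperimetric constant\<close>

context crel
begin

lemma null_sets_measure: "A \<in> sets M \<Longrightarrow> measure M A = 0 \<Longrightarrow> A \<in> null_sets M"
  by (simp add: null_sets_def emeasure_eq_measure)

lemma Image_null:
  assumes "N \<in> null_sets M"
  shows "E `` N \<in> null_sets M"
proof -
  have "Range (\<Phi> k \<inter> N \<times> UNIV) \<in> null_sets M" for k
  proof -
    have pa: "pa (\<Phi> k \<inter> N \<times> UNIV)"
      using assms by (intro pa_subset[OF pa_\<Phi>] rel_Int_fst paD(1)[OF pa_\<Phi>]) auto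
    have "Domain (\<Phi> k \<inter> N \<times> UNIV) \<in> null_sets M"
      by (rule null_sets_subset[OF assms Domain_sets[OF paD(1)[OF pa]]]) auto
    then show ?thesis using pa_measure[OF pa] Range_sets[OF paD(1)[OF pa]] by (auto simp: null_sets_def)
  qed
  moreover have "E `` N = (\<Union>k. Range (\<Phi> k \<inter> N \<times> UNIV))"
  proof (intro equalityI subsetI)
    fix y assume "y \<in> E `` N"
    then obtain x where x: "(x, y) \<in> E" "x \<in> N" by blast
    then obtain k where "(x, y) \<in> \<Phi> k" using UN_\<Phi> by blast
    then show "y \<in> (\<Union>k. Range (\<Phi> k \<inter> N \<times> UNIV))" using x by blast
  next
    fix y assume "y \<in> (\<Union>k. Range (\<Phi> k \<inter> N \<times> UNIV))"
    then obtain k x where "(x, y) \<in> \<Phi> k" "x \<in> N" by blast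
    then show "y \<in> E `` N" using UN_\<Phi> by blast
  qed
  ultimately show ?thesis by (auto intro: null_sets_UN)
qed

lemma cut_off_exists:
  fixes s :: "nat \<Rightarrow> real"
  assumes s: "\<And>n. 0 \<le> s n" "\<And>n. (\<Sum>m<n. s m) \<le> 1"
  shows "\<exists>V. incseq V \<and> (\<forall>n. V n \<in> sets M \<and> measure M (V n) = (\<Sum>m<n. s m))"
proof -
  have "\<exists>V. \<forall>n. (V n \<in> sets M \<and> measure M (V n) = (\<Sum>m<n. s m)) \<and> V n \<subseteq> V (Suc n)"
  proof (rule dependent_nat_choice)
    fix V n assume V: "V \<in> sets M \<and> measure M V = (\<Sum>m<n. s m)"
    have "s n \<le> measure M (space M - V)" using V s(2)[of "Suc n"] by (simp add: prob_compl)
    then obtain B where B: "B \<in> sets M" "B \<subseteq> space M - V" "measure M B = s n"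
      using subset_of_measure[of "space M - V" "s n"] V s(1) by blast
    then have "measure M (V \<union> B) = (\<Sum>m<Suc n. s m)"
      using V by (subst finite_measure_Union) auto
    then show "\<exists>W. (W \<in> sets M \<and> measure M W = (\<Sum>m<Suc n. s m)) \<and> V \<subseteq> W"
      using V B by (intro exI[of _ "V \<union> B"]) auto
  qed auto
  then obtain V where V: "\<forall>n. (V n \<in> sets M \<and> measure M (V n) = (\<Sum>m<n. s m)) \<and> V n \<subseteq> V (Suc n)" by blast
  then have "incseq V" by (intro incseq_SucI) blast
  with V show ?thesis by blast
qed

text \<open>Inside an ergodic subrelation the edges of countably many partial automorphisms of small total
  measure can be moved to disjoint places, so that they form a single partial automorphism.\<close>

lemma pack_edges:
  assumes T: "rel T" "ergodic_rel M (generated_rel M T)"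
    and G: "\<And>n. pa (G n)" "\<And>n. measure M (Domain (G n)) < \<epsilon> / 2 ^ Suc n" and \<epsilon>: "0 < \<epsilon>" "\<epsilon> \<le> 1"
  shows "\<exists>\<psi> N. pa \<psi> \<and> measure M (Domain \<psi>) \<le> \<epsilon> \<and> N \<in> null_sets M \<and>
    (\<forall>n x y. (x, y) \<in> G n \<longrightarrow> x \<notin> N \<longrightarrow> y \<notin> N \<longrightarrow> (x, y) \<in> linked (T \<union> \<psi>))"
proof -
  let ?E = "generated_rel M T"
  have relE: "rel ?E" using T(1) by (rule rel_generated)
  \<comment> \<open>The matchings are taken inside the relation generated by \<open>T\<close>, so
    that moving an end of an edge uses only \<open>T\<close>-paths.\<close>
  interpret R: crel M ?E u using relE equiv_generated by (rule sub_crel)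
  interpret R: ergodic_crel M ?E u by unfold_locales (fact T(2))
  have Rpa: "pa P" "P \<subseteq> ?E" if "R.pa P" for P
    using that relD(2)[OF relE] by (auto simp: R.pa_def pa_def R.rel_def rel_def)
  define s where "s n = measure M (Domain (G n))" for n
  have geo: "(\<Sum>m<n. \<epsilon> / 2 ^ Suc m) = \<epsilon> - \<epsilon> / 2 ^ n" for n
    by (induction n) (simp_all add: field_simps)
  have s_sum: "(\<Sum>m<n. s m) \<le> \<epsilon>" for n
  proof -
    have "(\<Sum>m<n. s m) \<le> (\<Sum>m<n. \<epsilon> / 2 ^ Suc m)"
      using G(2) unfolding s_def by (intro sum_mono less_imp_le) auto
    also have "\<dots> \<le> \<epsilon>" unfolding geo using \<epsilon>(1) by simp
    finally show ?thesis .
  qed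
  \<comment> \<open>The measures sum to at most \<open>\<epsilon> \<le> 1\<close>, so there is room
    for disjoint sets \<open>W n\<close>, each as large as the domain of \<open>G n\<close>.\<close>
  have "\<exists>V. incseq V \<and> (\<forall>n. V n \<in> sets M \<and> measure M (V n) = (\<Sum>m<n. s m))"
    by (rule cut_off_exists) (use s_sum \<epsilon>(2) order_trans in \<open>auto simp: s_def\<close>)
  then obtain V where V: "incseq V" "\<And>n. V n \<in> sets M" "\<And>n. measure M (V n) = (\<Sum>m<n. s m)" by blast
  define W where "W n = V (Suc n) - V n" for n
  have W: "W n \<in> sets M" "measure M (W n) = s n" for n
    unfolding W_def using V incseqD[OF V(1), of n "Suc n"] by (auto simp: finite_measure_Diff)
  have W_disj: "disjoint_family W"
    unfolding W_def using V(1) by (rule disjoint_family_Suc[OF incseq_SucD])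
  have DG: "Domain (G n) \<in> sets M" "Range (G n) \<in> sets M" for n
    using Domain_sets Range_sets paD(1)[OF G(1)] by auto
  have RG: "measure M (Range (G n)) = s n" for n
    using pa_measure[OF G(1)] by (simp add: measure_def s_def)
  have "\<forall>n. \<exists>P. R.pa P \<and> Domain P \<subseteq> Domain (G n) \<and> Range P \<subseteq> W n \<and> measure M (Domain (G n) - Domain P) = 0"
    using R.equidecomposable[OF DG(1) W(1)] W(2) by (simp add: s_def)
  then obtain A where A: "\<And>n. R.pa (A n)" "\<And>n. Domain (A n) \<subseteq> Domain (G n)" "\<And>n. Range (A n) \<subseteq> W n"
    "\<And>n. measure M (Domain (G n) - Domain (A n)) = 0" by metis
  have "\<forall>n. \<exists>P. R.pa P \<and> Domain P \<subseteq> Range (G n) \<and> Range P \<subseteq> W n \<and> measure M (Range (G n) - Domain P) = 0"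
    using R.equidecomposable[OF DG(2) W(1)] W(2) RG by simp
  then obtain B where B: "\<And>n. R.pa (B n)" "\<And>n. Domain (B n) \<subseteq> Range (G n)" "\<And>n. Range (B n) \<subseteq> W n"
    "\<And>n. measure M (Range (G n) - Domain (B n)) = 0" by metis
  \<comment> \<open>\<open>G n\<close> with both ends moved into \<open>W n\<close>. Domains and
    ranges for different \<open>n\<close> are then disjoint, which makes the union a partial
    automorphism.\<close>
  define \<psi> where "\<psi> n = (A n)\<inverse> O G n O B n" for n
  have \<psi>: "pa (\<psi> n)" "Domain (\<psi> n) \<subseteq> W n" "Range (\<psi> n) \<subseteq> W n" for n
  proof -
    have "pa (A n)" "pa (B n)" using Rpa(1) A(1) B(1) by blast+
    then show "pa (\<psi> n)" unfolding \<psi>_def by (intro pa_comp pa_converse G(1))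
    show "Domain (\<psi> n) \<subseteq> W n" "Range (\<psi> n) \<subseteq> W n"
      using A(3)[of n] B(3)[of n] unfolding \<psi>_def by blast+
  qed
  have disj: "disjoint_family (\<lambda>n. Domain (\<psi> n))" "disjoint_family (\<lambda>n. Range (\<psi> n))"
    using W_disj \<psi>(2,3) unfolding disjoint_family_on_def by blast+
  have P: "pa (\<Union>n. \<psi> n)" using \<psi>(1) disj by (rule pa_UN)
  have "Domain (\<Union>n. \<psi> n) \<subseteq> (\<Union>n. V n)" using \<psi>(2) unfolding W_def by blast
  then have "measure M (Domain (\<Union>n. \<psi> n)) \<le> measure M (\<Union>n. V n)"
    by (rule finite_measure_mono) (use V(2) in auto)
  also have "\<dots> \<le> \<epsilon>"
  proof (rule LIMSEQ_le_const2)
    show "(\<lambda>n. measure M (V n)) \<longlonglongrightarrow> measure M (\<Union>n. V n)"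
      using V(1,2) by (intro finite_Lim_measure_incseq) auto
  qed (use V(3) s_sum in auto)
  finally have le: "measure M (Domain (\<Union>n. \<psi> n)) \<le> \<epsilon>" .
  \<comment> \<open>The points at which one of the matchings is undefined. Off \<open>N\<close> an
    edge \<open>(x, y)\<close> of \<open>G n\<close> is recovered as a \<open>T\<close>-path from
    \<open>x\<close> to \<open>a\<close>, the edge \<open>(a, b)\<close> of \<open>\<psi> n\<close>,
    and a \<open>T\<close>-path from \<open>b\<close> to \<open>y\<close>.\<close>
  define N where "N = (\<Union>n. (Domain (G n) - Domain (A n)) \<union> (Range (G n) - Domain (B n)))"
  have N: "N \<in> null_sets M"
    unfolding N_def using A(4) B(4) DG Domain_sets[OF paD(1)[OF Rpa(1)[OF A(1)]]] Domain_sets[OF paD(1)[OF Rpa(1)[OF B(1)]]]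
    by (intro null_sets_UN null_sets.Un null_sets_measure) auto
  let ?K = "(T \<union> (\<Union>n. \<psi> n)) \<union> (T \<union> (\<Union>n. \<psi> n))\<inverse>"
  have sub: "?E \<subseteq> ?K\<^sup>*" unfolding generated_rel_def by (intro le_infI1 rtrancl_mono) auto
  have "(x, y) \<in> ?K\<^sup>*" if xy: "(x, y) \<in> G n" "x \<notin> N" "y \<notin> N" for n x y
  proof -
    have "x \<in> Domain (A n)" "y \<in> Domain (B n)" using xy unfolding N_def by blast+
    then obtain a b where ab: "(x, a) \<in> A n" "(y, b) \<in> B n" by blast
    then have "(a, b) \<in> \<psi> n" using xy(1) unfolding \<psi>_def by blast
    then have "(a, b) \<in> ?K\<^sup>*" by blast
    moreover have "(x, a) \<in> ?K\<^sup>*" "(y, b) \<in> ?K\<^sup>*" using ab Rpa(2)[OF A(1)] Rpa(2)[OF B(1)] sub by blast+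
    ultimately show ?thesis using linked_sym[of y b] by (meson rtrancl_trans)
  qed
  then show ?thesis using P le N by blast
qed

end

section \<open>Symmetric vertices from the cyclic shifts of a tower\<close>

lemma mod_shift_inj:
  fixes i j k N :: nat
  shows "(i + j) mod N = (k + j) mod N \<Longrightarrow> i < N \<Longrightarrow> k < N \<Longrightarrow> i = k"
proof (induction i k rule: linorder_wlog)
  case (le i k)
  then have "N dvd k - i" using mod_eq_dvd_iff_nat[of "i + j" "k + j" N] by simp
  then show ?case using le by (auto dest: dvd_imp_le)
qed simp

lemma mod_shift_surj:
  fixes j m N :: nat
  assumes "m < N"
  shows "\<exists>i<N. (i + j) mod N = m"
proof -
  have inj: "inj_on (\<lambda>i. (i + j) mod N) {..<N}" by (rule inj_onI) (auto dest: mod_shift_inj)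
  have "(\<lambda>i. (i + j) mod N) ` {..<N} = {..<N}"
    using assms by (intro endo_inj_surj[OF _ _ inj]) auto
  then have "m \<in> (\<lambda>i. (i + j) mod N) ` {..<N}" using assms by simp
  then show ?thesis by auto
qed

lemma count_le_1: "(\<And>a b. a \<in> S \<Longrightarrow> b \<in> S \<Longrightarrow> a = b) \<Longrightarrow> emeasure (count_space UNIV) S \<le> 1"
proof -
  assume *: "\<And>a b. a \<in> S \<Longrightarrow> b \<in> S \<Longrightarrow> a = b"
  then have "S = {} \<or> (\<exists>a. S = {a})" by blast
  then show ?thesis by auto
qed

context crel
begin

lemma mass_null:
  assumes "rel P" "N \<in> null_sets M" "P \<subseteq> N \<times> UNIV"
  shows "mass P = 0"
proof -
  have "deg P x = 0" if "x \<notin> N" for x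
  proof -
    have "P `` {x} = {}" using assms(3) that by blast
    then show ?thesis by simp
  qed
  then have "AE x in M. deg P x = 0"
    by (intro AE_I'[OF assms(2)]) blast
  then show ?thesis unfolding mass_def by (simp add: nn_integral_0_iff_AE deg_measurable[OF assms(1)])
qed

text \<open>The powers of the cyclic permutation of the levels of a tower are pairwise disjoint symmetric
  vertices, whose union is, over a point, its column. An edge of \<open>T\<close> leaves the column only at its top
  and enters it only at its bottom.\<close>

lemma tower_isoperimetric_bound:
  assumes tower: "tower N B g" and Z: "Z \<in> sets M" "measure M Z = 1"
    and T: "pa T" "\<And>x i j. x \<in> B \<Longrightarrow> i < N \<Longrightarrow> g i x \<in> Z \<Longrightarrow> Suc j < N \<Longrightarrow> (g j x, g (Suc j) x) \<in> T"
    and \<psi>: "pa \<psi>" and R: "E \<subseteq> R"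
  shows "isoperimetric_const_wrt M R (T \<union> \<psi>) \<le> ennreal (2 / N + 2 * measure M (Domain \<psi>))"
proof -
  have N: "N > 0" and B: "B \<in> sets M" and mB: "measure M B * N = 1" using towerD[OF tower] by auto
  have inj: "i = j \<and> x = y" if "g i x = g j y" "i < N" "j < N" "x \<in> B" "y \<in> B" for i j x y
    using towerD(4)[OF tower that(2,3,4,5,1)] .
  define X where "X = (\<Union>i<N. g i ` B)"
  have X: "X \<in> sets M" "measure M X = 1"
    unfolding X_def using tower_visits(2)[OF tower B] tower_full[OF tower] by blast+
  have g_space: "g i x \<in> space M" "(x, g i x) \<in> E" if "i < N" "x \<in> B" for i x
    using rel_space[OF towerD(3)[OF tower that(1)], of x "g i x"] relD(2)[OF towerD(3)[OF tower that(1)]] that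
    by (auto simp: tower_graph_def)
  define Y where "Y j = {(g i b, g ((i + j) mod N) b) |i b. i < N \<and> b \<in> B}" for j
  \<comment> \<open>The cyclic shift by \<open>j\<close> levels is extended by the identity off the
    tower to reach an element of the full group. There all \<open>V j\<close> coincide, but only on
    a null set, which disjointness of symmetric vertices tolerates.\<close>
  define V where "V j = Y j \<union> Id_on (space M - X)" for j
  have Y_X: "y \<in> X" "z \<in> X" if "(y, z) \<in> Y j" for y z j
    using that N unfolding Y_def X_def by (auto intro: mod_less_divisor)
  have relY: "rel (Y j)" for j
  proof -
    have eq: "Y j = (\<Union>i\<in>{..<N}. (tower_graph B (g i))\<inverse> O tower_graph B (g ((i + j) mod N)))"
      unfolding Y_def tower_graph_def by blast
    have "rel ((tower_graph B (g i))\<inverse> O tower_graph B (g ((i + j) mod N)))" if "i < N" for i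
      using that N by (intro rel_comp rel_converse towerD(3)[OF tower]) auto
    then show ?thesis unfolding eq rel_def by (auto intro!: sets.finite_UN)
  qed
  have paY: "pa (Y j)" for j
    unfolding pa_def
  proof (intro conjI relY)
    show "single_valued (Y j)"
      by (rule single_valuedI) (auto simp: Y_def dest: inj)
    show "single_valued ((Y j)\<inverse>)"
    proof (rule single_valuedI, unfold converse_iff)
      fix x y z assume "(y, x) \<in> Y j" "(z, x) \<in> Y j"
      then obtain i b k c where *: "y = g i b" "z = g k c" "x = g ((i + j) mod N) b" "x = g ((k + j) mod N) c"
        "i < N" "k < N" "b \<in> B" "c \<in> B" unfolding Y_def by blast
      then have "(i + j) mod N = (k + j) mod N \<and> b = c" using inj[of "(i + j) mod N" b "(k + j) mod N" c] N by simp
      then show "y = z" using * mod_shift_inj by blast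
    qed
  qed
  have dom: "Domain (Y j) = X" "Range (Y j) = X" for j
  proof -
    show "Domain (Y j) = X" unfolding Y_def X_def by blast
    have "z \<in> Range (Y j)" if z: "z \<in> X" for z
    proof -
      obtain m b where m: "m < N" "b \<in> B" "z = g m b" using z by (auto simp: X_def)
      obtain i where "i < N" "(i + j) mod N = m" using mod_shift_surj[OF m(1)] by blast
      then show ?thesis using m unfolding Y_def by blast
    qed
    then show "Range (Y j) = X" using Y_X by blast
  qed
  have relI: "rel (Id_on (space M - X))" using X by (intro rel_Id_on) auto
  have paV: "pa (V j)" for j
    unfolding V_def using relI dom
    by (intro pa_Un paY) (auto simp: pa_def single_valued_def)
  have Xsp: "X \<subseteq> space M" using sets.sets_into_space[OF X(1)] .
  have domV: "Domain (V j) = space M" "Range (V j) = space M" for j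
  proof -
    have "Domain (V j) = X \<union> (space M - X)" "Range (V j) = X \<union> (space M - X)"
      using dom[of j] by (auto simp: V_def Domain_Un_eq Range_Un_eq)
    then show "Domain (V j) = space M" "Range (V j) = space M" using Xsp by auto
  qed
  have symV: "V j \<in> symmetric_vertices M R" for j
  proof -
    obtain f where f: "\<And>x y. (x, y) \<in> V j \<longleftrightarrow> x \<in> Domain (V j) \<and> y = f x"
      using pa_function[OF paV] by blast
    have "V j \<subseteq> R" using relD(2)[OF paD(1)[OF paV]] R by blast
    note pf = pa_partial_automorphism[OF paV f this]
    have "f ` Domain (V j) = Range (V j)" using f by auto
    then have "f \<in> full_group M R" using pf(1) unfolding domV full_group_def by blast
    then show ?thesis using pf(2) domV by (auto simp: symmetric_vertices_def)
  qed
  have V_X: "(g i b, z) \<in> V j \<longleftrightarrow> z = g ((i + j) mod N) b" if "i < N" "b \<in> B" for i b z j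
  proof -
    have "g i b \<in> X" using that by (auto simp: X_def)
    then have "(g i b, z) \<in> V j \<longleftrightarrow> (g i b, z) \<in> Y j" by (auto simp: V_def)
    also have "\<dots> \<longleftrightarrow> z = g ((i + j) mod N) b" using that inj unfolding Y_def by blast
    finally show ?thesis .
  qed
  have V_inj: "j = k" if jk: "j < N" "k < N" "(y, z) \<in> V j" "(y, z) \<in> V k" "y \<in> X" for j k y z
  proof -
    obtain i b where i: "i < N" "b \<in> B" "y = g i b" using jk(5) by (auto simp: X_def)
    have "z = g ((i + j) mod N) b" "z = g ((i + k) mod N) b"
      using jk(3,4) V_X[OF i(1,2)] i(3) by simp_all
    then have "g ((i + j) mod N) b = g ((i + k) mod N) b" by simp
    then have "(i + j) mod N = (i + k) mod N" using inj[of "(i + j) mod N" b "(i + k) mod N" b] N i by simp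
    then show ?thesis using mod_shift_inj[of j i N k] jk by (simp add: add.commute)
  qed
  define A where "A = V ` {..<N}"
  have Bne: "B \<noteq> {}" using mB by auto
  have inj_V: "inj_on V {..<N}"
  proof (rule inj_onI)
    fix j k assume jk: "j \<in> {..<N}" "k \<in> {..<N}" "V j = V k"
    obtain b where b: "b \<in> B" using Bne by blast
    have "(g 0 b, g ((0 + j) mod N) b) \<in> V j" using V_X[of 0 b] N b by blast
    moreover have "g 0 b \<in> X" using N b by (auto simp: X_def)
    ultimately show "j = k" using V_inj jk by auto
  qed
  then have cardA: "card A = N" by (simp add: A_def card_image)
  have nullX: "space M - X \<in> null_sets M" using X by (intro null_sets_measure) (auto simp: prob_compl)
  have "A \<in> disjoint_symmetric_families M R"
  proof -
    have "rel_null M R (V j \<inter> V k)" if "j < N" "k < N" "V j \<noteq> V k" for j k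
    proof -
      have "V j \<inter> V k \<subseteq> (space M - X) \<times> UNIV"
      proof (rule subrelI)
        fix y z assume "(y, z) \<in> V j \<inter> V k"
        then have yz: "(y, z) \<in> V j" "(y, z) \<in> V k" by blast+
        have "y \<notin> X" using V_inj[OF that(1,2) yz] that(3) by blast
        then show "(y, z) \<in> (space M - X) \<times> UNIV" using yz(1) domV(1)[of j] by blast
      qed
      moreover have rVV: "rel (V j \<inter> V k)" by (intro rel_Int paD(1) paV)
      ultimately have "mass (V j \<inter> V k) = 0" using nullX by (intro mass_null)
      moreover have "V j \<inter> V k \<subseteq> R" using relD(2)[OF rVV] R by blast
      ultimately show ?thesis
        using relD(1)[OF rVV] unfolding rel_null_def
        by (intro bexI[of _ "V j \<inter> V k"]) (simp_all add: rel_measure_eq_mass)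
    qed
    then show ?thesis
      using N symV by (auto simp: disjoint_symmetric_families_def A_def pairwise_def)
  qed
  then have "isoperimetric_const_wrt M R (T \<union> \<psi>) \<le> edge_measure M (edge_boundary R (T \<union> \<psi>) A) / of_nat (card A)"
    unfolding isoperimetric_const_wrt_def by (rule INF_lower)
  also have "\<dots> \<le> ennreal (2 + 2 * (N * measure M (Domain \<psi>))) / of_nat (card A)"
  proof (rule divide_right_mono_ennreal)
    let ?c = "emeasure (count_space UNIV)"
    \<comment> \<open>These record the vertices of the column at which an edge of
      \<open>\<psi>\<close> starts or ends. As \<open>V j\<close> is onto and preserves the measure,
      each has the mass of \<open>Domain \<psi>\<close>; \<open>N\<close> shifts and two directions
      give the factor \<open>2 * N\<close>, and the top and bottom of the column give the constant
      2.\<close>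
    let ?V1 = "\<lambda>j. V j \<inter> UNIV \<times> Domain \<psi>" and ?V2 = "\<lambda>j. V j \<inter> UNIV \<times> Range \<psi>"
    have D\<psi>: "Domain \<psi> \<in> sets M" "Range \<psi> \<in> sets M" using Domain_sets Range_sets paD(1)[OF \<psi>] by auto
    have rel1: "rel (?V1 j)" "rel (?V2 j)" for j
      by (intro rel_Int_snd paD(1)[OF paV] D\<psi>)+
    have mass1: "mass (?V1 j) = measure M (Domain \<psi>)" "mass (?V2 j) = measure M (Domain \<psi>)" for j
    proof -
      have pa1: "pa (?V1 j)" "pa (?V2 j)" by (rule pa_subset[OF paV rel1(1) Int_lower1], rule pa_subset[OF paV rel1(2) Int_lower1])
      have "Domain \<psi> \<subseteq> space M" "Range \<psi> \<subseteq> space M" using D\<psi> sets.sets_into_space by blast+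
      then have "Range (?V1 j) = Domain \<psi>" "Range (?V2 j) = Range \<psi>" using domV(2)[of j] by blast+
      then show "mass (?V1 j) = measure M (Domain \<psi>)" "mass (?V2 j) = measure M (Domain \<psi>)"
        using mass_pa[OF pa1(1)] mass_pa[OF pa1(2)] pa_measure[OF pa1(1)] pa_measure[OF pa1(2)] pa_measure[OF \<psi>]
        by (simp_all add: emeasure_eq_measure)
    qed
    have AE: "AE x in M. ?c (edge_fibre (edge_boundary R (T \<union> \<psi>) A) x) \<le>
        2 + ((\<Sum>j<N. deg (?V1 j) x) + (\<Sum>j<N. deg (?V2 j) x))"
    proof -
      have "AE x in M. x \<in> X" "AE x in M. x \<in> Z" using X Z by (simp_all add: prob_eq_1)
      then show ?thesis
      proof eventually_elim
        case (elim x)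
        obtain i b where x: "i < N" "b \<in> B" "x = g i b" using elim by (auto simp: X_def)
        have col: "(x, y) \<in> \<Union>A \<longleftrightarrow> (\<exists>j<N. y = g j b)" for y
        proof
          assume "(x, y) \<in> \<Union>A"
          then obtain j where "(x, y) \<in> V j" by (auto simp: A_def)
          then have "y = g ((i + j) mod N) b" using V_X x by blast
          then show "\<exists>j<N. y = g j b" using N by (intro exI[of _ "(i + j) mod N"]) auto
        next
          assume "\<exists>j<N. y = g j b"
          then obtain m where m: "m < N" "y = g m b" by blast
          obtain j where j: "j < N" "(j + i) mod N = m" using mod_shift_surj[OF m(1)] by blast
          then have "(x, y) \<in> V j" using V_X[OF x(1,2)] x(3) m(2) by (simp add: add.commute)
          then show "(x, y) \<in> \<Union>A" using j(1) by (auto simp: A_def)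
        qed
        have T_in: "(g j b, g (Suc j) b) \<in> T" if "Suc j < N" for j
          using T(2)[OF x(2,1) _ that] elim x(3) by blast
        define e1 where "e1 = {((x, y), (x, z)) |y z. (y, z) \<in> T \<and> (x, y) \<in> \<Union>A \<and> (x, z) \<notin> \<Union>A}"
        define e2 where "e2 = {((x, y), (x, z)) |y z. (y, z) \<in> T \<and> (x, y) \<notin> \<Union>A \<and> (x, z) \<in> \<Union>A}"
        define f1 where "f1 j = {((x, y), (x, z)) |y z. (y, z) \<in> \<psi> \<and> (x, y) \<in> V j}" for j
        define f2 where "f2 j = {((x, y), (x, z)) |y z. (y, z) \<in> \<psi> \<and> (x, z) \<in> V j}" for j
        have sub: "edge_fibre (edge_boundary R (T \<union> \<psi>) A) x \<subseteq> (e1 \<union> e2) \<union> ((\<Union>j<N. f1 j) \<union> (\<Union>j<N. f2 j))"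
          unfolding edge_fibre_def edge_boundary_def cayley_edges_def e1_def e2_def f1_def f2_def A_def by auto
        have top: "y = g (N - 1) b" if yz: "(y, z) \<in> T" "(x, y) \<in> \<Union>A" "(x, z) \<notin> \<Union>A" for y z
        proof -
          obtain j where j: "j < N" "y = g j b" using yz(2) col[of y] by blast
          have "\<not> Suc j < N"
          proof
            assume lt: "Suc j < N"
            then have "z = g (Suc j) b" using T_in[OF lt] yz(1) j(2) paD(2)[OF T(1)] by (auto dest: single_valuedD)
            then have "(x, z) \<in> \<Union>A" using col[of z] lt by blast
            then show False using yz(3) by blast
          qed
          then have "j = N - 1" using j by simp
          then show ?thesis using j by simp
        qed
        have bottom: "z = g 0 b" if yz: "(y, z) \<in> T" "(x, y) \<notin> \<Union>A" "(x, z) \<in> \<Union>A" for y z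
        proof -
          obtain j where j: "j < N" "z = g j b" using yz(3) col[of z] by blast
          have "j = 0"
          proof (rule ccontr)
            assume "j \<noteq> 0"
            then obtain k where k: "j = Suc k" by (cases j) auto
            then have "y = g k b"
              using T_in[of k] yz(1) j paD(3)[OF T(1)] by (auto dest: single_valuedD)
            moreover have "k < N" using j(1) k by simp
            ultimately have "(x, y) \<in> \<Union>A" using col[of y] by blast
            then show False using yz(2) by blast
          qed
          then show ?thesis using j by simp
        qed
        have c1: "?c e1 \<le> 1"
        proof (rule count_le_1)
          fix p q assume "p \<in> e1" "q \<in> e1"
          then obtain y z y' z' where "p = ((x, y), (x, z))" "q = ((x, y'), (x, z'))" "(y, z) \<in> T" "(y', z') \<in> T"
            "y = g (N - 1) b" "y' = g (N - 1) b" unfolding e1_def using top by blast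
          then show "p = q" using paD(2)[OF T(1)] by (auto dest: single_valuedD)
        qed
        have c2: "?c e2 \<le> 1"
        proof (rule count_le_1)
          fix p q assume "p \<in> e2" "q \<in> e2"
          then obtain y z y' z' where "p = ((x, y), (x, z))" "q = ((x, y'), (x, z'))" "(y, z) \<in> T" "(y', z') \<in> T"
            "z = g 0 b" "z' = g 0 b" unfolding e2_def using bottom by blast
          then show "p = q" using paD(3)[OF T(1)] by (auto dest: single_valuedD)
        qed
        have c3: "?c (f1 j) \<le> deg (?V1 j) x" for j
        proof (cases "f1 j = {}")
          case False
          then have "x \<in> Domain (?V1 j)" unfolding f1_def by blast
          then have "deg (?V1 j) x = 1"
            using deg_single_valued[of "?V1 j" x] single_valued_subset[OF _ paD(2)[OF paV[of j]], of "?V1 j"] by simp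
          moreover have "?c (f1 j) \<le> 1"
          proof (rule count_le_1)
            fix p q assume "p \<in> f1 j" "q \<in> f1 j"
            then obtain y z y' z' where "p = ((x, y), (x, z))" "q = ((x, y'), (x, z'))" "(y, z) \<in> \<psi>" "(y', z') \<in> \<psi>"
              "(x, y) \<in> V j" "(x, y') \<in> V j" unfolding f1_def by blast
            then show "p = q" using paD(2)[OF \<psi>] paD(2)[OF paV[of j]] by (auto dest: single_valuedD)
          qed
          ultimately show ?thesis by simp
        qed simp
        have c4: "?c (f2 j) \<le> deg (?V2 j) x" for j
        proof (cases "f2 j = {}")
          case False
          then have "x \<in> Domain (?V2 j)" unfolding f2_def by blast
          then have "deg (?V2 j) x = 1"
            using deg_single_valued[of "?V2 j" x] single_valued_subset[OF _ paD(2)[OF paV[of j]], of "?V2 j"] by simp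
          moreover have "?c (f2 j) \<le> 1"
          proof (rule count_le_1)
            fix p q assume "p \<in> f2 j" "q \<in> f2 j"
            then obtain y z y' z' where *: "p = ((x, y), (x, z))" "q = ((x, y'), (x, z'))" "(y, z) \<in> \<psi>" "(y', z') \<in> \<psi>"
              "(x, z) \<in> V j" "(x, z') \<in> V j" unfolding f2_def by blast
            then have "z = z'" using paD(2)[OF paV[of j]] by (auto dest: single_valuedD)
            then show "p = q" using * paD(3)[OF \<psi>] by (auto dest: single_valuedD)
          qed
          ultimately show ?thesis by simp
        qed simp
        have "?c (edge_fibre (edge_boundary R (T \<union> \<psi>) A) x) \<le> ?c ((e1 \<union> e2) \<union> ((\<Union>j<N. f1 j) \<union> (\<Union>j<N. f2 j)))"
          using sub by (intro emeasure_mono) auto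
        also have "\<dots> \<le> ?c (e1 \<union> e2) + ?c ((\<Union>j<N. f1 j) \<union> (\<Union>j<N. f2 j))"
          by (intro emeasure_subadditive) auto
        also have "?c (e1 \<union> e2) \<le> ?c e1 + ?c e2" by (intro emeasure_subadditive) auto
        also have "?c e1 + ?c e2 \<le> 1 + 1" using c1 c2 by (rule add_mono)
        also have "?c ((\<Union>j<N. f1 j) \<union> (\<Union>j<N. f2 j)) \<le> ?c (\<Union>j<N. f1 j) + ?c (\<Union>j<N. f2 j)"
          by (intro emeasure_subadditive) auto
        also have "?c (\<Union>j<N. f1 j) \<le> (\<Sum>j<N. ?c (f1 j))" by (intro emeasure_subadditive_finite) auto
        also have "?c (\<Union>j<N. f2 j) \<le> (\<Sum>j<N. ?c (f2 j))" by (intro emeasure_subadditive_finite) auto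
        also have "(\<Sum>j<N. ?c (f1 j)) \<le> (\<Sum>j<N. deg (?V1 j) x)" using c3 by (intro sum_mono)
        also have "(\<Sum>j<N. ?c (f2 j)) \<le> (\<Sum>j<N. deg (?V2 j) x)" using c4 by (intro sum_mono)
        finally show ?case by (simp add: add_mono)
      qed
    qed
    have "edge_measure M (edge_boundary R (T \<union> \<psi>) A) \<le>
        (\<integral>\<^sup>+x. 2 + ((\<Sum>j<N. deg (?V1 j) x) + (\<Sum>j<N. deg (?V2 j) x)) \<partial>M)"
      unfolding edge_measure_def using AE by (rule nn_integral_mono_AE)
    also have "\<dots> = 2 + ((\<Sum>j<N. mass (?V1 j)) + (\<Sum>j<N. mass (?V2 j)))"
      unfolding mass_def using deg_measurable rel1
      by (simp add: nn_integral_add nn_integral_sum emeasure_space_1)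
    also have "\<dots> = ennreal (2 + 2 * (N * measure M (Domain \<psi>)))"
      unfolding mass1 by (simp add: ennreal_of_nat_eq_real_of_nat ennreal_mult[symmetric] ennreal_plus[symmetric]
          ennreal_numeral[symmetric] del: ennreal_plus ennreal_numeral)
    finally show "edge_measure M (edge_boundary R (T \<union> \<psi>) A) \<le> ennreal (2 + 2 * (N * measure M (Domain \<psi>)))" .
  qed
  also have "\<dots> = ennreal ((2 + 2 * (N * measure M (Domain \<psi>))) / N)"
    unfolding cardA ennreal_of_nat_eq_real_of_nat using N by (intro divide_ennreal) auto
  also have "(2 + 2 * (N * measure M (Domain \<psi>))) / N = 2 / N + 2 * measure M (Domain \<psi>)"
    using N by (simp add: field_simps)
  finally show ?thesis .
qed

lemma measured_equiv_rel_generated: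
  assumes Q: "rel Q"
  shows "measured_equiv_rel M (generated_rel M Q)"
  unfolding measured_equiv_rel_def
proof (intro conjI ballI)
  have G: "rel (generated_rel M Q)" using Q by (rule rel_generated)
  show "equiv (space M) (generated_rel M Q)" by (rule equiv_generated)
  show "generated_rel M Q \<in> sets (M \<Otimes>\<^sub>M M)" using relD(1)[OF G] .
  show "countable (generated_rel M Q `` {x})" for x
    by (rule countable_subset[OF _ E_countable[of x]]) (use relD(2)[OF G] in blast)
  fix N assume N: "N \<in> null_sets M"
  have "generated_rel M Q `` N \<in> sets M" using G N by (intro Image_sets) auto
  moreover have "generated_rel M Q `` N \<subseteq> E `` N" using relD(2)[OF G] by blast
  ultimately show "generated_rel M Q `` N \<in> null_sets M"
    using null_sets_subset[OF Image_null[OF N]] by blast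
qed

text \<open>The fibre of the Cayley graph over \<open>x\<close> embeds into \<open>Q\<close> by
  \<open>snd\<close>, as all its vertices share the first coordinate \<open>x\<close>. A simple
  cycle in the fibre would thus project to one in \<open>Q\<close>.\<close>

lemma subtreeing_forest:
  assumes Q: "rel Q" "forest Q" and R: "E \<subseteq> R"
  shows "subtreeing M R Q"
proof -
  let ?S = "generated_rel M Q"
  have "rel_null M ?S (?S - ?S)"
    unfolding rel_null_def
    by (intro bexI[of _ "{}"]) (auto simp: rel_measure_def)
  moreover have "Q \<subseteq> ?S" using rel_space[OF Q(1)] by (auto simp: generated_rel_def)
  ultimately have "graphing M ?S Q" using relD(1)[OF Q(1)] by (simp add: graphing_def)
  moreover have "forest (edge_fibre (cayley_edges ?S Q) x)" for x
    unfolding forest_def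
  proof
    let ?C = "edge_fibre (cayley_edges ?S Q) x"
    assume "\<exists>vs. simple_cycle ?C vs"
    then obtain vs where vs: "length vs \<notin> {0, 2}" "distinct vs"
      "\<And>i. i < length vs \<Longrightarrow> (vs ! i, vs ! (Suc i mod length vs)) \<in> ?C \<union> ?C\<inverse>"
      unfolding simple_cycle_def by blast
    have C: "fst v = x \<and> fst w = x \<and> (snd v, snd w) \<in> Q" if "(v, w) \<in> ?C" for v w
      using that unfolding edge_fibre_def cayley_edges_def by auto
    have "fst v = x" if v: "v \<in> set vs" for v
    proof -
      obtain i where "i < length vs" "v = vs ! i" using v by (auto simp: in_set_conv_nth)
      then show ?thesis using vs(3)[of i] C by blast
    qed
    then have "inj_on snd (set vs)" by (intro inj_onI prod_eqI) auto
    moreover have "(map snd vs ! i, map snd vs ! (Suc i mod length vs)) \<in> Q \<union> Q\<inverse>" if i: "i < length vs" for i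
    proof -
      have "Suc i mod length vs < length vs" using i by (intro mod_less_divisor) auto
      moreover have "(snd (vs ! i), snd (vs ! (Suc i mod length vs))) \<in> Q \<union> Q\<inverse>"
        using vs(3)[OF i] C by blast
      ultimately show ?thesis using i by simp
    qed
    ultimately have "simple_cycle Q (map snd vs)"
      using vs(1,2) by (simp add: simple_cycle_def distinct_map)
    then show False using Q(2) by (auto simp: forest_def)
  qed
  ultimately have "treeing M ?S Q" by (simp add: treeing_def)
  moreover have "?S \<subseteq> R" using relD(2)[OF rel_generated[OF Q(1)]] R by blast
  ultimately show ?thesis
    using measured_equiv_rel_generated[OF Q(1)] unfolding subtreeing_def by blast
qed

lemma finite_graphing_Un:
  assumes T: "pa T" and \<psi>: "pa \<psi>" and R: "E \<subseteq> R" and gr: "graphing M R (T \<union> \<psi>)"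
  shows "finite_graphing M R (T \<union> \<psi>)"
  unfolding finite_graphing_def
proof (intro conjI gr exI[of _ "{T, \<psi> - T} - {{}}"] ballI)
  show "partition_on (T \<union> \<psi>) ({T, \<psi> - T} - {{}})"
    by (rule partition_onI) (auto simp: disjnt_def)
  fix W assume "W \<in> {T, \<psi> - T} - {{}}"
  then have "W = T \<or> W = \<psi> - T" by blast
  moreover have "pa (\<psi> - T)"
    using paD(1)[OF T] paD(1)[OF \<psi>] by (intro pa_subset[OF \<psi>] rel_Diff) auto
  ultimately have W: "pa W" using T by blast
  obtain f where f: "\<And>x y. (x, y) \<in> W \<longleftrightarrow> x \<in> Domain W \<and> y = f x"
    using pa_function[OF W] by blast
  have "W \<subseteq> R" using relD(2)[OF paD(1)[OF W]] R by blast
  then show "\<exists>A f. partial_automorphism M R A f \<and> W = fun_graph A f"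
    using pa_partial_automorphism[OF W f] by blast
qed auto

end

context ergodic_crel
begin

text \<open>For each tolerance there is a finite graphing formed by \<open>T\<close> and a partial
  automorphism of small domain; a tall enough tower of the same \<open>T\<close> then supplies a
  family of symmetric vertices with small boundary.\<close>

lemma isoperimetric_const_zero:
  fixes C :: "nat \<Rightarrow> 'a set"
  assumes gen: "Int_stable (range C)" "range C \<subseteq> Pow (space M)" "sets M = sigma_sets (space M) (range C)"
    and R: "E \<subseteq> R" "R \<in> sets (M \<Otimes>\<^sub>M M)" and N0: "N0 \<in> null_sets M" "R - E \<subseteq> N0 \<times> UNIV"
    and light: "\<And>Q. rel Q \<Longrightarrow> forest Q \<Longrightarrow> Q \<inter> Q\<inverse> = {} \<Longrightarrow> mass Q \<le> 1"
  shows "isoperimetric_const M R = 0"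
proof -
  obtain T where T: "pa T" "measure M (Domain T) = 1" "forest T" "T \<inter> T\<inverse> = {}"
    "ergodic_rel M (generated_rel M T)"
    and towers: "\<And>n. \<exists>N\<ge>n. \<exists>B g. tower N B g \<and> (\<exists>Z\<in>sets M. measure M Z = 1 \<and>
       (\<forall>x\<in>B. \<forall>i<N. g i x \<in> Z \<longrightarrow> (\<forall>j. Suc j < N \<longrightarrow> (g j x, g (Suc j) x) \<in> T)))"
    using ergodic_path_exists[OF gen] by blast
  have graphing: "\<exists>\<psi>. pa \<psi> \<and> measure M (Domain \<psi>) \<le> \<epsilon> \<and> finite_graphing M R (T \<union> \<psi>)"
    if \<epsilon>: "0 < \<epsilon>" "\<epsilon> \<le> 1" for \<epsilon>
  proof -
    have "\<forall>n. \<exists>G. pa G \<and> G \<subseteq> \<Phi> n \<and> measure M (Domain G) < \<epsilon> / 2 ^ Suc n \<and>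
      \<Phi> n \<subseteq> linked (T \<union> G)"
      using \<epsilon>(1) by (intro allI thin_edges T light pa_\<Phi>) auto
    then obtain G where G: "\<And>n. pa (G n)" "\<And>n. measure M (Domain (G n)) < \<epsilon> / 2 ^ Suc n"
      "\<And>n. \<Phi> n \<subseteq> linked (T \<union> G n)" by metis
    obtain \<psi> N where \<psi>: "pa \<psi>" "measure M (Domain \<psi>) \<le> \<epsilon>" "N \<in> null_sets M"
      "\<And>n x y. (x, y) \<in> G n \<Longrightarrow> x \<notin> N \<Longrightarrow> y \<notin> N \<Longrightarrow> (x, y) \<in> linked (T \<union> \<psi>)"
      using pack_edges[OF paD(1)[OF T(1)] T(5) G(1,2) \<epsilon>] by metis
    let ?K = "(T \<union> \<psi>) \<union> (T \<union> \<psi>)\<inverse>"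
    have K: "rel (T \<union> \<psi>)" using paD(1) T(1) \<psi>(1) by (intro rel_Un)
    \<comment> \<open>The path through \<open>T \<union> G n\<close> must avoid \<open>N\<close> at
      every vertex. This is why the saturation of \<open>N\<close> is excluded for \<open>x\<close>
      and why membership in \<open>E\<close> is carried along the path.\<close>
    have conn: "(x, y) \<in> ?K\<^sup>*" if xy: "(x, y) \<in> E" "x \<notin> E `` N" for x y
    proof -
      obtain n where n: "(x, y) \<in> \<Phi> n" using xy UN_\<Phi> by blast
      have "(x, y) \<in> linked (T \<union> G n)" using G(3) n by blast
      then have "(x, y) \<in> ?K\<^sup>* \<and> (x, y) \<in> E"
      proof induction
        case base
        then show ?case using xy E_space E_refl by blast
      next
        case (step y z)
        have G_sub: "T \<union> G n \<subseteq> E" using relD(2) paD(1) T(1) G(1) by blast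
        then have yzE: "(y, z) \<in> E" using step(2) E_sym by blast
        have xz: "(x, z) \<in> E" using step(3) yzE E_trans by blast
        have out: "y \<notin> N" "z \<notin> N" using xy(2) step(3) xz E_sym by blast+
        have "(y, z) \<in> ?K\<^sup>*"
          using step(2) \<psi>(4)[OF _ out] linked_sym[OF \<psi>(4)[OF _ out(2,1)]] by blast
        then show ?case using step(3) xz by (meson rtrancl_trans)
      qed
      then show ?thesis by blast
    qed
    have sub: "R - generated_rel M (T \<union> \<psi>) \<subseteq> (N0 \<union> E `` N) \<times> UNIV"
      using conn N0(2) E_space unfolding generated_rel_def by blast
    have R_gen: "R - generated_rel M (T \<union> \<psi>) \<in> sets (M \<Otimes>\<^sub>M M)"
      using R(2) relD(1)[OF rel_generated[OF K]] by auto
    have "deg (R - generated_rel M (T \<union> \<psi>)) x = 0" if "x \<notin> N0 \<union> E `` N" for x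
    proof -
      have "(R - generated_rel M (T \<union> \<psi>)) `` {x} = {}" using sub that by blast
      then show ?thesis by simp
    qed
    then have "AE x in M. deg (R - generated_rel M (T \<union> \<psi>)) x = 0"
      using null_sets.Un[OF N0(1) Image_null[OF \<psi>(3)]] by (intro AE_I') blast+
    then have "mass (R - generated_rel M (T \<union> \<psi>)) = (\<integral>\<^sup>+x. 0 \<partial>M)"
      unfolding mass_def by (rule nn_integral_cong_AE)
    then have "rel_measure M R (R - generated_rel M (T \<union> \<psi>)) = 0"
      by (subst rel_measure_eq_mass) auto
    then have "rel_null M R (R - generated_rel M (T \<union> \<psi>))"
      using R_gen unfolding rel_null_def by blast
    then have "graphing M R (T \<union> \<psi>)"
      using relD[OF K] R(1) by (auto simp: graphing_def)
    then have "finite_graphing M R (T \<union> \<psi>)" using finite_graphing_Un[OF T(1) \<psi>(1) R(1)] by blast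
    then show ?thesis using \<psi>(1,2) by blast
  qed
  have "isoperimetric_const_fg M R \<le> 0 + ennreal e" if e: "e > 0" for e :: real
  proof -
    \<comment> \<open>The bound \<open>2 / N + 2 * measure M (Domain \<psi>)\<close> is split
      evenly: \<open>\<epsilon> \<le> e / 4\<close> makes the second term at most
      \<open>e / 2\<close>, and \<open>N > 4 / e\<close> the first. The cap 1 is required for
      packing the edges.\<close>
    define \<epsilon> where "\<epsilon> = min 1 (e / 4)"
    have \<epsilon>: "0 < \<epsilon>" "\<epsilon> \<le> 1" "\<epsilon> \<le> e / 4" using e by (auto simp: \<epsilon>_def)
    obtain \<psi> where \<psi>: "pa \<psi>" "measure M (Domain \<psi>) \<le> \<epsilon>" "finite_graphing M R (T \<union> \<psi>)"
      using graphing[OF \<epsilon>(1,2)] by blast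
    obtain n :: nat where n: "4 / e < n" using reals_Archimedean2 by blast
    obtain N B g Z where N: "n \<le> N" "tower N B g" "Z \<in> sets M" "measure M Z = 1"
      "\<And>x i j. x \<in> B \<Longrightarrow> i < N \<Longrightarrow> g i x \<in> Z \<Longrightarrow> Suc j < N \<Longrightarrow> (g j x, g (Suc j) x) \<in> T"
      using towers[of n] by blast
    have "isoperimetric_const_fg M R \<le> isoperimetric_const_wrt M R (T \<union> \<psi>)"
      unfolding isoperimetric_const_fg_def using \<psi>(3) by (intro INF_lower) simp
    also have "\<dots> \<le> ennreal (2 / N + 2 * measure M (Domain \<psi>))"
      using tower_isoperimetric_bound[OF N(2,3,4) T(1) N(5) \<psi>(1) R(1)] .
    also have "\<dots> \<le> ennreal e"
    proof (rule ennreal_leI)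
      have "real n > 0" using n e by (meson divide_pos_pos less_trans zero_less_numeral)
      then have "2 / real N \<le> 2 / real n" using N(1) by (intro divide_left_mono) auto
      also have "\<dots> \<le> e / 2" using n e \<open>real n > 0\<close> by (simp add: field_simps)
      finally show "2 / real N + 2 * measure M (Domain \<psi>) \<le> e" using \<psi>(2) \<epsilon>(3) by linarith
    qed
    finally show ?thesis by simp
  qed
  then have "isoperimetric_const_fg M R \<le> 0" by (rule ennreal_le_epsilon)
  moreover have "finitely_generated_rel M R"
    using graphing[of 1] unfolding finitely_generated_rel_def by auto
  ultimately show ?thesis by (simp add: isoperimetric_const_def)
qed

end

theorem corollary15:
  fixes M :: "'a measure" and R :: "('a \<times> 'a) set"
  assumes "standard_non_atomic_prob_space M"
    and "measured_equiv_rel M R"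
    and "ergodic_rel M R"
    and "type_II1 M R"
    and "uniformly_non_amenable M R"
  shows "\<exists>F. non_amenable_subtreeing M R F"
proof (rule ccontr)
  assume none: "\<nexists>F. non_amenable_subtreeing M R F"
  obtain d D where "polish_prob_space M d D"
    using assms(1) polish_prob_space_exists unfolding standard_non_atomic_prob_space_def by blast
  then interpret polish_prob_space M d D .
  have eq: "equiv (space M) R" and Rm [measurable]: "R \<in> sets (M \<Otimes>\<^sub>M M)"
    and null: "\<And>N. N \<in> null_sets M \<Longrightarrow> R `` N \<in> null_sets M"
    and count: "\<And>x. x \<in> space M \<Longrightarrow> countable (R `` {x})"
    using assms(2) by (auto simp: measured_equiv_rel_def)
  have R_space: "R \<subseteq> space M \<times> space M" using eq by (rule equiv_type)
  have R_refl: "(x, x) \<in> R" if "x \<in> space M" for x using eq that by (meson equivE refl_onD)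
  have R_sym: "(y, x) \<in> R" if "(x, y) \<in> R" for x y using eq that by (meson equivE symD)
  have R_trans: "(x, z) \<in> R" if "(x, y) \<in> R" "(y, z) \<in> R" for x y z using eq that by (meson equivE transD)
  obtain f N where f [measurable]: "\<And>n::nat. f n \<in> M \<rightarrow>\<^sub>M M" and N: "N \<in> null_sets M"
    and fN: "\<And>x y. (x, y) \<in> R \<Longrightarrow> x \<in> N \<or> (\<exists>n. y = f n x)"
    using countable_sections_cov[OF Rm count] unfolding cov_def by blast
  define N0 where "N0 = R `` N"
  have N0: "N0 \<in> null_sets M" unfolding N0_def using N by (rule null)
  then have [measurable]: "N0 \<in> sets M" by auto
  have N_sub: "x \<in> N0" if "x \<in> N" "x \<in> space M" for x using R_refl that by (auto simp: N0_def)
  have N0_inv: "y \<in> N0" if "(x, y) \<in> R" "x \<in> N0" for x y using that R_trans by (auto simp: N0_def)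
  obtain u where u [measurable]: "u \<in> borel_measurable M" and u_inj: "inj_on u (space M)"
    and u_bounds: "\<And>x. 0 \<le> u x \<and> u x < (1::real)"
    using real_label_exists by blast
  obtain C :: "nat \<Rightarrow> 'a set" where C: "Int_stable (range C)" "range C \<subseteq> Pow (space M)"
    "sets M = sigma_sets (space M) (range C)"
    using countable_generator_exists by blast
  \<comment> \<open>Collapsing the classes inside \<open>N0\<close> to points leaves an equivalence
    relation because \<open>N0\<close> is saturated, and it makes the enumeration by measurable maps
    exact everywhere.\<close>
  define E where "E = {(x, y)\<in>R. x \<in> N0 \<longrightarrow> x = y}"
  have ER: "E \<subseteq> R" by (auto simp: E_def)
  interpret crel M E u
  proof unfold_locales
    show "equiv (space M) E"
    proof (rule equivI)
      show "E \<subseteq> space M \<times> space M" using R_space ER by blast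
      show "refl_on (space M) E" using R_refl by (auto simp: refl_on_def E_def)
      show "sym E" using R_sym N0_inv by (auto simp: sym_def E_def)
      show "trans E" using R_trans N0_inv by (auto simp: trans_def E_def)
    qed
    have "E = R \<inter> {p\<in>space (M \<Otimes>\<^sub>M M). fst p \<in> N0 \<longrightarrow> u (fst p) = u (snd p)}"
      using R_space u_inj by (auto simp: E_def space_pair_measure dest: inj_onD)
    also have "\<dots> \<in> sets (M \<Otimes>\<^sub>M M)" by measurable
    finally show "E \<in> sets (M \<Otimes>\<^sub>M M)" .
    show "\<exists>f::nat \<Rightarrow> 'a \<Rightarrow> 'a. (\<forall>n. f n \<in> M \<rightarrow>\<^sub>M M) \<and> E = {(x, f n x) |n x. x \<in> space M}"
    \<comment> \<open>The covering graphs of \<open>cov\<close> may leave \<open>R\<close>; there,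
      and on \<open>N0\<close>, the identity takes their place.\<close>
    proof (intro exI[of _ "\<lambda>n x. if (x, f n x) \<in> R \<and> x \<notin> N0 then f n x else x"] conjI allI)
      show "(\<lambda>x. if (x, f n x) \<in> R \<and> x \<notin> N0 then f n x else x) \<in> M \<rightarrow>\<^sub>M M" for n by measurable
      show "E = {(x, if (x, f n x) \<in> R \<and> x \<notin> N0 then f n x else x) |n x. x \<in> space M}" (is "_ = ?S")
      proof (intro equalityI subrelI)
        fix x y assume xy: "(x, y) \<in> E"
        then have x: "x \<in> space M" "(x, y) \<in> R" using R_space by (auto simp: E_def)
        obtain n where "x \<in> N0 \<or> y = f n x" using fN[OF x(2)] N_sub x(1) by blast
        then have "y = (if (x, f n x) \<in> R \<and> x \<notin> N0 then f n x else x)" using xy by (auto simp: E_def)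
        then show "(x, y) \<in> ?S" using x(1) by blast
      qed (use R_refl in \<open>auto simp: E_def split: if_splits\<close>)
    qed
    show "type_II1 M E"
      unfolding type_II1_def
    proof (intro allI impI)
      fix A h assume "partial_automorphism M E A h"
      then have "partial_automorphism M R A h" using ER by (auto simp: partial_automorphism_def)
      then show "\<forall>B\<in>sets M. B \<subseteq> A \<longrightarrow> emeasure M (h ` B) = emeasure M B"
        using assms(4) by (auto simp: type_II1_def)
    qed
    show "emeasure M {x} = 0" if x: "x \<in> space M" for x
    proof (rule ccontr)
      assume pos: "emeasure M {x} \<noteq> 0"
      have "{x} = {y\<in>space M. u y = u x}" using u_inj x by (auto dest: inj_onD)
      also have "\<dots> \<in> sets M" by measurable
      finally have "{x} \<in> sets M" .
      moreover have "emeasure M {x} > 0" using pos by (simp add: zero_less_iff_neq_zero)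
      ultimately obtain B where "B \<subseteq> {x}" "0 < emeasure M B" "emeasure M B < emeasure M {x}"
        using assms(1) unfolding standard_non_atomic_prob_space_def non_atomic_def by blast
      then show False by (auto simp: subset_singleton_iff)
    qed
  qed (use u_inj u_bounds in auto)
  have "ergodic_rel M E"
    unfolding ergodic_rel_def
  proof (intro ballI impI)
    fix A assume A: "A \<in> sets M" "E `` A = A"
    \<comment> \<open>Off \<open>N0\<close> the relations \<open>E\<close> and \<open>R\<close>
      agree, so removing the null set \<open>N0\<close> from an \<open>E\<close>-invariant set
      leaves an \<open>R\<close>-invariant one.\<close>
    have "R `` (A - N0) = A - N0"
    proof (intro equalityI subsetI)
      fix y assume "y \<in> R `` (A - N0)"
      then obtain x where x: "(x, y) \<in> R" "x \<in> A" "x \<notin> N0" by blast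
      then have "(x, y) \<in> E" by (simp add: E_def)
      then have "y \<in> A" using A(2) x(2) by blast
      moreover have "y \<notin> N0" using N0_inv[OF R_sym[OF x(1)]] x(3) by blast
      ultimately show "y \<in> A - N0" by blast
    next
      fix y assume "y \<in> A - N0"
      then show "y \<in> R `` (A - N0)" using R_refl sets.sets_into_space[OF A(1)] by blast
    qed
    then have "emeasure M (A - N0) = 0 \<or> emeasure M (A - N0) = 1"
      using assms(3) A(1) by (auto simp: ergodic_rel_def)
    then show "emeasure M A = 0 \<or> emeasure M A = 1"
      using emeasure_Diff_null_set[OF N0 A(1)] by simp
  qed
  then interpret ergodic_crel M E u by unfold_locales
  have "mass Q \<le> 1" if Q: "rel Q" "forest Q" "Q \<inter> Q\<inverse> = {}" for Q
  proof (rule hyperfinite_forest_mass_le[OF Q])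
    show "hyperfinite_rel M (generated_rel M Q)"
      using none subtreeing_forest[OF Q(1,2) ER]
      unfolding non_amenable_subtreeing_def non_amenable_rel_def by blast
  qed
  moreover have "R - E \<subseteq> N0 \<times> UNIV" by (auto simp: E_def)
  ultimately have "isoperimetric_const M R = 0"
    using isoperimetric_const_zero[OF C ER Rm N0] by blast
  then show False using assms(5) by (simp add: uniformly_non_amenable_def)
qed

end
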